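(* Let $H$ be a finitely generated free abelian group and let $n\ge 1$. If $n+2=p^k$ is a prime power ($p$ prime, $k\ge 1$), then $p^{k-1}\ker\eta'_n=0$. For example, if $n+2$ is prime, then $\eta'_n:\mathcal{A}^t_n(H)\to\mathsf{D}'_n(H)$ is an isomorphism.
   Context: $\mathcal{A}^t_n(H)$ is the quotient of the free abelian group generated by unitrivalent trees with $n$ trivalent vertices (hence $n+2$ univalent vertices), each trivalent vertex equipped with an orientation (a cyclic ordering of its three incident edges) and each univalent vertex labeled by an element of $H$, by the following relations. (i) Anti-symmetry: $T+T'=0$ if $T'$ is identical with $T$ except that one trivalent vertex has the opposite orientation. (ii) IHX: for rooted labeled oriented trees $A,B,C,D$ let $W(A,B,C,D)$ be the tree with two adjacent trivalent vertices $u,v$ joined by an edge $e$, with $A,B$ attached at $u$ in cyclic order $(A,B,e)$ and $C,D$ attached at $v$ in cyclic order $(e,C,D)$; then $W(A,B,C,D)+W(B,C,A,D)+W(C,A,B,D)=0$. (iii) Linearity: $T=T_1+T_2$ if $T_1,T_2,T$ are identical except that one univalent vertex has labels $a_1,a_2,a_1+a_2\in H$ respectively. A quasi-Lie algebra (over $\mathbb{Z}$) is an abelian group with a bilinear bracket satisfying $[\alpha,\beta]+[\beta,\alpha]=0$ and the Jacobi identity $[[\alpha,\beta],\gamma]+[[\beta,\gamma],\alpha]+[[\gamma,\alpha],\beta]=0$ (the relation $[\alpha,\alpha]=0$ is not required). $\mathsf{L}'(H)=\bigoplus_n\mathsf{L}'_n(H)$ is the free quasi-Lie algebra on $H$, graded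 with $H$ in degree $1$. A unitrivalent tree, each of whose trivalent vertices is equipped with an orientation (a cyclic ordering of its three incident edges), with one univalent vertex unlabeled and designated as the root, and with the other $m$ univalent vertices labeled by elements of $H$, determines an element of $\mathsf{L}'_m(H)$ by iterated bracketing: a trivalent vertex with cyclic order (edge towards the root, first branch, second branch) gives the bracket [first, second]. $\mathsf{D}'_n(H)$ is the kernel of $\beta'_n:H\otimes\mathsf{L}'_{n+1}(H)\to\mathsf{L}'_{n+2}(H)$, $h\otimes\lambda\mapsto[h,\lambda]$. The homomorphism $\eta'_n:\mathcal{A}^t_n(H)\to H\otimes\mathsf{L}'_{n+1}(H)$ is $\eta'_n(T)=\sum_i h_i\otimes[T_i]$, the sum over all univalent vertices of $T$, where $h_i$ is the label of the $i$-th one and $[T_i]\in\mathsf{L}'_{n+1}(H)$ is the element determined by the rooted tree $T_i$ obtained from $T$ by making that vertex the (unlabeled) root. It is known that the image of $\eta'_n$ is exactly $\mathsf{D}'_n(H)$, and $\eta'_n$ is also regarded as a map onto $\mathsf{D}'_n(H)$. *)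

theory Defs
  imports "HOL-Algebra.Free_Abelian_Groups" "HOL-Computational_Algebra.Primes"
begin

text \<open>
  Abelian groups are groups in the sense of HOL-Algebra and are written multiplicatively, except
  that the free abelian group \<^const>\<open>free_Abelian_group\<close> on a set has underlying operation \<open>+\<close>.
\<close>

definition fg_free_abelian :: "('a, 'm) monoid_scheme \<Rightarrow> bool" where
  "fg_free_abelian H \<longleftrightarrow> comm_group H \<and> (\<exists>B :: nat set. finite B \<and> H \<cong> free_Abelian_group B)"


section \<open>Abelian groups given by generators and relations\<close>

definition relators :: "'s set \<Rightarrow> ('s \<Rightarrow>\<^sub>0 int) set \<Rightarrow> ('s \<Rightarrow>\<^sub>0 int) set" where
  "relators S R = generate (free_Abelian_group S) R"

definition presented :: "'s set \<Rightarrow> ('s \<Rightarrow>\<^sub>0 int) set \<Rightarrow> ('s \<Rightarrow>\<^sub>0 int) set monoid" where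
  "presented S R = free_Abelian_group S Mod relators S R"

definition presented_gen :: "'s set \<Rightarrow> ('s \<Rightarrow>\<^sub>0 int) set \<Rightarrow> 's \<Rightarrow> ('s \<Rightarrow>\<^sub>0 int) set" where
  "presented_gen S R s = relators S R #>\<^bsub>free_Abelian_group S\<^esub> frag_of s"

definition free_ext :: "('k, 'm) monoid_scheme \<Rightarrow> ('s \<Rightarrow> 'k) \<Rightarrow> ('s \<Rightarrow>\<^sub>0 int) \<Rightarrow> 'k" where
  "free_ext K f x = finprod K (\<lambda>s. f s [^]\<^bsub>K\<^esub> Poly_Mapping.lookup x s) (Poly_Mapping.keys x)"

text \<open>
  The map on \<^term>\<open>presented S R\<close> induced by \<^term>\<open>f\<close> on the generators. It is meaningful only if
  \<^term>\<open>free_ext K f\<close> is trivial on \<^term>\<open>R\<close>, hence constant on every coset.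
\<close>

definition induced :: "('k, 'm) monoid_scheme \<Rightarrow> ('s \<Rightarrow> 'k) \<Rightarrow> ('s \<Rightarrow>\<^sub>0 int) set \<Rightarrow> 'k" where
  "induced K f X = the_elem (free_ext K f ` X)"


section \<open>Tensor product of abelian groups\<close>

definition tensor_relations ::
  "('a, 'm) monoid_scheme \<Rightarrow> ('b, 'n) monoid_scheme \<Rightarrow> ('a \<times> 'b \<Rightarrow>\<^sub>0 int) set" where
  "tensor_relations G K =
     {frag_of (g \<otimes>\<^bsub>G\<^esub> g', k) - frag_of (g, k) - frag_of (g', k) | g g' k.
        g \<in> carrier G \<and> g' \<in> carrier G \<and> k \<in> carrier K} \<union>
     {frag_of (g, k \<otimes>\<^bsub>K\<^esub> k') - frag_of (g, k) - frag_of (g, k') | g k k'.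
        g \<in> carrier G \<and> k \<in> carrier K \<and> k' \<in> carrier K}"

definition tensor ::
  "('a, 'm) monoid_scheme \<Rightarrow> ('b, 'n) monoid_scheme \<Rightarrow> ('a \<times> 'b \<Rightarrow>\<^sub>0 int) set monoid" where
  "tensor G K = presented (carrier G \<times> carrier K) (tensor_relations G K)"

definition pure_tensor ::
  "('a, 'm) monoid_scheme \<Rightarrow> ('b, 'n) monoid_scheme \<Rightarrow> 'a \<Rightarrow> 'b \<Rightarrow> ('a \<times> 'b \<Rightarrow>\<^sub>0 int) set" where
  "pure_tensor G K g k =
     presented_gen (carrier G \<times> carrier K) (tensor_relations G K) (g, k)"


section \<open>The free quasi-Lie algebra on an abelian group\<close>

text \<open>
  It is the free nonassociative algebra on the set \<^term>\<open>carrier H\<close> modulo the smallest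
  two-sided ideal that makes the inclusion of \<^term>\<open>H\<close> additive and enforces antisymmetry and the
  Jacobi identity. Elements of the algebra are integer combinations of nonassociative words.
\<close>

datatype (letters: 'a) word = Letter 'a | Br "'a word" "'a word"

primrec word_length :: "'a word \<Rightarrow> nat" where
  "word_length (Letter a) = 1"
| "word_length (Br s t) = word_length s + word_length t"

definition words :: "('a, 'm) monoid_scheme \<Rightarrow> 'a word set" where
  "words H = {t. letters t \<subseteq> carrier H}"

definition word_mult :: "('a word \<Rightarrow>\<^sub>0 int) \<Rightarrow> ('a word \<Rightarrow>\<^sub>0 int) \<Rightarrow> ('a word \<Rightarrow>\<^sub>0 int)" where
  "word_mult x y = frag_extend (\<lambda>s. frag_extend (\<lambda>t. frag_of (Br s t)) y) x"

inductive_set quasi_lie_ideal :: "('a, 'm) monoid_scheme \<Rightarrow> ('a word \<Rightarrow>\<^sub>0 int) set"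
  for H :: "('a, 'm) monoid_scheme" where
  additive: "a \<in> carrier H \<Longrightarrow> b \<in> carrier H \<Longrightarrow>
    frag_of (Letter (a \<otimes>\<^bsub>H\<^esub> b)) - frag_of (Letter a) - frag_of (Letter b) \<in> quasi_lie_ideal H"
| antisym: "x \<in> carrier (free_Abelian_group (words H)) \<Longrightarrow>
    y \<in> carrier (free_Abelian_group (words H)) \<Longrightarrow>
    word_mult x y + word_mult y x \<in> quasi_lie_ideal H"
| jacobi: "x \<in> carrier (free_Abelian_group (words H)) \<Longrightarrow>
    y \<in> carrier (free_Abelian_group (words H)) \<Longrightarrow>
    z \<in> carrier (free_Abelian_group (words H)) \<Longrightarrow>
    word_mult (word_mult x y) z + word_mult (word_mult y z) x + word_mult (word_mult z x) y
      \<in> quasi_lie_ideal H"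
| zero: "0 \<in> quasi_lie_ideal H"
| diff: "x \<in> quasi_lie_ideal H \<Longrightarrow> y \<in> quasi_lie_ideal H \<Longrightarrow> x - y \<in> quasi_lie_ideal H"
| mult_left: "x \<in> quasi_lie_ideal H \<Longrightarrow> y \<in> carrier (free_Abelian_group (words H)) \<Longrightarrow>
    word_mult y x \<in> quasi_lie_ideal H"
| mult_right: "x \<in> quasi_lie_ideal H \<Longrightarrow> y \<in> carrier (free_Abelian_group (words H)) \<Longrightarrow>
    word_mult x y \<in> quasi_lie_ideal H"

definition quasi_lie_class ::
  "('a, 'm) monoid_scheme \<Rightarrow> ('a word \<Rightarrow>\<^sub>0 int) \<Rightarrow> ('a word \<Rightarrow>\<^sub>0 int) set" where
  "quasi_lie_class H x = quasi_lie_ideal H #>\<^bsub>free_Abelian_group (words H)\<^esub> x"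

definition quasi_lie :: "('a, 'm) monoid_scheme \<Rightarrow> ('a word \<Rightarrow>\<^sub>0 int) set monoid" where
  "quasi_lie H = free_Abelian_group (words H) Mod quasi_lie_ideal H"

definition quasi_lie_bracket ::
  "('a, 'm) monoid_scheme \<Rightarrow> ('a word \<Rightarrow>\<^sub>0 int) set \<Rightarrow> ('a word \<Rightarrow>\<^sub>0 int) set \<Rightarrow>
     ('a word \<Rightarrow>\<^sub>0 int) set" where
  "quasi_lie_bracket H X Y = (\<Union>x\<in>X. \<Union>y\<in>Y. quasi_lie_class H (word_mult x y))"

definition quasi_lie_incl :: "('a, 'm) monoid_scheme \<Rightarrow> 'a \<Rightarrow> ('a word \<Rightarrow>\<^sub>0 int) set" where
  "quasi_lie_incl H a = quasi_lie_class H (frag_of (Letter a))"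

definition quasi_lie_deg :: "('a, 'm) monoid_scheme \<Rightarrow> nat \<Rightarrow> ('a word \<Rightarrow>\<^sub>0 int) set monoid" where
  "quasi_lie_deg H m = (quasi_lie H)
     \<lparr>carrier := quasi_lie_class H `
        carrier (free_Abelian_group {t \<in> words H. word_length t = m})\<rparr>"


section \<open>Unitrivalent trees\<close>

text \<open>
  A graph is given by its half-edges. Each half-edge emanates from one vertex; \<open>opp\<close> exchanges the
  two halves of an edge, and \<open>nxt\<close> rotates the half-edges at a vertex. Thus edges are the orbits of
  \<open>opp\<close> and vertices are the orbits of \<open>nxt\<close>; the cycles of \<open>nxt\<close> of length three are the cyclic
  orderings at the trivalent vertices, and its fixed points are the univalent vertices. Only the
  values of \<open>opp\<close> and \<open>nxt\<close> on half-edges, and of \<open>lab\<close> on univalent vertices, are relevant.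
\<close>

record 'a utree =
  halves :: "nat set"
  opp :: "nat \<Rightarrow> nat"
  nxt :: "nat \<Rightarrow> nat"
  lab :: "nat \<Rightarrow> 'a"

definition vertex_of :: "('a, 'u) utree_scheme \<Rightarrow> nat \<Rightarrow> nat set" where
  "vertex_of T d = {d, nxt T d, nxt T (nxt T d)}"

definition univalent :: "('a, 'u) utree_scheme \<Rightarrow> nat set" where
  "univalent T = {d \<in> halves T. nxt T d = d}"

definition trivalent_vertices :: "('a, 'u) utree_scheme \<Rightarrow> nat set set" where
  "trivalent_vertices T = {vertex_of T d | d. d \<in> halves T \<and> nxt T d \<noteq> d}"

definition unitrivalent_graph ::
  "('a, 'm) monoid_scheme \<Rightarrow> ('a, 'u) utree_scheme \<Rightarrow> bool" where
  "unitrivalent_graph H T \<longleftrightarrow>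
     finite (halves T) \<and>
     (\<forall>d\<in>halves T. opp T d \<in> halves T \<and> opp T d \<noteq> d \<and> opp T (opp T d) = d) \<and>
     (\<forall>d\<in>halves T. nxt T d \<in> halves T \<and> nxt T (nxt T (nxt T d)) = d) \<and>
     (\<forall>d\<in>univalent T. lab T d \<in> carrier H)"

text \<open>Since \<open>opp\<close> and \<open>nxt\<close> have finite order, reachability along them is symmetric.\<close>

definition connected_graph :: "('a, 'u) utree_scheme \<Rightarrow> bool" where
  "connected_graph T \<longleftrightarrow> halves T \<noteq> {} \<and>
     (\<forall>d\<in>halves T. \<forall>d'\<in>halves T.
        (d, d') \<in> ({(c, opp T c) | c. c \<in> halves T} \<union> {(c, nxt T c) | c. c \<in> halves T})\<^sup>*)"

text \<open>
  Traverse the edge of \<open>d\<close> starting with the half \<open>d\<close>, then leave its far end along another edge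
  (or along the same edge again, if that edge is a loop). A closed walk of such non-backtracking
  steps exists if and only if the graph has a cycle (loops and double edges included).
\<close>

definition nonbacktracking_step :: "('a, 'u) utree_scheme \<Rightarrow> (nat \<times> nat) set" where
  "nonbacktracking_step T =
     {(d, d'). d \<in> halves T \<and> d' \<in> vertex_of T (opp T d) \<and> d' \<noteq> opp T d}"

definition unitrivalent_trees :: "('a, 'm) monoid_scheme \<Rightarrow> nat \<Rightarrow> 'a utree set" where
  "unitrivalent_trees H n =
     {T. unitrivalent_graph H T \<and> connected_graph T \<and> acyclic (nonbacktracking_step T) \<and>
         card (trivalent_vertices T) = n}"

definition utree_iso :: "'a utree \<Rightarrow> 'a utree \<Rightarrow> bool" where
  "utree_iso T T' \<longleftrightarrow>
     (\<exists>f. bij_betw f (halves T) (halves T') \<and>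
          (\<forall>d\<in>halves T. f (opp T d) = opp T' (f d) \<and> f (nxt T d) = nxt T' (f d)) \<and>
          (\<forall>d\<in>univalent T. lab T' (f d) = lab T d))"


section \<open>The tree group\<close>

text \<open>Isomorphic trees are identified.\<close>

definition iso_relations :: "('a, 'm) monoid_scheme \<Rightarrow> nat \<Rightarrow> ('a utree \<Rightarrow>\<^sub>0 int) set" where
  "iso_relations H n = {frag_of T - frag_of T' | T T'.
     T \<in> unitrivalent_trees H n \<and> T' \<in> unitrivalent_trees H n \<and> utree_iso T T'}"

definition flip_orientation :: "'a utree \<Rightarrow> nat \<Rightarrow> 'a utree" where
  "flip_orientation T d =
     T\<lparr>nxt := (\<lambda>c. if c \<in> vertex_of T d then nxt T (nxt T c) else nxt T c)\<rparr>"

definition as_relations :: "('a, 'm) monoid_scheme \<Rightarrow> nat \<Rightarrow> ('a utree \<Rightarrow>\<^sub>0 int) set" where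
  "as_relations H n = {frag_of T + frag_of (flip_orientation T d) | T d.
     T \<in> unitrivalent_trees H n \<and> flip_orientation T d \<in> unitrivalent_trees H n \<and>
     d \<in> halves T \<and> nxt T d \<noteq> d}"

text \<open>
  Below, \<open>e\<close> and \<open>opp T e\<close> are the two halves of the edge joining the adjacent trivalent vertices,
  with \<open>e\<close> at the first one, and \<open>a\<close>, \<open>b\<close>, \<open>c\<close>, \<open>d\<close> are the remaining half-edges at these vertices;
  their opposites carry the four rooted trees. In \<open>arrange T a b c d e\<close> the cyclic orderings are
  \<open>(a, b, e)\<close> at the first vertex and \<open>(opp T e, c, d)\<close> at the second.
\<close>

definition arrange :: "'a utree \<Rightarrow> nat \<Rightarrow> nat \<Rightarrow> nat \<Rightarrow> nat \<Rightarrow> nat \<Rightarrow> 'a utree" where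
  "arrange T a b c d e =
     T\<lparr>nxt := (nxt T)(a := b, b := e, e := a, opp T e := c, c := d, d := opp T e)\<rparr>"

definition ihx_relations :: "('a, 'm) monoid_scheme \<Rightarrow> nat \<Rightarrow> ('a utree \<Rightarrow>\<^sub>0 int) set" where
  "ihx_relations H n =
     {frag_of T + frag_of (arrange T b c a d e) + frag_of (arrange T c a b d e) | T a b c d e.
        T \<in> unitrivalent_trees H n \<and>
        arrange T b c a d e \<in> unitrivalent_trees H n \<and>
        arrange T c a b d e \<in> unitrivalent_trees H n \<and>
        {a, b, c, d, e} \<subseteq> halves T \<and> a \<noteq> b \<and> c \<noteq> d \<and>
        nxt T a = b \<and> nxt T b = e \<and> nxt T e = a \<and>
        nxt T (opp T e) = c \<and> nxt T c = d \<and> nxt T d = opp T e}"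

definition linearity_relations :: "('a, 'm) monoid_scheme \<Rightarrow> nat \<Rightarrow> ('a utree \<Rightarrow>\<^sub>0 int) set" where
  "linearity_relations H n =
     {frag_of T - frag_of (T\<lparr>lab := (lab T)(d := a\<^sub>1)\<rparr>) - frag_of (T\<lparr>lab := (lab T)(d := a\<^sub>2)\<rparr>)
        | T d a\<^sub>1 a\<^sub>2. T \<in> unitrivalent_trees H n \<and> d \<in> univalent T \<and>
            a\<^sub>1 \<in> carrier H \<and> a\<^sub>2 \<in> carrier H \<and> lab T d = a\<^sub>1 \<otimes>\<^bsub>H\<^esub> a\<^sub>2}"

definition tree_group ::
  "('a, 'm) monoid_scheme \<Rightarrow> nat \<Rightarrow> ('a utree \<Rightarrow>\<^sub>0 int) set monoid" where
  "tree_group H n = presented (unitrivalent_trees H n)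
     (iso_relations H n \<union> as_relations H n \<union> ihx_relations H n \<union> linearity_relations H n)"


section \<open>The maps\<close>

text \<open>
  \<open>branch_value H T d x\<close>: iterated bracketing of the subtree reached through \<open>d\<close>, that is, of the
  component of the tree beyond the edge of \<open>d\<close>, the root being on the side of \<open>d\<close>, gives \<open>x\<close>.
  The half-edge at the far end that points towards the root is \<open>opp T d\<close>.
\<close>

inductive branch_value ::
  "('a, 'm) monoid_scheme \<Rightarrow> 'a utree \<Rightarrow> nat \<Rightarrow> ('a word \<Rightarrow>\<^sub>0 int) set \<Rightarrow> bool"
  for H :: "('a, 'm) monoid_scheme" and T :: "'a utree" where
  univalent_end: "nxt T (opp T d) = opp T d \<Longrightarrow>
    branch_value H T d (quasi_lie_incl H (lab T (opp T d)))"
| trivalent_end: "nxt T (opp T d) \<noteq> opp T d \<Longrightarrow>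
    branch_value H T (nxt T (opp T d)) x \<Longrightarrow>
    branch_value H T (nxt T (nxt T (opp T d))) y \<Longrightarrow>
    branch_value H T d (quasi_lie_bracket H x y)"

lemma branch_value_ex1:
  assumes T: "T \<in> unitrivalent_trees H n" and d: "d \<in> halves T"
  shows "\<exists>!x. branch_value H T d x"
proof -
  have G: "unitrivalent_graph H T" and ac: "acyclic (nonbacktracking_step T)"
    using T by (auto simp: unitrivalent_trees_def)
  have "nonbacktracking_step T \<subseteq> halves T \<times> halves T"
    using G by (auto simp: nonbacktracking_step_def unitrivalent_graph_def vertex_of_def)
  then have "finite (nonbacktracking_step T)"
    using G by (auto simp: unitrivalent_graph_def intro: finite_subset)
  then have wf: "wf ((nonbacktracking_step T)\<inverse>)"
    using ac by (rule finite_acyclic_wf_converse)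
  show ?thesis
    using wf d
  proof (induction d rule: wf_induct_rule)
    case (less d)
    let ?e = "opp T d"
    have e: "?e \<in> halves T" using G less.prems by (auto simp: unitrivalent_graph_def)
    show ?case
    proof (cases "nxt T ?e = ?e")
      case True
      show ?thesis
      proof
        show "branch_value H T d (quasi_lie_incl H (lab T ?e))"
          using True by (rule branch_value.univalent_end)
        fix z assume "branch_value H T d z"
        then show "z = quasi_lie_incl H (lab T ?e)"
          using True by cases simp_all
      qed
    next
      case False
      have h: "nxt T ?e \<in> halves T" "nxt T (nxt T ?e) \<in> halves T"
        and n3: "nxt T (nxt T (nxt T ?e)) = ?e"
        using G e by (auto simp: unitrivalent_graph_def)
      have "nxt T (nxt T ?e) \<noteq> ?e"
        using False n3 by metis
      then have step: "(nxt T ?e, d) \<in> (nonbacktracking_step T)\<inverse>"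
        "(nxt T (nxt T ?e), d) \<in> (nonbacktracking_step T)\<inverse>"
        using False less.prems by (auto simp: nonbacktracking_step_def vertex_of_def)
      obtain x y where
        x: "branch_value H T (nxt T ?e) x" "\<And>x'. branch_value H T (nxt T ?e) x' \<Longrightarrow> x' = x" and
        y: "branch_value H T (nxt T (nxt T ?e)) y"
        "\<And>y'. branch_value H T (nxt T (nxt T ?e)) y' \<Longrightarrow> y' = y"
        using less.IH[OF step(1) h(1)] less.IH[OF step(2) h(2)] by (elim ex1E) blast
      show ?thesis
      proof
        show "branch_value H T d (quasi_lie_bracket H x y)"
          using False x(1) y(1) by (rule branch_value.trivalent_end)
        fix z assume "branch_value H T d z"
        then show "z = quasi_lie_bracket H x y"
        proof cases
          case univalent_end
          then show ?thesis using False by simp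
        next
          case (trivalent_end x' y')
          then show ?thesis using x(2) y(2) by blast
        qed
      qed
    qed
  qed
qed

definition rooted_value ::
  "('a, 'm) monoid_scheme \<Rightarrow> 'a utree \<Rightarrow> nat \<Rightarrow> ('a word \<Rightarrow>\<^sub>0 int) set" where
  "rooted_value H T i = (THE x. branch_value H T i x)"

definition eta_tree ::
  "('a, 'm) monoid_scheme \<Rightarrow> nat \<Rightarrow> 'a utree \<Rightarrow> ('a \<times> ('a word \<Rightarrow>\<^sub>0 int) set \<Rightarrow>\<^sub>0 int) set" where
  "eta_tree H n T = finprod (tensor H (quasi_lie_deg H (n + 1)))
     (\<lambda>i. pure_tensor H (quasi_lie_deg H (n + 1)) (lab T i) (rooted_value H T i)) (univalent T)"

definition eta ::
  "('a, 'm) monoid_scheme \<Rightarrow> nat \<Rightarrow> ('a utree \<Rightarrow>\<^sub>0 int) set \<Rightarrow>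
     ('a \<times> ('a word \<Rightarrow>\<^sub>0 int) set \<Rightarrow>\<^sub>0 int) set" where
  "eta H n = induced (tensor H (quasi_lie_deg H (n + 1))) (eta_tree H n)"

definition beta ::
  "('a, 'm) monoid_scheme \<Rightarrow> nat \<Rightarrow> ('a \<times> ('a word \<Rightarrow>\<^sub>0 int) set \<Rightarrow>\<^sub>0 int) set \<Rightarrow>
     ('a word \<Rightarrow>\<^sub>0 int) set" where
  "beta H n = induced (quasi_lie_deg H (n + 2))
     (\<lambda>(h, x). quasi_lie_bracket H (quasi_lie_incl H h) x)"

definition D_group ::
  "('a, 'm) monoid_scheme \<Rightarrow> nat \<Rightarrow> ('a \<times> ('a word \<Rightarrow>\<^sub>0 int) set \<Rightarrow>\<^sub>0 int) set monoid" where
  "D_group H n = (tensor H (quasi_lie_deg H (n + 1)))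
     \<lparr>carrier := kernel (tensor H (quasi_lie_deg H (n + 1))) (quasi_lie_deg H (n + 2)) (beta H n)\<rparr>"

end

theory Submission
  imports Defs "HOL-Library.Multiset"
begin

text \<open>
  The kernel is annihilated because the map eta has an inverse up to the factor \<open>p ^ (k - 1)\<close>.
  Cutting a tree at an edge gives a pair of planar rooted trees, that is, a pair \<open>(u, v)\<close> of words.
  For letters from a basis of \<open>H\<close> and integer weights of the letters, let \<open>regraft\<close> send \<open>a \<otimes> w\<close> to the
  weight of \<open>a\<close> times the tree obtained from \<open>w\<close> by labelling its root with \<open>a\<close>. The value of eta on
  a tree has one summand for each univalent vertex, and regrafting any of them gives back the
  tree. So \<open>regraft\<close> after eta is multiplication with the total weight of all the labels
  (\<open>regraft_leaf_sum\<close>).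

  The total weight is adjusted as follows. All maps and all relations preserve the multiset of the
  labels, so the weights may be chosen for each multiset separately, and by Bezout the total weight
  can be the gcd of the multiplicities of the labels. The multiplicities add up to
  \<open>n + 2 = p ^ k\<close>; if there are at least two different labels, all of them are smaller than \<open>p ^ k\<close> and
  their gcd divides \<open>p ^ (k - 1)\<close> (\<open>prime_power_weights\<close>). If there is only one label \<open>a\<close>, then weight
  one gives \<open>p ^ k\<close>; but this part of the groups is killed by two, since each of its trees contains
  \<open>[a, a]\<close> and \<open>2 [a, a] = 0\<close> (\<open>double_single_letter\<close>), and \<open>p ^ k - p ^ (k - 1)\<close> is even as \<open>p ^ k \<ge> 3\<close>. This
  gives \<open>retract_eta\<close> and hence the first part of the theorem.

  If \<open>n + 2\<close> is prime, the factor is one and eta is injective. For the image consider the other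
  composite, eta after \<open>regraft\<close>. It is homotopic to multiplication with the total weight: there is
  a map \<open>homotopy\<close> from the quasi-Lie algebra back to the tensor product such that the sum of the
  composite and of \<open>homotopy\<close> after the bracket map \<open>\<beta>'\<close> is the total weight times the identity
  (\<open>homotopy_bracket\<close>). On the kernel of \<open>\<beta>'\<close> the second term vanishes, so every element of the
  kernel is in the image of eta (\<open>eta_retract\<close>). Conversely the image is contained in the kernel by
  the Jacobi identity (\<open>bracket_leaf_sum\<close>).

  To carry this over to graphs, it is shown that a tree is determined up to isomorphism by the words
  at any of its edges, since the realization of a pair of words is a covering of the tree
  (\<open>realize_inj\<close>); that every pair of words occurs (\<open>word_tree_in_trees\<close>); that the sum defining eta
  can be read off from the words at any edge (\<open>leaf_sum_univalent\<close>); and that the relations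
  between trees correspond to relations between pairs of words (\<open>eta_frag_rels\<close>,
  \<open>to_tree_pair_relators\<close>). The passage from labels in \<open>H\<close> to basis elements is linearity in each
  letter (\<open>to_tree_expand\<close>, \<open>to_tensor_coords\<close>).
\<close>


section \<open>Subgroups of free abelian groups\<close>

text \<open>
  Subgroups are generated inside the ambient additive type: congruences become statements
  \<open>x - y \<in> zspan R\<close>, and the carriers of the groups enter only when quotients are formed.
\<close>

inductive_set zspan :: "('s \<Rightarrow>\<^sub>0 int) set \<Rightarrow> ('s \<Rightarrow>\<^sub>0 int) set" for G where
  zero: "0 \<in> zspan G"
| gen: "x \<in> G \<Longrightarrow> x \<in> zspan G"
| diff: "x \<in> zspan G \<Longrightarrow> y \<in> zspan G \<Longrightarrow> x - y \<in> zspan G"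

lemma zspan_minus: "x \<in> zspan G \<Longrightarrow> - x \<in> zspan G"
  using zspan.diff[OF zspan.zero] by fastforce

lemma zspan_add: "x \<in> zspan G \<Longrightarrow> y \<in> zspan G \<Longrightarrow> x + y \<in> zspan G"
  using zspan.diff[OF _ zspan_minus] by fastforce

lemma zspan_sum: "(\<And>i. i \<in> I \<Longrightarrow> f i \<in> zspan G) \<Longrightarrow> sum f I \<in> zspan G"
  by (induction I rule: infinite_finite_induct) (auto intro: zspan.zero zspan_add)

lemma zspan_cmul: "x \<in> zspan G \<Longrightarrow> frag_cmul k x \<in> zspan G"
  by (rule frag_closure_minus_cmul) (auto intro: zspan.intros)

lemma zspan_frag_extend:
  "(\<And>s. s \<in> Poly_Mapping.keys x \<Longrightarrow> f s \<in> zspan G) \<Longrightarrow> frag_extend f x \<in> zspan G"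
  unfolding frag_extend_def by (intro zspan_sum zspan_cmul)

lemma frag_extend_zspan:
  assumes "x \<in> zspan G" and "\<And>g. g \<in> G \<Longrightarrow> frag_extend f g \<in> zspan G'"
  shows "frag_extend f x \<in> zspan G'"
  using assms(1) by induction (auto simp: frag_extend_diff intro: zspan.intros assms(2))

lemma zspan_trans: "x - y \<in> zspan G \<Longrightarrow> y - z \<in> zspan G \<Longrightarrow> x - z \<in> zspan G"
  using zspan_add by fastforce

lemma zspan_sym: "x - y \<in> zspan G \<Longrightarrow> y - x \<in> zspan G"
  using zspan_minus by fastforce

lemma zspan_diff_cong:
  "x - x' \<in> zspan G \<Longrightarrow> y - y' \<in> zspan G \<Longrightarrow> (x - y) - (x' - y') \<in> zspan G"
  using zspan.diff[of "x - x'" G "y - y'"] by (simp add: algebra_simps)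

lemma zspan_add_cong:
  "x - x' \<in> zspan G \<Longrightarrow> y - y' \<in> zspan G \<Longrightarrow> (x + y) - (x' + y') \<in> zspan G"
  using zspan_add[of "x - x'" G "y - y'"] by (simp add: algebra_simps)

lemma zspan_subst: "x - y \<in> zspan G \<Longrightarrow> y \<in> zspan G \<Longrightarrow> x \<in> zspan G"
  using zspan_add by fastforce

lemma keys_frag_extendI:
  "(\<And>s. s \<in> Poly_Mapping.keys x \<Longrightarrow> Poly_Mapping.keys (f s) \<subseteq> S)
    \<Longrightarrow> Poly_Mapping.keys (frag_extend f x) \<subseteq> S"
  using keys_frag_extend[of f x] by blast

lemma frag_extend_frag_extend:
  "frag_extend f (frag_extend g x) = frag_extend (\<lambda>s. frag_extend f (g s)) x"
  using subset_UNIV by (induction x rule: frag_induction) (auto simp: frag_extend_diff)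

lemma frag_extend_fun_add:
  "frag_extend (\<lambda>s. f s + g s) x = frag_extend f x + frag_extend g x"
  using subset_UNIV by (induction x rule: frag_induction) (auto simp: frag_extend_diff)

lemma frag_extend_fun_diff:
  "frag_extend (\<lambda>s. f s - g s) x = frag_extend f x - frag_extend g x"
  using subset_UNIV by (induction x rule: frag_induction) (auto simp: frag_extend_diff)

lemma frag_extend_cong_zspan:
  assumes "\<And>s. s \<in> Poly_Mapping.keys x \<Longrightarrow> f s - f' s \<in> zspan G"
  shows "frag_extend f x - frag_extend f' x \<in> zspan G"
  using zspan_frag_extend[of x "\<lambda>s. f s - f' s"] assms by (simp add: frag_extend_fun_diff)

lemma frag_cmul_diff_distrib2: "frag_cmul k (x - y) = frag_cmul k x - frag_cmul k y"
  by (rule poly_mapping_eqI) (simp add: lookup_minus right_diff_distrib)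

lemma frag_extend_fun_cmul:
  "frag_extend (\<lambda>s. frag_cmul k (f s)) x = frag_cmul k (frag_extend f x)"
  using subset_UNIV
  by (induction x rule: frag_induction) (auto simp: frag_extend_diff frag_cmul_diff_distrib2)

definition otimes :: "('s \<Rightarrow>\<^sub>0 int) \<Rightarrow> ('t \<Rightarrow>\<^sub>0 int) \<Rightarrow> ('s \<times> 't \<Rightarrow>\<^sub>0 int)" where
  "otimes x y = frag_extend (\<lambda>s. frag_extend (\<lambda>t. frag_of (s, t)) y) x"

lemma otimes_frag_of [simp]: "otimes (frag_of s) (frag_of t) = frag_of (s, t)"
  by (simp add: otimes_def)

lemma otimes_left:
  "otimes 0 y = 0" "otimes (x + x') y = otimes x y + otimes x' y"
  "otimes (x - x') y = otimes x y - otimes x' y" "otimes (- x) y = - otimes x y"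
  "otimes (frag_cmul k x) y = frag_cmul k (otimes x y)"
  by (simp_all add: otimes_def frag_extend_add frag_extend_diff frag_extend_minus frag_extend_cmul)

lemma otimes_right:
  "otimes x 0 = 0" "otimes x (y + y') = otimes x y + otimes x y'"
  "otimes x (y - y') = otimes x y - otimes x y'"
  "otimes x (frag_cmul k y) = frag_cmul k (otimes x y)"
  by (simp_all add: otimes_def frag_extend_add frag_extend_diff frag_extend_cmul
      frag_extend_fun_add frag_extend_fun_diff frag_extend_fun_cmul frag_extend_eq_0)

lemma otimes_right_minus: "otimes x (- y) = - otimes x y"
  using otimes_right(3)[of x 0 y] by (simp add: otimes_right(1))

lemmas otimes_bilinear = otimes_left otimes_right otimes_right_minus

lemma keys_otimes: "Poly_Mapping.keys (otimes x y) \<subseteq> Poly_Mapping.keys x \<times> Poly_Mapping.keys y"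
  unfolding otimes_def by (intro keys_frag_extendI) auto

lemma word_mult_frag_of [simp]: "word_mult (frag_of s) (frag_of t) = frag_of (Br s t)"
  by (simp add: word_mult_def)

lemma word_mult_left:
  "word_mult 0 y = 0" "word_mult (x + x') y = word_mult x y + word_mult x' y"
  "word_mult (x - x') y = word_mult x y - word_mult x' y" "word_mult (- x) y = - word_mult x y"
  "word_mult (frag_cmul k x) y = frag_cmul k (word_mult x y)"
  by (simp_all add: word_mult_def frag_extend_add frag_extend_diff frag_extend_minus
      frag_extend_cmul)

lemma word_mult_right:
  "word_mult x 0 = 0" "word_mult x (y + y') = word_mult x y + word_mult x y'"
  "word_mult x (y - y') = word_mult x y - word_mult x y'"
  "word_mult x (frag_cmul k y) = frag_cmul k (word_mult x y)"
  by (simp_all add: word_mult_def frag_extend_add frag_extend_diff frag_extend_cmul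
      frag_extend_fun_add frag_extend_fun_diff frag_extend_fun_cmul frag_extend_eq_0)

lemma word_mult_right_minus: "word_mult x (- y) = - word_mult x y"
  using word_mult_right(3)[of x 0 y] by (simp add: word_mult_right(1))

lemmas word_mult_bilinear = word_mult_left word_mult_right word_mult_right_minus

lemma keys_word_mult:
  "Poly_Mapping.keys (word_mult x y)
    \<subseteq> (\<lambda>(s, t). Br s t) ` (Poly_Mapping.keys x \<times> Poly_Mapping.keys y)"
  unfolding word_mult_def by (intro keys_frag_extendI) auto

lemmas frag_extend_linear =
  frag_extend_add frag_extend_diff frag_extend_minus frag_extend_cmul

lemma frag_linear_ext:
  fixes F G :: "('s \<Rightarrow>\<^sub>0 int) \<Rightarrow> 'b :: ab_group_add"
  assumes "\<And>x y. F (x - y) = F x - F y" "\<And>x y. G (x - y) = G x - G y"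
    and "\<And>s. F (frag_of s) = G (frag_of s)"
  shows "F x = G x"
proof -
  have "F 0 = 0" "G 0 = 0" using assms(1,2)[of 0 0] by simp_all
  with subset_UNIV show ?thesis
    by (induction x rule: frag_induction) (auto simp: assms)
qed

lemma frag_zspan_ext:
  assumes "\<And>x y. F (x - y) = F x - F y" "\<And>s. s \<in> Poly_Mapping.keys x \<Longrightarrow> F (frag_of s) \<in> zspan G"
  shows "F x \<in> zspan G"
proof -
  have "Poly_Mapping.keys x \<subseteq> {s. F (frag_of s) \<in> zspan G}"
    using assms(2) by auto
  then show ?thesis
  proof (induction x rule: frag_induction)
    case zero
    show ?case using assms(1)[of 0 0] by (simp add: zspan.zero)
  qed (auto simp: assms(1) intro: zspan.diff)
qed


section \<open>Lie relations between words\<close>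

text \<open>
  Antisymmetry and Jacobi alone, without additivity in the letters. The generators are kept
  homogeneous: all words in a relator have the same letters with the same multiplicities, which
  is what allows constructions that depend on these multiplicities.
\<close>

inductive_set lie_relators :: "('a word \<Rightarrow>\<^sub>0 int) set" where
  antisym: "frag_of (Br s t) + frag_of (Br t s) \<in> lie_relators"
| jacobi: "frag_of (Br (Br r s) t) + frag_of (Br (Br s t) r) + frag_of (Br (Br t r) s)
    \<in> lie_relators"
| left: "g \<in> lie_relators \<Longrightarrow> word_mult (frag_of w) g \<in> lie_relators"
| right: "g \<in> lie_relators \<Longrightarrow> word_mult g (frag_of w) \<in> lie_relators"

lemma zspan_lie_antisym: "word_mult x y + word_mult y x \<in> zspan lie_relators"
proof (rule frag_zspan_ext[where x = x])
  fix s show "word_mult (frag_of s) y + word_mult y (frag_of s) \<in> zspan lie_relators"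
    by (rule frag_zspan_ext[where x = y])
       (auto simp: word_mult_bilinear algebra_simps intro: zspan.gen lie_relators.antisym)
qed (simp add: word_mult_bilinear algebra_simps)

lemma zspan_lie_jacobi:
  "word_mult (word_mult x y) z + word_mult (word_mult y z) x + word_mult (word_mult z x) y
    \<in> zspan lie_relators"
proof (rule frag_zspan_ext[where x = x], goal_cases)
  case (2 r)
  show ?case
  proof (rule frag_zspan_ext[where x = y], goal_cases)
    case (2 s)
    show ?case
      by (rule frag_zspan_ext[where x = z])
         (simp add: word_mult_bilinear algebra_simps, simp add: zspan.gen lie_relators.jacobi)
  qed (simp add: word_mult_bilinear algebra_simps)
qed (simp add: word_mult_bilinear algebra_simps)

lemma zspan_lie_mult_right:
  "q \<in> zspan lie_relators \<Longrightarrow> word_mult q y \<in> zspan lie_relators"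
proof (rule frag_zspan_ext[where x = y], goal_cases)
  case (2 w)
  from 2(1) show ?case
    by induction (auto simp: word_mult_bilinear intro: zspan.intros lie_relators.right)
qed (simp add: word_mult_bilinear)

lemma zspan_lie_mult_left:
  "q \<in> zspan lie_relators \<Longrightarrow> word_mult y q \<in> zspan lie_relators"
  using zspan.diff[OF zspan_lie_antisym zspan_lie_mult_right, of q y q y] by simp

primrec letter_mset :: "'a word \<Rightarrow> 'a multiset" where
  "letter_mset (Letter a) = {#a#}"
| "letter_mset (Br s t) = letter_mset s + letter_mset t"

lemma letter_mset_letters [simp]: "set_mset (letter_mset w) = letters w"
  by (induction w) auto

lemma letter_mset_length [simp]: "size (letter_mset w) = word_length w"
  by (induction w) auto

lemma word_length_pos [simp]: "0 < word_length w"
  by (induction w) auto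

lemma lie_relators_homogeneous:
  "g \<in> lie_relators \<Longrightarrow> \<exists>m. \<forall>w \<in> Poly_Mapping.keys g. letter_mset w = m"
proof (induction rule: lie_relators.induct)
  case (antisym s t)
  show ?case
    by (intro exI[of _ "letter_mset s + letter_mset t"])
       (auto dest!: keys_add[THEN subsetD] simp: ac_simps)
next
  case (jacobi r s t)
  show ?case
    by (intro exI[of _ "letter_mset r + letter_mset s + letter_mset t"])
       (auto dest!: keys_add[THEN subsetD] simp: ac_simps)
next
  case (left g w)
  then obtain m where "\<forall>w \<in> Poly_Mapping.keys g. letter_mset w = m" by blast
  then show ?case
    by (intro exI[of _ "letter_mset w + m"]) (auto dest!: keys_word_mult[THEN subsetD])
next
  case (right g w)
  then obtain m where "\<forall>w \<in> Poly_Mapping.keys g. letter_mset w = m" by blast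
  then show ?case
    by (intro exI[of _ "m + letter_mset w"]) (auto dest!: keys_word_mult[THEN subsetD])
qed

text \<open>
  A word of length at least two in a single letter \<open>a\<close> contains \<open>[a, a]\<close>, which antisymmetry makes
  a 2-torsion element.
\<close>

lemma double_single_letter:
  "letters w \<subseteq> {a} \<Longrightarrow> word_length w \<ge> 2 \<Longrightarrow> frag_cmul 2 (frag_of w) \<in> zspan lie_relators"
proof (induction w)
  case (Br s t)
  consider "word_length s \<ge> 2" | "word_length t \<ge> 2" | "word_length s = 1" "word_length t = 1"
    using word_length_pos[of s] word_length_pos[of t] by linarith
  then show ?case
  proof cases
    case 1
    then have "frag_cmul 2 (frag_of s) \<in> zspan lie_relators" using Br by auto
    then show ?thesis
      using zspan_lie_mult_right[of _ "frag_of t"] by (fastforce simp: word_mult_bilinear)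
  next
    case 2
    then have "frag_cmul 2 (frag_of t) \<in> zspan lie_relators" using Br by auto
    then show ?thesis
      using zspan_lie_mult_left[of _ "frag_of s"] by (fastforce simp: word_mult_bilinear)
  next
    case 3
    have letter: "\<exists>b. u = Letter b" if "word_length u = 1" for u :: "'a word"
    proof (cases u)
      case (Br x y)
      then show ?thesis using that word_length_pos[of x] word_length_pos[of y] by simp
    qed simp
    obtain b c where "s = Letter b" "t = Letter c" using 3 letter by metis
    then have "s = t" using Br.prems(1) by simp
    then show ?thesis
      using zspan.gen[OF lie_relators.antisym[of s t]]
      using frag_cmul_distrib[of 1 1 "frag_of (Br s t)"] by simp
  qed
qed simp


section \<open>Moving the root of a word\<close>

text \<open>
  A pair \<open>(u, v)\<close> of words encodes the tree obtained by joining the planar rooted trees \<open>u\<close> and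
  \<open>v\<close> along their root edges. Choosing another edge of the same tree gives another pair; the
  relators below make all of these equal, and impose AS and IHX at an edge.
\<close>

inductive_set pair_relators :: "('a word \<times> 'a word \<Rightarrow>\<^sub>0 int) set" where
  swap: "frag_of (u, v) - frag_of (v, u) \<in> pair_relators"
| move: "frag_of (Br u v, w) - frag_of (u, Br v w) \<in> pair_relators"
| antisym: "frag_of (Br u v, w) + frag_of (Br v u, w) \<in> pair_relators"
| ihx: "frag_of (Br (Br r s) t, w) + frag_of (Br (Br s t) r, w) + frag_of (Br (Br t r) s, w)
    \<in> pair_relators"

lemma zspan_pair_swap: "otimes x y - otimes y x \<in> zspan pair_relators"
proof (rule frag_zspan_ext[where x = x])
  fix s show "otimes (frag_of s) y - otimes y (frag_of s) \<in> zspan pair_relators"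
    by (rule frag_zspan_ext[where x = y])
       (auto simp: otimes_bilinear algebra_simps intro: zspan.gen pair_relators.swap)
qed (simp add: otimes_bilinear algebra_simps)

lemma zspan_pair_move:
  "otimes (word_mult x y) z - otimes x (word_mult y z) \<in> zspan pair_relators"
proof (rule frag_zspan_ext[where x = x], goal_cases)
  case (2 r)
  show ?case
  proof (rule frag_zspan_ext[where x = y], goal_cases)
    case (2 s)
    show ?case
      by (rule frag_zspan_ext[where x = z])
         (auto simp: word_mult_bilinear otimes_bilinear algebra_simps
           intro: zspan.gen pair_relators.move)
  qed (simp add: word_mult_bilinear otimes_bilinear algebra_simps)
qed (simp add: word_mult_bilinear otimes_bilinear algebra_simps)

lemma zspan_pair_move': "otimes x (word_mult y z) - otimes (word_mult z x) y \<in> zspan pair_relators"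
proof -
  have "otimes x (word_mult y z) - otimes (word_mult y z) x \<in> zspan pair_relators"
    by (rule zspan_pair_swap)
  moreover have "otimes (word_mult y z) x - otimes y (word_mult z x) \<in> zspan pair_relators"
    by (rule zspan_pair_move)
  moreover have "otimes y (word_mult z x) - otimes (word_mult z x) y \<in> zspan pair_relators"
    by (rule zspan_pair_swap)
  ultimately show ?thesis by (blast intro: zspan_trans)
qed

text \<open>
  A Lie relation deep inside a word is brought next to the root by moving the root, so imposing AS
  and IHX at the root is enough.
\<close>

lemma otimes_lie_relator:
  "g \<in> lie_relators \<Longrightarrow> otimes g y \<in> zspan pair_relators"
proof (induction arbitrary: y rule: lie_relators.induct)
  case (antisym s t)
  show ?case
    by (rule frag_zspan_ext[where x = y])
       (auto simp: otimes_bilinear algebra_simps intro: zspan.gen pair_relators.antisym)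
next
  case (jacobi r s t)
  show ?case
    by (rule frag_zspan_ext[where x = y])
       (simp add: otimes_bilinear algebra_simps,
         simp add: otimes_left zspan.gen pair_relators.ihx)
next
  case (left g w)
  have "otimes (word_mult (frag_of w) g) y - otimes g (word_mult y (frag_of w))
    \<in> zspan pair_relators"
    by (rule zspan_sym) (rule zspan_pair_move')
  then show ?case using left.IH by (blast intro: zspan_subst)
next
  case (right g w)
  show ?case
    using zspan_pair_move right.IH by (blast intro: zspan_subst)
qed

lemma otimes_zspan_lie_right:
  assumes "q \<in> zspan lie_relators" shows "otimes x q \<in> zspan pair_relators"
proof -
  have "otimes q x \<in> zspan pair_relators"
    using assms by induction (auto simp: otimes_bilinear intro: zspan.intros otimes_lie_relator)
  with zspan_pair_swap show ?thesis by (rule zspan_subst)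
qed


section \<open>The sum over the univalent vertices\<close>

text \<open>
  \<open>branch_sum s y\<close> is the contribution to the sum over the univalent vertices of the tree \<open>(s, y)\<close>
  of those lying in \<open>s\<close>: descending into a branch of \<open>s\<close>, the rest of \<open>s\<close> is absorbed into the word
  on the other side of the edge.
\<close>

primrec branch_sum :: "'a word \<Rightarrow> ('a word \<Rightarrow>\<^sub>0 int) \<Rightarrow> ('a \<times> 'a word \<Rightarrow>\<^sub>0 int)" where
  "branch_sum (Letter a) y = otimes (frag_of a) y"
| "branch_sum (Br s t) y =
     branch_sum s (word_mult (frag_of t) y) + branch_sum t (word_mult y (frag_of s))"

definition leaf_sum :: "'a word \<times> 'a word \<Rightarrow> ('a \<times> 'a word \<Rightarrow>\<^sub>0 int)" where
  "leaf_sum = (\<lambda>(u, v). branch_sum u (frag_of v) + branch_sum v (frag_of u))"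

text \<open>
  The relators of the tensor product of the free abelian group on the letters with the words modulo
  \<^const>\<open>lie_relators\<close>.
\<close>

definition tensor_relators :: "('a \<times> 'a word \<Rightarrow>\<^sub>0 int) set" where
  "tensor_relators = {otimes (frag_of a) g | a g. g \<in> lie_relators}"

lemma branch_sum_linear:
  "branch_sum s (x + y) = branch_sum s x + branch_sum s y"
  "branch_sum s (x - y) = branch_sum s x - branch_sum s y"
  "branch_sum s 0 = 0"
  "branch_sum s (frag_cmul k x) = frag_cmul k (branch_sum s x)"
  by (induction s arbitrary: x y)
     (simp_all add: otimes_bilinear word_mult_bilinear frag_cmul_distrib2)

lemma branch_sum_homogeneous:
  assumes "(a, w) \<in> Poly_Mapping.keys (branch_sum s y)"
    and "\<And>v. v \<in> Poly_Mapping.keys y \<Longrightarrow> letter_mset v = m"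
  shows "add_mset a (letter_mset w) = letter_mset s + m"
  using assms
proof (induction s arbitrary: y m)
  case (Letter b)
  then show ?case using keys_otimes[of "frag_of b" y] by auto
next
  case (Br s t)
  consider "(a, w) \<in> Poly_Mapping.keys (branch_sum s (word_mult (frag_of t) y))"
    | "(a, w) \<in> Poly_Mapping.keys (branch_sum t (word_mult y (frag_of s)))"
    using Br.prems(1) keys_add by fastforce
  then show ?case
  proof cases
    case 1
    then have "add_mset a (letter_mset w) = letter_mset s + (letter_mset t + m)"
      by (rule Br.IH(1)) (use Br.prems(2) keys_word_mult[of "frag_of t" y] in auto)
    then show ?thesis by (simp add: ac_simps)
  next
    case 2
    then have "add_mset a (letter_mset w) = letter_mset t + (m + letter_mset s)"
      by (rule Br.IH(2)) (use Br.prems(2) keys_word_mult[of y "frag_of s"] in auto)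
    then show ?thesis by (simp add: ac_simps)
  qed
qed

lemma leaf_sum_homogeneous:
  assumes "(a, w) \<in> Poly_Mapping.keys (leaf_sum (u, v))"
  shows "add_mset a (letter_mset w) = letter_mset u + letter_mset v"
proof -
  consider "(a, w) \<in> Poly_Mapping.keys (branch_sum u (frag_of v))"
    | "(a, w) \<in> Poly_Mapping.keys (branch_sum v (frag_of u))"
    using assms keys_add unfolding leaf_sum_def by fastforce
  then show ?thesis
    by cases (auto dest!: branch_sum_homogeneous simp: add.commute)
qed

lemma branch_sum_lie_right:
  "q \<in> zspan lie_relators \<Longrightarrow> branch_sum s q \<in> zspan tensor_relators"
proof (induction s arbitrary: q)
  case (Letter a)
  then show ?case
    by induction
      (auto simp: otimes_bilinear tensor_relators_def intro: zspan.intros)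
next
  case (Br s t)
  then show ?case
    by (auto intro!: zspan_add zspan_lie_mult_left zspan_lie_mult_right)
qed

text \<open>
  In the Jacobi case the coefficient of each of \<open>r\<close>, \<open>s\<close>, \<open>t\<close> is, up to antisymmetry, again a Jacobi
  expression, in the two other words and \<open>y\<close>.
\<close>

lemma branch_sum_lie_left:
  "g \<in> lie_relators \<Longrightarrow> frag_extend (\<lambda>s. branch_sum s y) g \<in> zspan tensor_relators"
proof (induction arbitrary: y rule: lie_relators.induct)
  case (antisym s t)
  have "frag_extend (\<lambda>s. branch_sum s y) (frag_of (Br s t) + frag_of (Br t s)) =
      branch_sum s (word_mult (frag_of t) y + word_mult y (frag_of t)) +
      branch_sum t (word_mult y (frag_of s) + word_mult (frag_of s) y)"
    by (simp add: frag_extend_linear branch_sum_linear algebra_simps)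
  then show ?case
    by (auto intro!: zspan_add branch_sum_lie_right zspan_lie_antisym)
next
  case (jacobi r s t)
  define C where "C a b = word_mult a (word_mult b y) + word_mult y (word_mult a b)
    + word_mult (word_mult a y) b" for a b
  have C: "C a b \<in> zspan lie_relators" for a b
  proof -
    have "(word_mult a (word_mult b y) + word_mult (word_mult b y) a)
      + (word_mult y (word_mult a b) + word_mult (word_mult a b) y)
      + word_mult (word_mult a y + word_mult y a) b
      - (word_mult (word_mult a b) y + word_mult (word_mult b y) a + word_mult (word_mult y a) b)
        \<in> zspan lie_relators"
      by (intro zspan.diff zspan_add zspan_lie_mult_right zspan_lie_antisym zspan_lie_jacobi)
    then show ?thesis by (simp add: C_def word_mult_bilinear)
  qed
  have "frag_extend (\<lambda>s. branch_sum s y)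
      (frag_of (Br (Br r s) t) + frag_of (Br (Br s t) r) + frag_of (Br (Br t r) s)) =
    branch_sum r (C (frag_of s) (frag_of t)) + branch_sum s (C (frag_of t) (frag_of r))
      + branch_sum t (C (frag_of r) (frag_of s))"
    by (simp add: C_def frag_extend_linear branch_sum_linear algebra_simps)
  then show ?case
    by (auto intro!: zspan_add branch_sum_lie_right C)
next
  case (left g w)
  have "frag_extend (\<lambda>s. branch_sum s y) (word_mult (frag_of w) x) =
      branch_sum w (word_mult x y) + frag_extend (\<lambda>s. branch_sum s (word_mult y (frag_of w))) x"
    for x
    by (rule frag_linear_ext[where x = x])
       (simp_all add: word_mult_bilinear frag_extend_linear branch_sum_linear)
  then show ?case
    using left.IH zspan.gen[OF left.hyps]
    by (auto intro!: zspan_add branch_sum_lie_right zspan_lie_mult_right)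
next
  case (right g w)
  have "frag_extend (\<lambda>s. branch_sum s y) (word_mult x (frag_of w)) =
      frag_extend (\<lambda>s. branch_sum s (word_mult (frag_of w) y)) x + branch_sum w (word_mult y x)"
    for x
    by (rule frag_linear_ext[where x = x])
       (simp_all add: word_mult_bilinear frag_extend_linear branch_sum_linear)
  then show ?case
    using right.IH zspan.gen[OF right.hyps]
    by (auto intro!: zspan_add branch_sum_lie_right zspan_lie_mult_left)
qed


lemma leaf_sum_otimes:
  "frag_extend leaf_sum (otimes x (frag_of w)) =
    frag_extend (\<lambda>s. branch_sum s (frag_of w)) x + branch_sum w x"
  by (rule frag_linear_ext[where x = x])
     (simp_all add: leaf_sum_def otimes_bilinear frag_extend_linear branch_sum_linear)

text \<open>
  The sum runs over the univalent vertices of the whole tree, so it is the same for all the edges at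
  which the tree can be cut; and AS and IHX at an edge are Lie relations in each summand.
\<close>

lemma leaf_sum_pair_relators:
  assumes "g \<in> pair_relators" shows "frag_extend leaf_sum g \<in> zspan tensor_relators"
proof -
  have lie: "frag_extend leaf_sum (otimes r (frag_of w)) \<in> zspan tensor_relators"
    if "r \<in> lie_relators" for r w
    using that unfolding leaf_sum_otimes
    by (intro zspan_add branch_sum_lie_left branch_sum_lie_right zspan.gen)
  from assms show ?thesis
  proof cases
    case (swap u v)
    show ?thesis
      unfolding swap by (simp add: leaf_sum_def frag_extend_linear add.commute zspan.zero)
  next
    case (move u v w)
    show ?thesis
      unfolding move by (simp add: leaf_sum_def frag_extend_linear algebra_simps zspan.zero)
  next
    case (antisym u v w)
    show ?thesis
      unfolding antisym using lie[OF lie_relators.antisym, of u v w] by (simp add: otimes_bilinear)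
  next
    case (ihx r s t w)
    show ?thesis
      unfolding ihx using lie[OF lie_relators.jacobi, of r s t w] by (simp add: otimes_bilinear)
  qed
qed

text \<open>
  The bracket of label and branch, summed over the univalent vertices of \<open>(s, y)\<close> in \<open>s\<close>, collapses
  to \<open>[s, y]\<close> by repeated use of Jacobi; the two halves of the sum then cancel by antisymmetry.
\<close>

lemma bracket_branch_sum:
  "frag_extend (\<lambda>(a, w). frag_of (Br (Letter a) w)) (branch_sum s y) - word_mult (frag_of s) y
    \<in> zspan lie_relators"
proof (induction s arbitrary: y)
  case (Letter a)
  have "frag_extend (\<lambda>(a, w). frag_of (Br (Letter a) w)) (branch_sum (Letter a) y)
      = word_mult (frag_of (Letter a)) y"
    by (rule frag_linear_ext[where x = y])
       (simp_all add: otimes_bilinear word_mult_bilinear frag_extend_linear)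
  then show ?case by (simp add: zspan.zero)
next
  case (Br s t)
  let ?s = "frag_of s" and ?t = "frag_of t"
  have "(word_mult ?s (word_mult ?t y) + word_mult (word_mult ?t y) ?s)
      + (word_mult ?t (word_mult y ?s) + word_mult (word_mult y ?s) ?t)
      - (word_mult (word_mult ?s ?t) y + word_mult (word_mult ?t y) ?s
         + word_mult (word_mult y ?s) ?t) \<in> zspan lie_relators"
    by (intro zspan.diff zspan_add zspan_lie_antisym zspan_lie_jacobi)
  then have "(word_mult ?s (word_mult ?t y) + word_mult ?t (word_mult y ?s))
      - word_mult (frag_of (Br s t)) y \<in> zspan lie_relators"
    by (simp add: algebra_simps)
  moreover have "frag_extend (\<lambda>(a, w). frag_of (Br (Letter a) w)) (branch_sum (Br s t) y)
      - (word_mult ?s (word_mult ?t y) + word_mult ?t (word_mult y ?s)) \<in> zspan lie_relators"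
    unfolding branch_sum.simps frag_extend_add by (intro zspan_add_cong Br.IH)
  ultimately show ?case by (rule zspan_trans[rotated])
qed

lemma bracket_leaf_sum:
  "frag_extend (\<lambda>(a, w). frag_of (Br (Letter a) w)) (leaf_sum (u, v)) \<in> zspan lie_relators"
proof -
  have "frag_extend (\<lambda>(a, w). frag_of (Br (Letter a) w)) (leaf_sum (u, v))
      - (word_mult (frag_of u) (frag_of v) + word_mult (frag_of v) (frag_of u))
      \<in> zspan lie_relators"
    unfolding leaf_sum_def prod.case frag_extend_add by (intro zspan_add_cong bracket_branch_sum)
  then show ?thesis using zspan_lie_antisym by (rule zspan_subst)
qed


section \<open>A weighted contraction\<close>

text \<open>
  Give every letter \<open>a\<close> an integer weight \<open>k a\<close>. The map \<open>regraft k\<close> turns \<open>a \<otimes> w\<close> into \<open>k a\<close>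
  times the tree with root labelled \<open>a\<close>; applied to the sum over the univalent vertices of a tree
  it gives back the tree once for every univalent vertex, with the weight of its label.
\<close>

definition weight :: "('a \<Rightarrow> int) \<Rightarrow> 'a word \<Rightarrow> int" where
  "weight k w = (\<Sum>a\<in>#letter_mset w. k a)"

lemma weight_simps [simp]:
  "weight k (Letter a) = k a" "weight k (Br s t) = weight k s + weight k t"
  by (simp_all add: weight_def)

definition regraft :: "('a \<Rightarrow> int) \<Rightarrow> 'a \<times> 'a word \<Rightarrow> ('a word \<times> 'a word \<Rightarrow>\<^sub>0 int)" where
  "regraft k = (\<lambda>(a, w). frag_cmul (k a) (frag_of (Letter a, w)))"

lemma regraft_branch_sum:
  "frag_extend (regraft k) (branch_sum s y) - frag_cmul (weight k s) (otimes (frag_of s) y)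
    \<in> zspan pair_relators"
proof (induction s arbitrary: y)
  case (Letter a)
  have "frag_extend (regraft k) (branch_sum (Letter a) y)
      = frag_cmul (k a) (otimes (frag_of (Letter a)) y)"
    by (rule frag_linear_ext[where x = y])
       (simp_all add: regraft_def otimes_bilinear frag_extend_linear frag_cmul_diff_distrib2)
  then show ?case by (simp add: zspan.zero)
next
  case (Br s t)
  let ?s = "frag_of s" and ?t = "frag_of t"
  have "frag_cmul (weight k s) (otimes ?s (word_mult ?t y)
        - otimes (word_mult ?s ?t) y) \<in> zspan pair_relators"
    by (intro zspan_cmul zspan_sym[OF zspan_pair_move])
  moreover have "frag_cmul (weight k t) (otimes ?t (word_mult y ?s)
        - otimes (word_mult ?s ?t) y) \<in> zspan pair_relators"
    by (intro zspan_cmul zspan_pair_move')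
  ultimately have "(frag_cmul (weight k s) (otimes ?s (word_mult ?t y))
        + frag_cmul (weight k t) (otimes ?t (word_mult y ?s)))
      - (frag_cmul (weight k s) (otimes (word_mult ?s ?t) y)
        + frag_cmul (weight k t) (otimes (word_mult ?s ?t) y)) \<in> zspan pair_relators"
    by (intro zspan_add_cong) (simp_all only: frag_cmul_diff_distrib2)
  then have "(frag_cmul (weight k s) (otimes ?s (word_mult ?t y))
        + frag_cmul (weight k t) (otimes ?t (word_mult y ?s)))
      - frag_cmul (weight k (Br s t)) (otimes (frag_of (Br s t)) y) \<in> zspan pair_relators"
    by (simp add: frag_cmul_distrib)
  moreover have "frag_extend (regraft k) (branch_sum (Br s t) y)
      - (frag_cmul (weight k s) (otimes ?s (word_mult ?t y))
        + frag_cmul (weight k t) (otimes ?t (word_mult y ?s))) \<in> zspan pair_relators"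
    unfolding branch_sum.simps frag_extend_add by (intro zspan_add_cong Br.IH)
  ultimately show ?case by (rule zspan_trans[rotated])
qed

lemma regraft_leaf_sum:
  "frag_extend (regraft k) (leaf_sum (u, v)) - frag_cmul (weight k u + weight k v) (frag_of (u, v))
    \<in> zspan pair_relators"
proof -
  have "frag_extend (regraft k) (branch_sum v (frag_of u))
      - frag_cmul (weight k v) (frag_of (v, u)) \<in> zspan pair_relators"
    using regraft_branch_sum[of k v "frag_of u"] by simp
  moreover have "frag_cmul (weight k v) (frag_of (v, u)) - frag_cmul (weight k v) (frag_of (u, v))
      \<in> zspan pair_relators"
    unfolding frag_cmul_diff_distrib2[symmetric]
    by (intro zspan_cmul zspan.gen pair_relators.swap)
  ultimately have "frag_extend (regraft k) (branch_sum v (frag_of u))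
      - frag_cmul (weight k v) (frag_of (u, v)) \<in> zspan pair_relators"
    by (rule zspan_trans)
  moreover have "frag_extend (regraft k) (branch_sum u (frag_of v))
      - frag_cmul (weight k u) (frag_of (u, v)) \<in> zspan pair_relators"
    using regraft_branch_sum[of k u "frag_of v"] by simp
  ultimately show ?thesis
    unfolding leaf_sum_def prod.case frag_extend_add frag_cmul_distrib
    by (intro zspan_add_cong)
qed

text \<open>
  The other composite need not be a multiple of the identity, but it is one up to a map that factors
  through the bracket \<open>a \<otimes> w \<mapsto> [a, w]\<close>. The formula for this map is forced by \<open>homotopy_bracket\<close>
  on brackets with a letter; weighting the two sides crosswise makes it antisymmetric.
\<close>

primrec homotopy :: "('a \<Rightarrow> int) \<Rightarrow> 'a word \<Rightarrow> ('a \<times> 'a word \<Rightarrow>\<^sub>0 int)" where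
  "homotopy k (Letter a) = 0"
| "homotopy k (Br s t) = frag_cmul (weight k t) (branch_sum s (frag_of t))
     - frag_cmul (weight k s) (branch_sum t (frag_of s))"

lemma homotopy_bracket:
  "homotopy k (Br (Letter a) w) + frag_extend leaf_sum (regraft k (a, w))
    = frag_cmul (k a + weight k w) (frag_of (a, w))"
  by (simp add: regraft_def leaf_sum_def frag_extend_linear frag_cmul_distrib frag_cmul_distrib2)

lemma lie_relators_weight:
  assumes "g \<in> lie_relators"
  obtains n where "\<And>w. w \<in> Poly_Mapping.keys g \<Longrightarrow> weight k w = n"
  using lie_relators_homogeneous[OF assms] unfolding weight_def by metis

text \<open>
  All words of a relator have the same weight, so bracketing with \<open>w\<close> leaves fixed multiples of the
  relator in one or the other argument of \<^const>\<open>branch_sum\<close>.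
\<close>

lemma homotopy_mult_relator:
  assumes g: "g \<in> lie_relators"
  shows "frag_extend (homotopy k) (word_mult (frag_of w) g) \<in> zspan tensor_relators"
    and "frag_extend (homotopy k) (word_mult g (frag_of w)) \<in> zspan tensor_relators"
proof -
  obtain n where n: "\<And>w. w \<in> Poly_Mapping.keys g \<Longrightarrow> weight k w = n"
    using lie_relators_weight[OF g] by blast
  define P where "P x = frag_cmul n (branch_sum w x)
    - frag_cmul (weight k w) (frag_extend (\<lambda>s. branch_sum s (frag_of w)) x)" for x
  have P: "P g \<in> zspan tensor_relators"
    unfolding P_def
    by (intro zspan.diff zspan_cmul branch_sum_lie_right branch_sum_lie_left zspan.gen g)
  have P0: "P 0 = 0" "P (x - y) = P x - P y" for x y
    by (simp_all add: P_def branch_sum_linear frag_extend_linear frag_cmul_diff_distrib2)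
  have "Poly_Mapping.keys g \<subseteq> {w. weight k w = n}" using n by auto
  then have "frag_extend (homotopy k) (word_mult (frag_of w) g) = P g \<and>
      frag_extend (homotopy k) (word_mult g (frag_of w)) = - P g"
  proof (induction g rule: frag_induction)
    case (one s)
    then show ?case by (simp add: P_def)
  qed (auto simp: P0 word_mult_bilinear frag_extend_linear)
  then show "frag_extend (homotopy k) (word_mult (frag_of w) g) \<in> zspan tensor_relators"
    and "frag_extend (homotopy k) (word_mult g (frag_of w)) \<in> zspan tensor_relators"
    using P zspan_minus by auto
qed

lemma homotopy_lie_relators:
  assumes "g \<in> lie_relators" shows "frag_extend (homotopy k) g \<in> zspan tensor_relators"
  using assms
proof cases
  case (antisym s t)
  show ?thesis unfolding antisym by (simp add: frag_extend_linear zspan.zero)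
next
  case (jacobi r s t)
  \<comment> \<open>Each of the terms \<open>branch_sum r (Br s t)\<close>, cyclically permuted, occurs with total weight zero.\<close>
  have "frag_extend (homotopy k) g = 0"
    unfolding jacobi
    by (simp add: frag_extend_linear frag_cmul_distrib frag_cmul_distrib2 algebra_simps)
  then show ?thesis by (simp add: zspan.zero)
qed (auto intro: homotopy_mult_relator)


section \<open>Weights adapted to the letters\<close>

text \<open>
  All maps preserve the multiset of letters, so the weights may depend on it.
\<close>

definition regraft_by :: "('a multiset \<Rightarrow> 'a \<Rightarrow> int) \<Rightarrow> 'a \<times> 'a word \<Rightarrow> ('a word \<times> 'a word \<Rightarrow>\<^sub>0 int)"
  where "regraft_by c = (\<lambda>(a, w). regraft (c (add_mset a (letter_mset w))) (a, w))"

definition homotopy_by :: "('a multiset \<Rightarrow> 'a \<Rightarrow> int) \<Rightarrow> 'a word \<Rightarrow> ('a \<times> 'a word \<Rightarrow>\<^sub>0 int)"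
  where "homotopy_by c w = homotopy (c (letter_mset w)) w"

definition total :: "('a multiset \<Rightarrow> 'a \<Rightarrow> int) \<Rightarrow> 'a multiset \<Rightarrow> int" where
  "total c m = (\<Sum>a\<in>#m. c m a)"

lemma regraft_by_leaf_sum:
  "frag_extend (regraft_by c) (leaf_sum (u, v))
    - frag_cmul (total c (letter_mset u + letter_mset v)) (frag_of (u, v)) \<in> zspan pair_relators"
proof -
  let ?m = "letter_mset u + letter_mset v"
  have "frag_extend (regraft_by c) (leaf_sum (u, v)) = frag_extend (regraft (c ?m)) (leaf_sum (u, v))"
    by (intro frag_extend_eq) (auto simp: regraft_by_def dest!: leaf_sum_homogeneous)
  moreover have "total c ?m = weight (c ?m) u + weight (c ?m) v"
    by (simp add: total_def weight_def)
  ultimately show ?thesis by (simp add: regraft_leaf_sum)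
qed

lemma homotopy_by_bracket:
  "homotopy_by c (Br (Letter a) w) + frag_extend leaf_sum (regraft_by c (a, w))
    = frag_cmul (total c (add_mset a (letter_mset w))) (frag_of (a, w))"
  unfolding homotopy_by_def regraft_by_def prod.case letter_mset.simps
    add_mset_add_single[of a "letter_mset w", unfolded add.commute[of "letter_mset w"]]
    homotopy_bracket
  by (simp add: total_def weight_def)

lemma homotopy_by_lie:
  assumes "q \<in> zspan lie_relators" shows "frag_extend (homotopy_by c) q \<in> zspan tensor_relators"
  using assms
proof (rule frag_extend_zspan)
  fix g :: "'a word \<Rightarrow>\<^sub>0 int" assume g: "g \<in> lie_relators"
  then obtain m where m: "\<And>w. w \<in> Poly_Mapping.keys g \<Longrightarrow> letter_mset w = m"
    using lie_relators_homogeneous by blast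
  have "frag_extend (homotopy_by c) g = frag_extend (homotopy (c m)) g"
    by (intro frag_extend_eq) (simp add: homotopy_by_def m)
  then show "frag_extend (homotopy_by c) g \<in> zspan tensor_relators"
    using homotopy_lie_relators[OF g] by simp
qed

lemma regraft_by_tensor_relators:
  assumes "q \<in> zspan lie_relators"
  shows "frag_extend (regraft_by c) (otimes (frag_of a) q) \<in> zspan pair_relators"
proof -
  have "frag_extend (\<lambda>w. regraft_by c (a, w)) q \<in> zspan pair_relators"
    using assms
  proof (rule frag_extend_zspan)
    fix g :: "'a word \<Rightarrow>\<^sub>0 int" assume g: "g \<in> lie_relators"
    then obtain m where m: "\<And>w. w \<in> Poly_Mapping.keys g \<Longrightarrow> letter_mset w = m"
      using lie_relators_homogeneous by blast
    let ?k = "c (add_mset a m) a"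
    have "frag_extend (\<lambda>w. regraft_by c (a, w)) g
        = frag_extend (\<lambda>w. frag_cmul ?k (frag_of (Letter a, w))) g"
      by (intro frag_extend_eq) (simp add: regraft_by_def regraft_def m)
    also have "\<dots> = frag_cmul ?k (otimes (frag_of (Letter a)) g)"
      by (simp add: frag_extend_fun_cmul otimes_def)
    finally show "frag_extend (\<lambda>w. regraft_by c (a, w)) g \<in> zspan pair_relators"
      by (simp add: zspan_cmul otimes_zspan_lie_right zspan.gen g)
  qed
  then show ?thesis
    by (simp add: otimes_def frag_extend_frag_extend)
qed

lemma sum_mset_eq_sum_count:
  fixes c :: "'a \<Rightarrow> int"
  shows "(\<Sum>a\<in>#m. c a) = (\<Sum>a\<in>set_mset m. int (count m a) * c a)"
proof -
  have "finite A \<Longrightarrow> set_mset m \<subseteq> A \<Longrightarrow> (\<Sum>a\<in>#m. c a) = (\<Sum>a\<in>A. int (count m a) * c a)" for A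
  proof (induction m)
    case (add x m)
    have "(\<Sum>a\<in>A. int (count (add_mset x m) a) * c a)
        = (\<Sum>a\<in>A. (if a = x then c a else 0) + int (count m a) * c a)"
      by (intro sum.cong) (auto simp: algebra_simps)
    then show ?case using add by (simp add: sum.distrib)
  qed simp
  then show ?thesis by simp
qed

lemma bezout_multiplicities:
  fixes f :: "'a \<Rightarrow> nat"
  assumes "finite A"
  shows "\<exists>c :: 'a \<Rightarrow> int. (\<Sum>a\<in>A. int (f a) * c a) = int (Gcd (f ` A))"
  using assms
proof induction
  case (insert b A)
  then obtain c :: "'a \<Rightarrow> int" where c: "(\<Sum>a\<in>A. int (f a) * c a) = int (Gcd (f ` A))"
    by blast
  obtain x y where xy: "x * int (f b) + y * int (Gcd (f ` A)) = gcd (int (f b)) (int (Gcd (f ` A)))"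
    using bezout_int by blast
  let ?d = "\<lambda>a. if a = b then x else y * c a"
  have "(\<Sum>a\<in>A. int (f a) * ?d a) = (\<Sum>a\<in>A. y * (int (f a) * c a))"
    using insert.hyps by (intro sum.cong) auto
  then have "(\<Sum>a\<in>insert b A. int (f a) * ?d a) = int (f b) * x + y * int (Gcd (f ` A))"
    using insert.hyps c by (simp flip: sum_distrib_left)
  also have "\<dots> = int (Gcd (f ` insert b A))"
    using xy by (simp add: mult.commute gcd_int_int_eq)
  finally show ?case by (rule exI[of _ ?d])
qed simp

text \<open>
  The multiplicities of the letters add up to \<open>p ^ k\<close>. As there is more than one letter, they are all
  smaller than \<open>p ^ k\<close>; hence their gcd is a proper divisor of \<open>p ^ k\<close> and divides \<open>p ^ (k - 1)\<close>.
\<close>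

lemma prime_power_weights:
  assumes p: "prime p" "k \<ge> 1" and m: "size m = p ^ k" and not_single: "\<not> (\<exists>a. set_mset m \<subseteq> {a})"
  shows "\<exists>c :: 'a \<Rightarrow> int. (\<Sum>a\<in>#m. c a) = int (p ^ (k - 1))"
proof -
  let ?g = "Gcd (count m ` set_mset m)"
  have sum: "(\<Sum>a\<in>set_mset m. count m a) = p ^ k"
    using m by (simp add: size_multiset_overloaded_eq)
  have "?g dvd (\<Sum>a\<in>set_mset m. count m a)"
    by (intro dvd_sum) (auto intro: Gcd_dvd)
  then obtain j where j: "j \<le> k" "?g = p ^ j"
    using divides_primepow_nat[OF p(1)] unfolding sum by blast
  obtain a b where ab: "a \<in># m" "b \<in># m" "a \<noteq> b"
    using not_single by blast
  have "count m a + count m b \<le> (\<Sum>a\<in>set_mset m. count m a)"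
    using ab sum_mono2[of "set_mset m" "{a, b}" "count m"] by simp
  moreover have "count m b > 0" "count m a > 0" using ab by simp_all
  moreover have "?g \<le> count m a"
    using ab \<open>count m a > 0\<close> by (intro dvd_imp_le Gcd_dvd) auto
  ultimately have "p ^ j < p ^ k" using j(2) sum by linarith
  then have "j < k" using p prime_gt_1_nat power_less_imp_less_exp by blast
  obtain c :: "'a \<Rightarrow> int" where c: "(\<Sum>a\<in>set_mset m. int (count m a) * c a) = int ?g"
    using bezout_multiplicities[of "set_mset m" "count m"] by auto
  have "(\<Sum>a\<in>#m. c a * int (p ^ (k - 1 - j)))
      = (\<Sum>a\<in>set_mset m. int (count m a) * c a) * int (p ^ (k - 1 - j))"
    by (simp add: sum_mset_eq_sum_count sum_distrib_right mult.assoc)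
  also have "\<dots> = int (p ^ j * p ^ (k - 1 - j))" using c j by simp
  also have "p ^ j * p ^ (k - 1 - j) = p ^ (k - 1)"
    using \<open>j < k\<close> by (simp flip: power_add)
  finally show ?thesis by blast
qed


section \<open>Quotients of free abelian groups\<close>

lemma zspan_keys:
  assumes "x \<in> zspan R" and R: "\<And>r. r \<in> R \<Longrightarrow> Poly_Mapping.keys r \<subseteq> S"
  shows "Poly_Mapping.keys x \<subseteq> S"
  using assms(1)
proof induction
  case (diff x y)
  then show ?case by (intro order_trans[OF keys_diff] Un_least)
qed (simp_all add: R)

definition frag_class :: "('s \<Rightarrow>\<^sub>0 int) set \<Rightarrow> ('s \<Rightarrow>\<^sub>0 int) \<Rightarrow> ('s \<Rightarrow>\<^sub>0 int) set" where
  "frag_class R x = (\<lambda>k. k + x) ` zspan R"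

lemma mem_frag_class: "y \<in> frag_class R x \<longleftrightarrow> y - x \<in> zspan R"
  by (force simp: frag_class_def image_iff)

lemma frag_class_self: "x \<in> frag_class R x"
  by (simp add: mem_frag_class zspan.zero)

lemma frag_class_eq_iff: "frag_class R x = frag_class R y \<longleftrightarrow> x - y \<in> zspan R"
proof
  assume "frag_class R x = frag_class R y"
  then show "x - y \<in> zspan R" using frag_class_self[of x R] by (simp add: mem_frag_class)
next
  assume *: "x - y \<in> zspan R"
  show "frag_class R x = frag_class R y"
  proof (rule Set.set_eqI)
    fix z show "z \<in> frag_class R x \<longleftrightarrow> z \<in> frag_class R y"
      using zspan_trans[of z x R y] zspan_trans[of z y R x] * zspan_sym[OF *]
      by (auto simp: mem_frag_class)
  qed
qed

lemma r_coset_free_Abelian_group: "K #>\<^bsub>free_Abelian_group S\<^esub> x = (\<lambda>k. k + x) ` K"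
  by (auto simp: r_coset_def)

lemma frag_class_set_mult:
  "frag_class R x <#>\<^bsub>free_Abelian_group S\<^esub> frag_class R y = frag_class R (x + y)"
proof (rule Set.set_eqI)
  fix z
  have "z \<in> frag_class R x <#>\<^bsub>free_Abelian_group S\<^esub> frag_class R y \<longleftrightarrow>
      (\<exists>a b. a - x \<in> zspan R \<and> b - y \<in> zspan R \<and> z = a + b)"
    by (simp add: set_mult_def Bex_def mem_frag_class)
  also have "\<dots> \<longleftrightarrow> z - (x + y) \<in> zspan R"
  proof
    assume "\<exists>a b. a - x \<in> zspan R \<and> b - y \<in> zspan R \<and> z = a + b"
    then show "z - (x + y) \<in> zspan R" using zspan_add_cong by blast
  next
    assume "z - (x + y) \<in> zspan R"
    then have "(z - y) - x \<in> zspan R \<and> y - y \<in> zspan R \<and> z = (z - y) + y"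
      by (simp add: zspan.zero algebra_simps)
    then show "\<exists>a b. a - x \<in> zspan R \<and> b - y \<in> zspan R \<and> z = a + b" by blast
  qed
  finally show "z \<in> frag_class R x <#>\<^bsub>free_Abelian_group S\<^esub> frag_class R y
      \<longleftrightarrow> z \<in> frag_class R (x + y)"
    by (simp add: mem_frag_class)
qed

text \<open>
  Groups given by generators and relations and the degree parts of the quasi-Lie algebra at once: in
  the latter, \<open>A\<close> consists of homogeneous elements, while \<open>R\<close> is the ideal of the whole algebra.
\<close>

locale frag_quotient =
  fixes R A :: "('s \<Rightarrow>\<^sub>0 int) set" and Q :: "('s \<Rightarrow>\<^sub>0 int) set monoid"
  assumes carrier_eq: "carrier Q = frag_class R ` A"
    and zero: "0 \<in> A"
    and diff: "x \<in> A \<Longrightarrow> y \<in> A \<Longrightarrow> x - y \<in> A"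
    and mult: "x \<in> A \<Longrightarrow> y \<in> A \<Longrightarrow> frag_class R x \<otimes>\<^bsub>Q\<^esub> frag_class R y = frag_class R (x + y)"
    and one: "\<one>\<^bsub>Q\<^esub> = frag_class R 0"
begin

lemma uminus: "x \<in> A \<Longrightarrow> - x \<in> A"
  using diff[OF zero] by fastforce

lemma add: "x \<in> A \<Longrightarrow> y \<in> A \<Longrightarrow> x + y \<in> A"
  using diff[OF _ uminus] by fastforce

lemma closed: "x \<in> A \<Longrightarrow> frag_class R x \<in> carrier Q"
  by (simp add: carrier_eq)

lemma comm_group: "comm_group Q"
proof (rule comm_groupI)
  fix X assume "X \<in> carrier Q"
  then obtain x where x: "X = frag_class R x" "x \<in> A" by (auto simp: carrier_eq)
  then have "frag_class R (- x) \<otimes>\<^bsub>Q\<^esub> X = \<one>\<^bsub>Q\<^esub>"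
    by (simp add: mult uminus one)
  then show "\<exists>Y\<in>carrier Q. Y \<otimes>\<^bsub>Q\<^esub> X = \<one>\<^bsub>Q\<^esub>"
    using x closed[OF uminus] by blast
qed (auto simp: carrier_eq mult add one zero ac_simps)

lemma one_iff: "frag_class R x = \<one>\<^bsub>Q\<^esub> \<longleftrightarrow> x \<in> zspan R"
  by (simp add: one frag_class_eq_iff)

lemma cmul: "x \<in> A \<Longrightarrow> frag_cmul k x \<in> A"
  by (rule frag_closure_minus_cmul[where P = "\<lambda>x. x \<in> A"]) (auto intro: zero diff)

lemma sum: "(\<And>i. i \<in> I \<Longrightarrow> f i \<in> A) \<Longrightarrow> sum f I \<in> A"
  by (induction I rule: infinite_finite_induct) (auto intro: zero add)

lemma nat_pow: "x \<in> A \<Longrightarrow> frag_class R x [^]\<^bsub>Q\<^esub> (n :: nat) = frag_class R (frag_cmul (int n) x)"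
proof (induction n)
  case 0
  then show ?case by (simp add: one)
next
  case (Suc n)
  interpret Q: comm_group Q by (rule comm_group)
  have "frag_cmul (int (Suc n)) x = frag_cmul (int n) x + x"
    using frag_cmul_distrib[of "int n" 1 x] by (simp add: add.commute)
  then show ?case using Suc by (simp add: mult cmul)
qed

lemma int_pow: "x \<in> A \<Longrightarrow> frag_class R x [^]\<^bsub>Q\<^esub> (k :: int) = frag_class R (frag_cmul k x)"
proof (cases k)
  case (neg n)
  interpret Q: comm_group Q by (rule comm_group)
  assume x: "x \<in> A"
  have "frag_class R x [^]\<^bsub>Q\<^esub> k = inv\<^bsub>Q\<^esub> (frag_class R (frag_cmul (int (Suc n)) x))"
    using x neg by (simp only: neg Q.int_pow_neg closed int_pow_int nat_pow)
  also have "\<dots> = frag_class R (frag_cmul k x)"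
    using x neg
    by (intro Q.inv_equality)
       (auto simp: mult cmul closed one frag_cmul_distrib[symmetric] simp del: of_nat_Suc)
  finally show ?thesis .
qed (simp add: int_pow_int nat_pow)

lemma finprod:
  "finite I \<Longrightarrow> (\<And>i. i \<in> I \<Longrightarrow> f i \<in> A) \<Longrightarrow>
    finprod Q (\<lambda>i. frag_class R (f i)) I = frag_class R (sum f I)"
proof (induction I rule: finite_induct)
  case empty
  interpret Q: comm_group Q by (rule comm_group)
  show ?case by (simp add: one)
next
  case (insert i I)
  interpret Q: comm_group Q by (rule comm_group)
  show ?case using insert by (simp add: closed mult sum Pi_iff)
qed

lemma free_ext:
  assumes "\<And>s. s \<in> Poly_Mapping.keys x \<Longrightarrow> f s = frag_class R (F s) \<and> F s \<in> A"
  shows "free_ext Q f x = frag_class R (frag_extend F x)"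
proof -
  interpret Q: comm_group Q by (rule comm_group)
  have "free_ext Q f x = finprod Q
      (\<lambda>s. frag_class R (frag_cmul (Poly_Mapping.lookup x s) (F s))) (Poly_Mapping.keys x)"
    unfolding free_ext_def using assms
    by (intro Q.finprod_cong) (auto simp: int_pow closed cmul simp_implies_def)
  also have "\<dots> = frag_class R (frag_extend F x)"
    unfolding frag_extend_def by (rule finprod) (auto simp: cmul assms)
  finally show ?thesis .
qed

lemma induced:
  assumes R': "\<And>r. r \<in> R' \<Longrightarrow> Poly_Mapping.keys r \<subseteq> S \<and> frag_extend F r \<in> zspan R"
    and f: "\<And>s. s \<in> S \<Longrightarrow> f s = frag_class R (F s) \<and> F s \<in> A"
    and x: "Poly_Mapping.keys x \<subseteq> S"
  shows "induced Q f (frag_class R' x) = frag_class R (frag_extend F x)"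
proof -
  have "free_ext Q f y = frag_class R (frag_extend F x)" if y: "y \<in> frag_class R' x" for y
  proof -
    have *: "y - x \<in> zspan R'" using y by (simp add: mem_frag_class)
    then have "Poly_Mapping.keys (y - x) \<subseteq> S"
      by (rule zspan_keys) (use R' in blast)
    then have "Poly_Mapping.keys y \<subseteq> S" using x keys_add[of "y - x" x] by auto
    then have "free_ext Q f y = frag_class R (frag_extend F y)"
      using f by (intro free_ext) auto
    moreover have "frag_extend F (y - x) \<in> zspan R"
      using * by (rule frag_extend_zspan) (use R' in blast)
    ultimately show ?thesis by (simp add: frag_class_eq_iff frag_extend_diff)
  qed
  then have "free_ext Q f ` frag_class R' x = {frag_class R (frag_extend F x)}"
    using frag_class_self[of x R'] by auto
  then show ?thesis by (simp add: induced_def)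
qed

end

lemma relators_eq_zspan:
  assumes R: "\<And>r. r \<in> R \<Longrightarrow> Poly_Mapping.keys r \<subseteq> S"
  shows "relators S R = zspan R"
proof (intro equalityI subsetI)
  fix x assume "x \<in> relators S R"
  then show "x \<in> zspan R"
    unfolding relators_def
    by induction (auto simp: R intro: zspan.zero zspan.gen zspan_add zspan_minus)
next
  fix x assume "x \<in> zspan R"
  then show "x \<in> relators S R"
    unfolding relators_def
  proof induction
    case zero
    show ?case using generate.one[of "free_Abelian_group S" R] by simp
  next
    case (gen x)
    then show ?case by (rule generate.incl)
  next
    case (diff x y)
    have "Poly_Mapping.keys y \<subseteq> S" using diff.hyps(2) R by (rule zspan_keys)
    moreover have "R \<subseteq> carrier (free_Abelian_group S)" using R by auto
    then have "inv\<^bsub>free_Abelian_group S\<^esub> y \<in> generate (free_Abelian_group S) R"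
      using diff.IH(2) by (intro group.generate_m_inv_closed) auto
    ultimately show ?case
      using generate.eng[OF diff.IH(1), of "- y"] by simp
  qed
qed

lemma presented_frag_quotient:
  assumes R: "\<And>r. r \<in> R \<Longrightarrow> Poly_Mapping.keys r \<subseteq> S"
  shows "frag_quotient R {x. Poly_Mapping.keys x \<subseteq> S} (presented S R)"
proof
  show "carrier (presented S R) = frag_class R ` {x. Poly_Mapping.keys x \<subseteq> S}"
    by (auto simp: presented_def FactGroup_def RCOSETS_def r_coset_free_Abelian_group
        relators_eq_zspan[OF R] frag_class_def)
  show "\<one>\<^bsub>presented S R\<^esub> = frag_class R 0"
    by (simp add: presented_def FactGroup_def relators_eq_zspan[OF R] frag_class_def)
  show "x - y \<in> {x. Poly_Mapping.keys x \<subseteq> S}"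
    if "x \<in> {x. Poly_Mapping.keys x \<subseteq> S}" "y \<in> {x. Poly_Mapping.keys x \<subseteq> S}" for x y
    using that keys_diff[of x y] by auto
qed (simp_all add: presented_def FactGroup_def frag_class_set_mult)

lemma presented_gen_eq:
  assumes "\<And>r. r \<in> R \<Longrightarrow> Poly_Mapping.keys r \<subseteq> S"
  shows "presented_gen S R s = frag_class R (frag_of s)"
  by (simp add: presented_gen_def r_coset_free_Abelian_group frag_class_def
      relators_eq_zspan[OF assms])


section \<open>The quasi-Lie ideal of words\<close>

lemma zspan_quasi_lie_ideal [simp]: "zspan (quasi_lie_ideal H) = quasi_lie_ideal H"
proof (intro equalityI subsetI)
  fix x assume "x \<in> zspan (quasi_lie_ideal H)"
  then show "x \<in> quasi_lie_ideal H" by induction (auto intro: quasi_lie_ideal.intros)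
qed (rule zspan.gen)

lemma quasi_lie_class_eq: "quasi_lie_class H x = frag_class (quasi_lie_ideal H) x"
  by (simp add: quasi_lie_class_def r_coset_free_Abelian_group frag_class_def)

lemma words_simps [simp]:
  "Letter a \<in> words H \<longleftrightarrow> a \<in> carrier H" "Br s t \<in> words H \<longleftrightarrow> s \<in> words H \<and> t \<in> words H"
  by (auto simp: words_def)

lemma keys_word_mult_words:
  "Poly_Mapping.keys x \<subseteq> words H \<Longrightarrow> Poly_Mapping.keys y \<subseteq> words H \<Longrightarrow>
    Poly_Mapping.keys (word_mult x y) \<subseteq> words H"
  using keys_word_mult[of x y] by fastforce

lemma quasi_lie_ideal_keys:
  assumes "comm_group H" "x \<in> quasi_lie_ideal H" shows "Poly_Mapping.keys x \<subseteq> words H"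
  using assms(2)
proof induction
  case (additive a b)
  interpret comm_group H by fact
  show ?case
    using additive by (intro order_trans[OF keys_diff] Un_least) auto
next
  case (antisym x y)
  then show ?case
    by (intro order_trans[OF keys_add] Un_least keys_word_mult_words) auto
next
  case (jacobi x y z)
  then show ?case
    by (intro order_trans[OF keys_add] Un_least keys_word_mult_words) auto
next
  case (diff x y)
  then show ?case by (intro order_trans[OF keys_diff] Un_least)
qed (simp_all add: keys_word_mult_words)

lemma quasi_lie_deg_frag_quotient:
  assumes "comm_group H"
  shows "frag_quotient (quasi_lie_ideal H)
    {x. Poly_Mapping.keys x \<subseteq> {t \<in> words H. word_length t = m}} (quasi_lie_deg H m)"
proof
  show "x - y \<in> {x. Poly_Mapping.keys x \<subseteq> {t \<in> words H. word_length t = m}}"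
    if "x \<in> {x. Poly_Mapping.keys x \<subseteq> {t \<in> words H. word_length t = m}}"
      "y \<in> {x. Poly_Mapping.keys x \<subseteq> {t \<in> words H. word_length t = m}}" for x y
    using that keys_diff[of x y] by auto
  show "\<one>\<^bsub>quasi_lie_deg H m\<^esub> = frag_class (quasi_lie_ideal H) 0"
    by (simp add: quasi_lie_deg_def quasi_lie_def FactGroup_def frag_class_def)
qed (auto simp add: quasi_lie_deg_def quasi_lie_def FactGroup_def frag_class_set_mult
    quasi_lie_class_eq)

lemma quasi_lie_bracket_class:
  assumes H: "comm_group H"
    and x: "Poly_Mapping.keys x \<subseteq> words H" and y: "Poly_Mapping.keys y \<subseteq> words H"
  shows "quasi_lie_bracket H (quasi_lie_class H x) (quasi_lie_class H y)
    = quasi_lie_class H (word_mult x y)"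
proof -
  have "quasi_lie_class H (word_mult x' y') = quasi_lie_class H (word_mult x y)"
    if "x' \<in> quasi_lie_class H x" "y' \<in> quasi_lie_class H y" for x' y'
  proof -
    have d: "x' - x \<in> quasi_lie_ideal H" "y' - y \<in> quasi_lie_ideal H"
      using that by (simp_all add: quasi_lie_class_eq mem_frag_class)
    have "Poly_Mapping.keys y' \<subseteq> words H"
      using quasi_lie_ideal_keys[OF H d(2)] y keys_add[of "y' - y" y] by auto
    then have "word_mult (x' - x) y' \<in> quasi_lie_ideal H"
      using d(1) by (intro quasi_lie_ideal.mult_right) auto
    moreover have "word_mult x (y' - y) \<in> quasi_lie_ideal H"
      using d(2) x by (intro quasi_lie_ideal.mult_left) auto
    ultimately have "word_mult (x' - x) y' + word_mult x (y' - y) \<in> zspan (quasi_lie_ideal H)"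
      by (intro zspan_add) auto
    then show ?thesis
      by (simp add: quasi_lie_class_eq frag_class_eq_iff word_mult_bilinear)
  qed
  moreover have "x \<in> quasi_lie_class H x" "y \<in> quasi_lie_class H y"
    by (simp_all add: quasi_lie_class_eq frag_class_self)
  ultimately show ?thesis unfolding quasi_lie_bracket_def by blast
qed

text \<open>
  Letters outside \<open>H\<close> may occur in \<^const>\<open>lie_relators\<close>; by homogeneity they occur in all words of a
  relator or in none.
\<close>

lemma restricted_lie_relator:
  "g \<in> lie_relators \<Longrightarrow>
    frag_extend (\<lambda>w. if w \<in> words H then frag_of w else 0) g \<in> quasi_lie_ideal H"
proof (induction rule: lie_relators.induct)
  case (antisym s t)
  show ?case
    using quasi_lie_ideal.antisym[of "frag_of s" H "frag_of t"]
    by (auto simp: frag_extend_linear intro: quasi_lie_ideal.zero)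
next
  case (jacobi r s t)
  show ?case
    using quasi_lie_ideal.jacobi[of "frag_of r" H "frag_of s" "frag_of t"]
    by (auto simp: frag_extend_linear intro: quasi_lie_ideal.zero)
next
  case (left g w)
  let ?r = "frag_extend (\<lambda>w. if w \<in> words H then frag_of w else 0)"
  have "Poly_Mapping.keys (?r g) \<subseteq> words H" by (rule keys_frag_extendI) auto
  moreover have "?r (word_mult (frag_of w) x) = (if w \<in> words H then word_mult (frag_of w) (?r x) else 0)" for x
    by (rule frag_linear_ext[where x = x]) (auto simp: word_mult_bilinear frag_extend_linear)
  ultimately show ?case
    using left.IH by (auto intro!: quasi_lie_ideal.mult_left quasi_lie_ideal.zero)
next
  case (right g w)
  let ?r = "frag_extend (\<lambda>w. if w \<in> words H then frag_of w else 0)"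
  have "Poly_Mapping.keys (?r g) \<subseteq> words H" by (rule keys_frag_extendI) auto
  moreover have "?r (word_mult x (frag_of w)) = (if w \<in> words H then word_mult (?r x) (frag_of w) else 0)" for x
    by (rule frag_linear_ext[where x = x]) (auto simp: word_mult_bilinear frag_extend_linear)
  ultimately show ?case
    using right.IH by (auto intro!: quasi_lie_ideal.mult_right quasi_lie_ideal.zero)
qed

lemma zspan_lie_quasi_lie_ideal:
  assumes q: "q \<in> zspan lie_relators" and "Poly_Mapping.keys q \<subseteq> words H"
  shows "q \<in> quasi_lie_ideal H"
proof -
  let ?r = "frag_extend (\<lambda>w. if w \<in> words H then frag_of w else 0)"
  have "?r q \<in> zspan (quasi_lie_ideal H)"
    using q by (rule frag_extend_zspan) (simp add: restricted_lie_relator)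
  moreover have "?r q = frag_extend frag_of q"
    using assms(2) by (intro frag_extend_eq) auto
  ultimately show ?thesis using frag_expansion[of q] by simp
qed


section \<open>Expansion in a basis\<close>

text \<open>
  The basis is a subset of \<open>H\<close> itself, so that words over the basis are words over \<open>H\<close> and expansion
  in the basis is an endomorphism of the group of words.
\<close>

locale coordinates =
  fixes H :: "('a, 'm) monoid_scheme" and coord :: "'a \<Rightarrow> ('a \<Rightarrow>\<^sub>0 int)"
  assumes comm_group_H: "comm_group H"
    and coord_mult: "a \<in> carrier H \<Longrightarrow> b \<in> carrier H \<Longrightarrow> coord (a \<otimes>\<^bsub>H\<^esub> b) = coord a + coord b"
    and coord_inj: "inj_on coord (carrier H)"
    and coord_keys: "a \<in> carrier H \<Longrightarrow>
      Poly_Mapping.keys (coord a) \<subseteq> {x \<in> carrier H. coord x = frag_of x}"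
begin

definition basis :: "'a set" where "basis = {x \<in> carrier H. coord x = frag_of x}"

sublocale H: comm_group H by (rule comm_group_H)

lemma coord_one: "coord \<one>\<^bsub>H\<^esub> = 0"
  using coord_mult[of "\<one>\<^bsub>H\<^esub>" "\<one>\<^bsub>H\<^esub>"] by simp

lemma coord_diff:
  assumes "a \<in> carrier H" "b \<in> carrier H" shows "coord (a \<otimes>\<^bsub>H\<^esub> inv\<^bsub>H\<^esub> b) = coord a - coord b"
  using assms coord_mult[of "inv\<^bsub>H\<^esub> b" b] by (simp add: coord_mult coord_one eq_neg_iff_add_eq_0[symmetric])

text \<open>
  A map that is additive modulo \<open>R\<close> is determined by its values on the basis. It suffices to find for
  every combination of basis elements one element with these coordinates for which the claim holds,
  because coordinates are injective.
\<close>

lemma additive_eq_coord: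
  assumes f: "\<And>a b. a \<in> carrier H \<Longrightarrow> b \<in> carrier H \<Longrightarrow> f (a \<otimes>\<^bsub>H\<^esub> b) - f a - f b \<in> zspan R"
    and a: "a \<in> carrier H"
  shows "f a - frag_extend f (coord a) \<in> zspan R"
proof -
  have one: "f \<one>\<^bsub>H\<^esub> \<in> zspan R"
    using zspan_minus[OF f[of "\<one>\<^bsub>H\<^esub>" "\<one>\<^bsub>H\<^esub>"]] by simp
  have "\<exists>b \<in> carrier H. coord b = y \<and> f b - frag_extend f y \<in> zspan R"
    if "Poly_Mapping.keys y \<subseteq> basis" for y
    using that
  proof (induction y rule: frag_induction)
    case zero
    show ?case using one by (intro bexI[of _ "\<one>\<^bsub>H\<^esub>"]) (auto simp: coord_one)
  next
    case (one x)
    then show ?case by (intro bexI[of _ x]) (auto simp: basis_def zspan.zero)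
  next
    case (diff x y)
    then obtain b c where b: "b \<in> carrier H" "coord b = x" "f b - frag_extend f x \<in> zspan R"
      and c: "c \<in> carrier H" "coord c = y" "f c - frag_extend f y \<in> zspan R" by blast
    let ?d = "b \<otimes>\<^bsub>H\<^esub> inv\<^bsub>H\<^esub> c"
    have "?d \<otimes>\<^bsub>H\<^esub> c = b" using b(1) c(1) by (simp add: H.m_assoc)
    then have "f b - f ?d - f c \<in> zspan R" using f[of ?d c] b(1) c(1) by simp
    from zspan_minus[OF this] have "f ?d - (f b - f c) \<in> zspan R"
      by (simp add: algebra_simps)
    moreover have "(f b - f c) - (frag_extend f x - frag_extend f y) \<in> zspan R"
      using b(3) c(3) by (rule zspan_diff_cong)
    ultimately have "f ?d - frag_extend f (x - y) \<in> zspan R"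
      unfolding frag_extend_diff by (rule zspan_trans)
    then show ?case using b c by (intro bexI[of _ ?d]) (auto simp: coord_diff)
  qed
  then obtain b where "b \<in> carrier H" "coord b = coord a"
      "f b - frag_extend f (coord a) \<in> zspan R"
    using coord_keys[OF a] unfolding basis_def by metis
  then show ?thesis using coord_inj a by (auto dest: inj_onD)
qed

primrec expand :: "'a word \<Rightarrow> ('a word \<Rightarrow>\<^sub>0 int)" where
  "expand (Letter a) = frag_extend (\<lambda>x. frag_of (Letter x)) (coord a)"
| "expand (Br s t) = word_mult (expand s) (expand t)"

lemma expand_word_mult:
  "frag_extend expand (word_mult x y) = word_mult (frag_extend expand x) (frag_extend expand y)"
proof (rule frag_linear_ext[where x = x], goal_cases)
  case (3 s)
  show ?case
    by (rule frag_linear_ext[where x = y])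
       (simp_all add: word_mult_bilinear frag_extend_linear)
qed (simp_all add: word_mult_bilinear frag_extend_linear)

lemma expand_quasi_lie_ideal:
  "x \<in> quasi_lie_ideal H \<Longrightarrow> frag_extend expand x \<in> zspan lie_relators"
proof (induction rule: quasi_lie_ideal.induct)
  case (additive a b)
  then show ?case by (simp add: frag_extend_linear coord_mult zspan.zero)
next
  case (mult_left x y)
  then show ?case by (simp add: expand_word_mult zspan_lie_mult_left)
next
  case (mult_right x y)
  then show ?case by (simp add: expand_word_mult zspan_lie_mult_right)
qed (auto simp: frag_extend_linear expand_word_mult
    intro: zspan.zero zspan.diff zspan_lie_antisym zspan_lie_jacobi)

lemma keys_expand:
  assumes "w \<in> words H"
  shows "Poly_Mapping.keys (expand w) \<subseteq> {v. letters v \<subseteq> basis \<and> word_length v = word_length w}"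
  using assms
proof (induction w)
  case (Letter a)
  then show ?case
    using coord_keys[of a] unfolding expand.simps
    by (intro keys_frag_extendI) (auto simp: basis_def)
next
  case (Br s t)
  then show ?case
    using keys_word_mult[of "expand s" "expand t"] by fastforce
qed

lemma basis_words: "letters w \<subseteq> basis \<Longrightarrow> w \<in> words H"
  by (auto simp: words_def basis_def)

lemma expand_basis: "letters w \<subseteq> basis \<Longrightarrow> expand w = frag_of w"
  by (induction w) (auto simp: basis_def)

lemma expand_cong:
  assumes "w \<in> words H" shows "frag_of w - expand w \<in> quasi_lie_ideal H"
  using assms
proof (induction w)
  case (Letter a)
  have "frag_of (Letter a) - frag_extend (\<lambda>x. frag_of (Letter x)) (coord a)
    \<in> zspan (quasi_lie_ideal H)"
    by (rule additive_eq_coord) (use Letter in \<open>auto intro: quasi_lie_ideal.additive\<close>)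
  then show ?case by simp
next
  case (Br s t)
  have "Poly_Mapping.keys (expand t) \<subseteq> words H"
    using keys_expand[of t] Br.prems basis_words by auto
  then have "word_mult (frag_of s - expand s) (expand t) \<in> zspan (quasi_lie_ideal H)"
    using quasi_lie_ideal.mult_right[of "frag_of s - expand s" H "expand t"] Br by simp
  moreover have "word_mult (frag_of s) (frag_of t - expand t) \<in> zspan (quasi_lie_ideal H)"
    using quasi_lie_ideal.mult_left[of "frag_of t - expand t" H "frag_of s"] Br by simp
  ultimately have "word_mult (frag_of s - expand s) (expand t)
      + word_mult (frag_of s) (frag_of t - expand t) \<in> zspan (quasi_lie_ideal H)"
    by (rule zspan_add)
  then show ?case by (simp add: word_mult_bilinear)
qed

end

lemma fg_free_abelian_coordinates:
  fixes H :: "('a, 'm) monoid_scheme"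
  assumes "fg_free_abelian H"
  shows "\<exists>coord. coordinates H coord"
proof -
  from assms obtain B :: "nat set" and h where
    H: "comm_group H" and h: "h \<in> iso H (free_Abelian_group B)"
    by (auto simp: fg_free_abelian_def is_iso_def)
  interpret comm_group H by (rule H)
  have bij: "bij_betw h (carrier H) (carrier (free_Abelian_group B))"
    and hom: "h \<in> hom H (free_Abelian_group B)"
    using h by (auto simp: iso_def)
  define e where "e b = inv_into (carrier H) h (frag_of b)" for b
  define coord where "coord a = frag_extend (frag_of \<circ> e) (h a)" for a
  have e: "e b \<in> carrier H" "h (e b) = frag_of b" if "b \<in> B" for b
  proof -
    have "frag_of b \<in> h ` carrier H" using bij that by (simp add: bij_betw_def)
    then show "e b \<in> carrier H" "h (e b) = frag_of b"
      unfolding e_def by (rule inv_into_into, rule f_inv_into_f)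
  qed
  have coord_e: "coord (e b) = frag_of (e b)" if "b \<in> B" for b
    using e[OF that] by (simp add: coord_def)
  have keys_h: "Poly_Mapping.keys (h a) \<subseteq> B" if "a \<in> carrier H" for a
  proof -
    have "h a \<in> carrier (free_Abelian_group B)" using bij_betwE[OF bij] that by blast
    then show ?thesis by simp
  qed
  have "coordinates H coord"
  proof
    fix a b assume "a \<in> carrier H" "b \<in> carrier H"
    then show "coord (a \<otimes>\<^bsub>H\<^esub> b) = coord a + coord b"
      using hom by (simp add: coord_def hom_def frag_extend_add)
  next
    fix a assume a: "a \<in> carrier H"
    show "Poly_Mapping.keys (coord a) \<subseteq> {x \<in> carrier H. coord x = frag_of x}"
      unfolding coord_def using keys_h[OF a] e coord_e by (intro keys_frag_extendI) auto
  next
    have "frag_extend h (coord a) = h a" if "a \<in> carrier H" for a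
    proof -
      have "frag_extend h (coord a) = frag_extend (h \<circ> e) (h a)"
        unfolding coord_def by (rule frag_extend_compose)
      also have "\<dots> = frag_extend frag_of (h a)"
        using keys_h[OF that] e by (intro frag_extend_eq) auto
      finally show ?thesis using frag_expansion[of "h a"] by simp
    qed
    then show "inj_on coord (carrier H)"
      using bij by (metis bij_betw_def inj_on_def)
  qed
  then show ?thesis by blast
qed


section \<open>Planar words of branches\<close>

text \<open>
  \<open>branch_word T e w\<close>: cutting the tree at the edge of \<open>e\<close>, the part that contains the vertex of \<open>e\<close>
  is the planar rooted tree \<open>w\<close>, with root edge \<open>e\<close>.
\<close>

inductive branch_word :: "('a, 'u) utree_scheme \<Rightarrow> nat \<Rightarrow> 'a word \<Rightarrow> bool"
  for T :: "('a, 'u) utree_scheme" where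
  leaf: "nxt T e = e \<Longrightarrow> branch_word T e (Letter (lab T e))"
| node: "nxt T e \<noteq> e \<Longrightarrow> branch_word T (opp T (nxt T e)) s \<Longrightarrow>
    branch_word T (opp T (nxt T (nxt T e))) t \<Longrightarrow> branch_word T e (Br s t)"

inductive_cases branch_word_LetterE: "branch_word T e (Letter a)"
inductive_cases branch_word_BrE: "branch_word T e (Br s t)"

lemma branch_word_unique: "branch_word T e w \<Longrightarrow> branch_word T e w' \<Longrightarrow> w = w'"
proof (induction arbitrary: w' rule: branch_word.induct)
  case (leaf e)
  from leaf(2,1) show ?case by cases auto
next
  case (node e s t)
  from node.prems node.hyps(1) show ?case
    by cases (auto dest: node.IH)
qed

locale ugraph =
  fixes H :: "('a, 'm) monoid_scheme" and T :: "'a utree"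
  assumes graph: "unitrivalent_graph H T"
begin

lemma finite_halves: "finite (halves T)"
  and opp_closed [simp]: "d \<in> halves T \<Longrightarrow> opp T d \<in> halves T"
  and opp_neq [simp]: "d \<in> halves T \<Longrightarrow> opp T d \<noteq> d"
  and opp_opp [simp]: "d \<in> halves T \<Longrightarrow> opp T (opp T d) = d"
  and nxt_closed [simp]: "d \<in> halves T \<Longrightarrow> nxt T d \<in> halves T"
  and nxt3 [simp]: "d \<in> halves T \<Longrightarrow> nxt T (nxt T (nxt T d)) = d"
  and lab_closed: "d \<in> halves T \<Longrightarrow> nxt T d = d \<Longrightarrow> lab T d \<in> carrier H"
  using graph by (auto simp: unitrivalent_graph_def univalent_def)

lemma nxt_inj: "d \<in> halves T \<Longrightarrow> d' \<in> halves T \<Longrightarrow> nxt T d = nxt T d' \<longleftrightarrow> d = d'"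
  by (metis nxt3)

lemma opp_inj: "d \<in> halves T \<Longrightarrow> d' \<in> halves T \<Longrightarrow> opp T d = opp T d' \<longleftrightarrow> d = d'"
  by (metis opp_opp)

lemma nxt2_neq: "d \<in> halves T \<Longrightarrow> nxt T d \<noteq> d \<Longrightarrow> nxt T (nxt T d) \<noteq> d \<and> nxt T (nxt T d) \<noteq> nxt T d"
  by (metis nxt3 nxt_closed)

lemma vertex_of_self: "d \<in> vertex_of T d"
  by (simp add: vertex_of_def)

lemma vertex_of_closed: "d \<in> halves T \<Longrightarrow> z \<in> vertex_of T d \<Longrightarrow> z \<in> halves T"
  by (auto simp: vertex_of_def)

lemma vertex_of_eq: "d \<in> halves T \<Longrightarrow> z \<in> vertex_of T d \<Longrightarrow> vertex_of T z = vertex_of T d"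
  by (auto simp: vertex_of_def)

abbreviation "step \<equiv> nonbacktracking_step T"

lemma stepI:
  "d \<in> halves T \<Longrightarrow> z \<in> vertex_of T d \<Longrightarrow> z \<noteq> d \<Longrightarrow> (opp T d, z) \<in> step"
  by (simp add: nonbacktracking_step_def)

lemma step_closed: "(d, d') \<in> step \<Longrightarrow> d \<in> halves T \<and> d' \<in> halves T"
  using vertex_of_closed[of "opp T d" d'] by (auto simp: nonbacktracking_step_def)

lemma step_reverse: "(d, d') \<in> step \<Longrightarrow> (opp T d', opp T d) \<in> step"
proof -
  assume *: "(d, d') \<in> step"
  then have d: "d \<in> halves T" "d' \<in> halves T" "d' \<in> vertex_of T (opp T d)" "d' \<noteq> opp T d"
    using step_closed[OF *] by (auto simp: nonbacktracking_step_def)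
  then have "opp T d \<in> vertex_of T d'"
    using vertex_of_eq[of "opp T d" d'] vertex_of_self by auto
  then show ?thesis using d by (intro stepI) auto
qed

lemma steps_reverse: "(d, d') \<in> step\<^sup>* \<Longrightarrow> (opp T d', opp T d) \<in> step\<^sup>*"
  by (induction rule: rtrancl_induct) (auto intro: step_reverse converse_rtrancl_into_rtrancl)

text \<open>
  The moves on trees considered later change a graph at one or two vertices; this lemma carries over
  the words of the branches at these vertices.
\<close>

lemma branch_word_cong:
  assumes "branch_word T e w" and "e \<in> halves T"
    and opp: "opp T' = opp T"
    and agree: "\<And>z. z \<in> halves T \<Longrightarrow> z \<notin> K \<Longrightarrow> nxt T' z = nxt T z \<and> (nxt T z = z \<longrightarrow> lab T' z = lab T z)"
    and K: "\<And>z. z \<in> K \<Longrightarrow> z \<in> halves T \<and> nxt T z \<in> K"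
    and away: "\<And>z. z \<in> K \<Longrightarrow> (opp T e, opp T z) \<notin> step\<^sup>*"
  shows "branch_word T' e w"
  using assms(1,2) away
proof (induction rule: branch_word.induct)
  case (leaf e)
  have "e \<notin> K" using leaf.prems by blast
  then have "nxt T' e = e" "lab T' e = lab T e" using agree leaf by auto
  then show ?case using branch_word.leaf[of T' e] by simp
next
  case (node e s t)
  have e: "e \<notin> K" "e \<in> halves T" using node.prems by blast+
  then have n: "nxt T e \<notin> K" "nxt T (nxt T e) \<notin> K" by (metis K nxt3)+
  have step: "(opp T e, nxt T e) \<in> step" "(opp T e, nxt T (nxt T e)) \<in> step"
    using e node.hyps(1) nxt2_neq[of e] by (auto intro!: stepI simp: vertex_of_def)
  have nxt: "nxt T' e = nxt T e" "nxt T' (nxt T e) = nxt T (nxt T e)"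
    using agree e n by auto
  have "branch_word T' (opp T (nxt T e)) s"
    by (rule node.IH(1)) (use e step(1) node.prems in \<open>auto dest: converse_rtrancl_into_rtrancl\<close>)
  moreover have "branch_word T' (opp T (nxt T (nxt T e))) t"
    by (rule node.IH(2)) (use e step(2) node.prems in \<open>auto dest: converse_rtrancl_into_rtrancl\<close>)
  ultimately show ?case
    using node.hyps(1) nxt opp by (intro branch_word.node) auto
qed

lemma branch_word_other:
  assumes e: "e \<in> halves T" "nxt T e \<noteq> e"
    and s: "branch_word T (opp T (nxt T e)) s" and t: "branch_word T (opp T (nxt T (nxt T e))) t"
    and c: "branch_word T (opp T e) c"
  shows "branch_word T (nxt T e) (Br t c)" "branch_word T (nxt T (nxt T e)) (Br c s)"
  using assms nxt2_neq[of e] by (auto intro!: branch_word.node)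

lemma branch_value_branch_word:
  assumes H: "comm_group H"
  shows "branch_word T e w \<Longrightarrow> e = opp T d \<Longrightarrow> e \<in> halves T \<Longrightarrow>
    branch_value H T d (quasi_lie_class H (frag_of w)) \<and> w \<in> words H"
proof (induction arbitrary: d rule: branch_word.induct)
  case (leaf e)
  then show ?case
    using branch_value.univalent_end[of T d H] lab_closed[of e] by (auto simp: quasi_lie_incl_def)
next
  case (node e s t)
  have "branch_value H T (nxt T e) (quasi_lie_class H (frag_of s)) \<and> s \<in> words H"
    "branch_value H T (nxt T (nxt T e)) (quasi_lie_class H (frag_of t)) \<and> t \<in> words H"
    using node.IH(1)[of "nxt T e"] node.IH(2)[of "nxt T (nxt T e)"] node.prems by simp_all
  then show ?case
    using branch_value.trivalent_end[of T d H "quasi_lie_class H (frag_of s)"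
        "quasi_lie_class H (frag_of t)"] node.hyps(1) node.prems
      quasi_lie_bracket_class[OF H, of "frag_of s" "frag_of t"] by simp
qed

abbreviation "adjacent \<equiv> {(c, opp T c) | c. c \<in> halves T} \<union> {(c, nxt T c) | c. c \<in> halves T}"

lemma adjacent_closed: "(c, d) \<in> adjacent\<^sup>* \<Longrightarrow> c \<in> halves T \<Longrightarrow> d \<in> halves T"
  by (induction rule: rtrancl_induct) auto

lemma adjacent_sym: "(c, d) \<in> adjacent\<^sup>* \<Longrightarrow> (d, c) \<in> adjacent\<^sup>*"
proof (induction rule: rtrancl_induct)
  case (step y z)
  then consider "y \<in> halves T" "z = opp T y" | "y \<in> halves T" "z = nxt T y" by blast
  then have "(z, y) \<in> adjacent\<^sup>*"
  proof cases
    case 1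
    then have "(z, opp T z) \<in> adjacent" by auto
    then show ?thesis using 1 by auto
  next
    case 2
    then have "(z, nxt T z) \<in> adjacent" "(nxt T z, nxt T (nxt T z)) \<in> adjacent" by auto
    then have "(z, nxt T (nxt T z)) \<in> adjacent\<^sup>*" by (meson r_into_rtrancl rtrancl_trans)
    then show ?thesis using 2 by simp
  qed
  then show ?case using step.IH by (rule rtrancl_trans)
qed simp

lemma connectedI:
  assumes "e \<in> halves T" and "\<And>d. d \<in> halves T \<Longrightarrow> (e, d) \<in> adjacent\<^sup>*"
  shows "connected_graph T"
  unfolding connected_graph_def
proof (intro conjI ballI)
  fix d d' assume "d \<in> halves T" "d' \<in> halves T"
  then show "(d, d') \<in> adjacent\<^sup>*"
    by (intro rtrancl_trans[OF adjacent_sym[OF assms(2)] assms(2)])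
qed (use assms(1) in auto)

end

locale utree = ugraph H T for H :: "('a, 'm) monoid_scheme" and T :: "'a utree" +
  fixes n :: nat
  assumes tree: "T \<in> unitrivalent_trees H n"
begin

lemma acyclic: "acyclic step"
  and connected: "connected_graph T"
  and card_trivalent: "card (trivalent_vertices T) = n"
  using tree by (auto simp: unitrivalent_trees_def)

lemma no_cycle: "(d, d') \<in> step\<^sup>* \<Longrightarrow> (d', d) \<in> step \<Longrightarrow> False"
  using acyclic rtrancl_into_trancl1[of d d' step d] by (auto simp: acyclic_def)

text \<open>
  A non-backtracking path that traverses the same edge in both directions would have to turn around
  on a cycle: strip its two ends as long as they are opposite to each other.
\<close>

lemma no_turn:
  assumes "d \<in> halves T" shows "(d, opp T d) \<notin> step\<^sup>*"
proof
  assume "(d, opp T d) \<in> step\<^sup>*"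
  then obtain m where "(d, opp T d) \<in> step ^^ m" by (auto dest: rtrancl_imp_relpow)
  then show False using assms
  proof (induction m arbitrary: d rule: less_induct)
    case (less m)
    consider "m = 0" | "m = 1" | k where "m = Suc (Suc k)"
      by (cases m rule: nat.exhaust) (auto, metis One_nat_def nat.exhaust)
    then show False
    proof cases
      case 1
      then show False using less.prems opp_neq[of d] by auto
    next
      case 2
      then show False using less.prems by (auto simp: nonbacktracking_step_def)
    next
      case 3
      obtain x where x: "(d, x) \<in> step" "(x, opp T d) \<in> step ^^ Suc k"
        using less.prems(1) 3 by (meson relpow_Suc_D2)
      then obtain z where z: "(x, z) \<in> step ^^ k" "(z, opp T d) \<in> step"
        by (meson relpow_Suc_E)
      have h: "x \<in> halves T" "z \<in> halves T" using x(1) z(2) step_closed by blast+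
      show False
      proof (cases "x = opp T z")
        case True
        then have "(x, opp T x) \<in> step ^^ k" using z(1) h by simp
        then show False using less.IH[of k x] 3 h by simp
      next
        case False
        have "opp T d \<in> vertex_of T (opp T z)" "x \<in> vertex_of T (opp T d)"
          using x(1) z(2) by (auto simp: nonbacktracking_step_def)
        then have "x \<in> vertex_of T (opp T z)"
          using vertex_of_eq[of "opp T z" "opp T d"] h by auto
        then have "(z, x) \<in> step" using stepI[of "opp T z" x] h False by simp
        then show False using no_cycle z(1) relpow_imp_rtrancl by blast
      qed
    qed
  qed
qed

text \<open>
  Such a path could be continued across the vertex of \<open>x\<close> to a cycle, or it would turn around.
\<close>

lemma no_return:
  assumes "x \<in> halves T" "z \<in> vertex_of T x" shows "(x, opp T z) \<notin> step\<^sup>*"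
proof
  assume *: "(x, opp T z) \<in> step\<^sup>*"
  have z: "z \<in> halves T" using assms vertex_of_closed by blast
  show False
  proof (cases "z = x")
    case True
    then show False using * no_turn assms by simp
  next
    case False
    have "x \<in> vertex_of T z" using vertex_of_eq[OF assms] vertex_of_self by auto
    then have "(opp T z, x) \<in> step" using False z by (intro stepI) auto
    then show False using * no_cycle by blast
  qed
qed

lemma branch_word_exists:
  assumes "e \<in> halves T" shows "\<exists>w. branch_word T e w"
proof -
  have "step \<subseteq> halves T \<times> halves T" using step_closed by auto
  then have "finite step" using finite_halves by (auto intro: finite_subset)
  then have wf: "wf (step\<inverse>)" using acyclic by (rule finite_acyclic_wf_converse)
  have "\<exists>w. branch_word T (opp T d) w" if "d \<in> halves T" for d
    using wf that
  proof (induction d rule: wf_induct_rule)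
    case (less d)
    let ?e = "opp T d"
    show ?case
    proof (cases "nxt T ?e = ?e")
      case True
      then show ?thesis using branch_word.leaf by blast
    next
      case False
      have e: "?e \<in> halves T" "opp T ?e = d" using less.prems by auto
      have "(d, nxt T ?e) \<in> step" "(d, nxt T (nxt T ?e)) \<in> step"
        using e False nxt2_neq[of ?e] stepI[of ?e] by (auto simp: vertex_of_def)
      then obtain s t where "branch_word T (opp T (nxt T ?e)) s"
          "branch_word T (opp T (nxt T (nxt T ?e))) t"
        using less.IH e by (metis converseI nxt_closed)
      then show ?thesis using branch_word.node[OF False] by blast
    qed
  qed
  from this[of "opp T e"] show ?thesis using assms by simp
qed

end


section \<open>The tree of a pair of words\<close>

text \<open>
  Positions in a word are paths of left (\<open>True\<close>) and right steps, the last step first.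
\<close>

primrec sub :: "'a word \<Rightarrow> bool list \<Rightarrow> 'a word option" where
  "sub w [] = Some w"
| "sub w (b # \<pi>) = (case sub w \<pi> of
      Some (Br s t) \<Rightarrow> Some (if b then s else t) | _ \<Rightarrow> None)"

lemma sub_append:
  "sub w (\<pi> @ [b]) = (case w of Br s t \<Rightarrow> sub (if b then s else t) \<pi> | Letter a \<Rightarrow> None)"
  by (induction \<pi>) (auto split: word.splits)

lemma sub_tl: "sub w (b # \<pi>) = Some v \<Longrightarrow> \<exists>s t. sub w \<pi> = Some (Br s t) \<and> v = (if b then s else t)"
  by (cases b) (auto split: option.splits word.splits)

lemma sub_letters: "sub w \<pi> = Some v \<Longrightarrow> letters v \<subseteq> letters w"
proof (induction \<pi> arbitrary: v)
  case (Cons b \<pi>)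
  then obtain s t where "sub w \<pi> = Some (Br s t)" "v = (if b then s else t)" using sub_tl by blast
  then show ?case using Cons.IH[of "Br s t"] by auto
qed simp

definition leaf_positions :: "'a word \<Rightarrow> bool list set" where
  "leaf_positions w = {\<pi>. \<exists>a. sub w \<pi> = Some (Letter a)}"

definition node_positions :: "'a word \<Rightarrow> bool list set" where
  "node_positions w = {\<pi>. \<exists>s t. sub w \<pi> = Some (Br s t)}"

lemma leaf_positions_simps:
  "leaf_positions (Letter a) = {[]}"
  "leaf_positions (Br s t) = (\<lambda>\<pi>. \<pi> @ [True]) ` leaf_positions s \<union> (\<lambda>\<pi>. \<pi> @ [False]) ` leaf_positions t"
proof -
  have "sub (Letter a) \<pi> = (if \<pi> = [] then Some (Letter a) else None)" for \<pi>
    by (induction \<pi>) auto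
  then show "leaf_positions (Letter a) = {[]}" by (auto simp: leaf_positions_def)
  show "leaf_positions (Br s t)
      = (\<lambda>\<pi>. \<pi> @ [True]) ` leaf_positions s \<union> (\<lambda>\<pi>. \<pi> @ [False]) ` leaf_positions t"
  proof (intro Set.set_eqI)
    fix \<pi> show "\<pi> \<in> leaf_positions (Br s t) \<longleftrightarrow>
        \<pi> \<in> (\<lambda>\<pi>. \<pi> @ [True]) ` leaf_positions s \<union> (\<lambda>\<pi>. \<pi> @ [False]) ` leaf_positions t"
    proof (cases \<pi> rule: rev_cases)
      case (snoc \<rho> b)
      then show ?thesis by (cases b) (auto simp: leaf_positions_def sub_append)
    qed (auto simp: leaf_positions_def)
  qed
qed

lemma node_positions_simps:
  "node_positions (Letter a) = {}"
  "node_positions (Br s t) = insert [] ((\<lambda>\<pi>. \<pi> @ [True]) ` node_positions s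
     \<union> (\<lambda>\<pi>. \<pi> @ [False]) ` node_positions t)"
proof -
  have "sub (Letter a) \<pi> = (if \<pi> = [] then Some (Letter a) else None)" for \<pi>
    by (induction \<pi>) auto
  then show "node_positions (Letter a) = {}" by (auto simp: node_positions_def)
  show "node_positions (Br s t) = insert [] ((\<lambda>\<pi>. \<pi> @ [True]) ` node_positions s
     \<union> (\<lambda>\<pi>. \<pi> @ [False]) ` node_positions t)"
  proof (intro Set.set_eqI)
    fix \<pi> show "\<pi> \<in> node_positions (Br s t) \<longleftrightarrow> \<pi> \<in> insert [] ((\<lambda>\<pi>. \<pi> @ [True]) ` node_positions s
        \<union> (\<lambda>\<pi>. \<pi> @ [False]) ` node_positions t)"
    proof (cases \<pi> rule: rev_cases)
      case (snoc \<rho> b)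
      then show ?thesis by (cases b) (auto simp: node_positions_def sub_append)
    qed (auto simp: node_positions_def)
  qed
qed

lemma finite_leaf_positions [simp]: "finite (leaf_positions w)"
  and finite_node_positions [simp]: "finite (node_positions w)"
  by (induction w) (auto simp: leaf_positions_simps node_positions_simps)

lemma card_node_positions: "card (node_positions w) + 1 = word_length w"
proof (induction w)
  case (Br s t)
  have "card ((\<lambda>\<pi>. \<pi> @ [True]) ` node_positions s \<union> (\<lambda>\<pi>. \<pi> @ [False]) ` node_positions t)
      = card (node_positions s) + card (node_positions t)"
    by (subst card_Un_disjoint) (auto simp: card_image inj_on_def)
  moreover have "[] \<notin> (\<lambda>\<pi>. \<pi> @ [True]) ` node_positions s \<union> (\<lambda>\<pi>. \<pi> @ [False]) ` node_positions t"
    by auto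
  ultimately show ?case using Br by (simp add: node_positions_simps)
qed (simp add: node_positions_simps)

text \<open>
  The half-edges of the tree of \<open>(u, v)\<close>, in terms of the positions in \<open>Br u v\<close> other than the root:
  the subword at \<open>\<pi>\<close> has a root vertex with a half-edge \<open>up_half \<pi>\<close> towards its parent, and the other
  half of the same edge is \<open>down_half \<pi>\<close>. The two halves of the edge joining \<open>u\<close> and \<open>v\<close> are
  \<open>up_half [True]\<close> and \<open>up_half [False]\<close>.
\<close>

definition up_half :: "bool list \<Rightarrow> nat" where "up_half \<pi> = to_nat (True, \<pi>)"
definition down_half :: "bool list \<Rightarrow> nat" where "down_half \<pi> = to_nat (False, \<pi>)"

definition word_tree :: "'a word \<Rightarrow> 'a word \<Rightarrow> 'a utree" where
  "word_tree u v = \<lparr>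
     halves = {up_half \<pi> | \<pi>. sub (Br u v) \<pi> \<noteq> None \<and> \<pi> \<noteq> []} \<union>
              {down_half (b # \<pi>) | b \<pi>. \<pi> \<in> node_positions (Br u v) \<and> \<pi> \<noteq> []},
     opp = (\<lambda>h. case from_nat h of (d, \<pi>) \<Rightarrow>
              if length \<pi> = 1 then to_nat (d, [\<not> hd \<pi>]) else to_nat (\<not> d, \<pi>)),
     nxt = (\<lambda>h. case from_nat h of (d, \<pi>) \<Rightarrow>
              if d then (if \<pi> \<in> node_positions (Br u v) then down_half (True # \<pi>) else up_half \<pi>)
              else if hd \<pi> then down_half (False # tl \<pi>) else up_half (tl \<pi>)),
     lab = (\<lambda>h. case sub (Br u v) (snd (from_nat h :: bool \<times> bool list)) of
              Some (Letter a) \<Rightarrow> a | _ \<Rightarrow> undefined)\<rparr>"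

lemma half_simps [simp]:
  "up_half \<pi> = up_half \<rho> \<longleftrightarrow> \<pi> = \<rho>" "down_half \<pi> = down_half \<rho> \<longleftrightarrow> \<pi> = \<rho>"
  "up_half \<pi> \<noteq> down_half \<rho>" "down_half \<rho> \<noteq> up_half \<pi>"
  by (simp_all add: up_half_def down_half_def)

lemma word_tree_simps [simp]:
  "opp (word_tree u v) (up_half [b]) = up_half [\<not> b]"
  "\<pi> \<noteq> [] \<Longrightarrow> opp (word_tree u v) (up_half (b # \<pi>)) = down_half (b # \<pi>)"
  "\<pi> \<noteq> [] \<Longrightarrow> opp (word_tree u v) (down_half (b # \<pi>)) = up_half (b # \<pi>)"
  "nxt (word_tree u v) (up_half \<pi>) =
     (if \<pi> \<in> node_positions (Br u v) then down_half (True # \<pi>) else up_half \<pi>)"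
  "nxt (word_tree u v) (down_half (True # \<pi>)) = down_half (False # \<pi>)"
  "nxt (word_tree u v) (down_half (False # \<pi>)) = up_half \<pi>"
  by (simp_all add: word_tree_def up_half_def down_half_def)

lemma lab_word_tree:
  "sub (Br u v) \<pi> = Some (Letter a) \<Longrightarrow> lab (word_tree u v) (up_half \<pi>) = a"
  by (simp add: word_tree_def up_half_def)

lemma halves_word_tree:
  "halves (word_tree u v) = up_half ` (leaf_positions (Br u v) \<union> node_positions (Br u v) - {[]})
    \<union> (\<lambda>(b, \<pi>). down_half (b # \<pi>)) ` (UNIV \<times> (node_positions (Br u v) - {[]}))"
proof -
  have "sub (Br u v) \<pi> \<noteq> None \<longleftrightarrow> \<pi> \<in> leaf_positions (Br u v) \<union> node_positions (Br u v)" for \<pi>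
    by (cases "sub (Br u v) \<pi>"; cases "the (sub (Br u v) \<pi>)")
       (auto simp: leaf_positions_def node_positions_def)
  then show ?thesis by (auto simp: word_tree_def)
qed

lemma halves_word_treeE:
  assumes "h \<in> halves (word_tree u v)"
  obtains (leaf) \<pi> a where "h = up_half \<pi>" "\<pi> \<noteq> []" "sub (Br u v) \<pi> = Some (Letter a)"
    "\<pi> \<notin> node_positions (Br u v)"
  | (node) \<pi> where "h = up_half \<pi>" "\<pi> \<noteq> []" "\<pi> \<in> node_positions (Br u v)"
  | (down) b \<pi> where "h = down_half (b # \<pi>)" "\<pi> \<noteq> []" "\<pi> \<in> node_positions (Br u v)"
proof -
  from assms have "(\<exists>\<pi>. h = up_half \<pi> \<and> \<pi> \<noteq> [] \<and> \<pi> \<in> node_positions (Br u v))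
      \<or> (\<exists>\<pi>. h = up_half \<pi> \<and> \<pi> \<noteq> [] \<and> \<pi> \<in> leaf_positions (Br u v))
      \<or> (\<exists>b \<pi>. h = down_half (b # \<pi>) \<and> \<pi> \<noteq> [] \<and> \<pi> \<in> node_positions (Br u v))"
    unfolding halves_word_tree by auto
  then consider \<pi> where "h = up_half \<pi>" "\<pi> \<noteq> []" "\<pi> \<in> node_positions (Br u v)"
    | \<pi> where "h = up_half \<pi>" "\<pi> \<noteq> []" "\<pi> \<in> leaf_positions (Br u v)"
    | b \<pi> where "h = down_half (b # \<pi>)" "\<pi> \<noteq> []" "\<pi> \<in> node_positions (Br u v)"
    by (elim disjE exE conjE)
  then show ?thesis
  proof cases
    case 2
    then show ?thesis by (auto simp: leaf_positions_def node_positions_def intro: that(1))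
  qed (rule that; assumption)+
qed

lemma up_half_in [simp]:
  "up_half \<pi> \<in> halves (word_tree u v) \<longleftrightarrow> \<pi> \<noteq> [] \<and> sub (Br u v) \<pi> \<noteq> None"
  by (auto simp: word_tree_def)

lemma down_half_in [simp]:
  "down_half (b # \<pi>) \<in> halves (word_tree u v) \<longleftrightarrow> \<pi> \<noteq> [] \<and> \<pi> \<in> node_positions (Br u v)"
  by (auto simp: word_tree_def)

lemma node_positions_child: "\<pi> \<in> node_positions w \<Longrightarrow> sub w (b # \<pi>) \<noteq> None"
  by (auto simp: node_positions_def)

lemma child_node_positions: "sub w (b # \<pi>) \<noteq> None \<Longrightarrow> \<pi> \<in> node_positions w"
  by (auto simp: node_positions_def split: option.splits word.splits)

lemma word_tree_graph:
  fixes H :: "('a, 'm) monoid_scheme"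
  assumes "letters u \<subseteq> carrier H" "letters v \<subseteq> carrier H"
  shows "unitrivalent_graph H (word_tree u v)"
  unfolding unitrivalent_graph_def
proof (intro conjI ballI)
  show "finite (halves (word_tree u v))" by (simp add: halves_word_tree)
next
  fix d assume d: "d \<in> halves (word_tree u v)"
  have up: "opp (word_tree u v) (up_half \<pi>) \<in> halves (word_tree u v) \<and>
    opp (word_tree u v) (up_half \<pi>) \<noteq> up_half \<pi> \<and>
    opp (word_tree u v) (opp (word_tree u v) (up_half \<pi>)) = up_half \<pi>"
    if pi: "\<pi> \<noteq> []" "sub (Br u v) \<pi> \<noteq> None" for \<pi>
  proof -
    obtain b \<rho> where \<pi>: "\<pi> = b # \<rho>" using pi by (cases \<pi>) auto
    show ?thesis
      using pi child_node_positions[of "Br u v" b \<rho>] unfolding \<pi> by (cases "\<rho> = []") simp_all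
  qed
  have opp: "opp (word_tree u v) d \<in> halves (word_tree u v) \<and> opp (word_tree u v) d \<noteq> d \<and>
    opp (word_tree u v) (opp (word_tree u v) d) = d"
    using d
  proof (cases rule: halves_word_treeE)
    case (down b \<pi>)
    then show ?thesis using node_positions_child[of \<pi> "Br u v" b] by simp
  qed (use up in \<open>auto simp: node_positions_def\<close>)
  then show "opp (word_tree u v) d \<in> halves (word_tree u v)" "opp (word_tree u v) d \<noteq> d"
    "opp (word_tree u v) (opp (word_tree u v) d) = d" by auto
  have nxt: "nxt (word_tree u v) d \<in> halves (word_tree u v) \<and>
    nxt (word_tree u v) (nxt (word_tree u v) (nxt (word_tree u v) d)) = d"
    using d
  proof (cases rule: halves_word_treeE)
    case (down b \<pi>)
    moreover have "sub (Br u v) \<pi> \<noteq> None" using down by (auto simp: node_positions_def)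
    ultimately show ?thesis by (cases b) simp_all
  qed simp_all
  then show "nxt (word_tree u v) d \<in> halves (word_tree u v)"
    "nxt (word_tree u v) (nxt (word_tree u v) (nxt (word_tree u v) d)) = d" by auto
next
  fix d assume "d \<in> univalent (word_tree u v)"
  then have d: "d \<in> halves (word_tree u v)" and n: "nxt (word_tree u v) d = d"
    by (auto simp: univalent_def)
  from d show "lab (word_tree u v) d \<in> carrier H"
  proof (cases rule: halves_word_treeE)
    case (leaf \<pi> a)
    then show ?thesis using sub_letters[OF leaf(3)] assms by (auto simp: lab_word_tree)
  next
    case (down b \<pi>)
    then show ?thesis using n by (cases b) auto
  qed (use n in auto)
qed

lemma word_tree_connected:
  fixes H :: "('a, 'm) monoid_scheme"
  assumes "letters u \<subseteq> carrier H" "letters v \<subseteq> carrier H"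
  shows "connected_graph (word_tree u v)"
proof -
  interpret ugraph H "word_tree u v" by unfold_locales (rule word_tree_graph[OF assms])
  let ?e = "up_half [True]"
  have opp: "(?e, opp (word_tree u v) d) \<in> adjacent\<^sup>*"
    and nxt: "(?e, nxt (word_tree u v) d) \<in> adjacent\<^sup>*"
    if "(?e, d) \<in> adjacent\<^sup>*" "d \<in> halves (word_tree u v)" for d
    using that by (auto intro: rtrancl_into_rtrancl)
  have down: "(?e, down_half (b # \<pi>)) \<in> adjacent\<^sup>*"
    if "(?e, up_half \<pi>) \<in> adjacent\<^sup>*" "\<pi> \<noteq> []" "\<pi> \<in> node_positions (Br u v)" for b \<pi>
  proof -
    have "sub (Br u v) \<pi> \<noteq> None" using that(3) by (auto simp: node_positions_def)
    then have "(?e, down_half (True # \<pi>)) \<in> adjacent\<^sup>*" using nxt[OF that(1)] that by simp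
    then show ?thesis using nxt[of "down_half (True # \<pi>)"] that by (cases b) simp_all
  qed
  have up: "(?e, up_half \<pi>) \<in> adjacent\<^sup>*" if "\<pi> \<noteq> []" "sub (Br u v) \<pi> \<noteq> None" for \<pi>
    using that
  proof (induction \<pi>)
    case (Cons b \<pi>)
    have node: "\<pi> \<in> node_positions (Br u v)" using Cons.prems child_node_positions by blast
    show ?case
    proof (cases "\<pi> = []")
      case True
      then show ?thesis using opp[of ?e] by (cases b) auto
    next
      case False
      then have "(?e, up_half \<pi>) \<in> adjacent\<^sup>*"
        using Cons.IH node by (auto simp: node_positions_def)
      then show ?thesis
        using opp[OF down[of \<pi> b]] False node by simp
    qed
  qed simp
  show ?thesis
  proof (rule connectedI)
    fix d assume "d \<in> halves (word_tree u v)"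
    then show "(?e, d) \<in> adjacent\<^sup>*"
      by (cases rule: halves_word_treeE) (auto intro!: up down simp: node_positions_def)
  qed simp
qed

text \<open>
  A non-backtracking path in the tree of a pair of words climbs towards the central edge and then
  descends, so the depth with sign increases along it.
\<close>

lemma word_tree_acyclic:
  fixes H :: "('a, 'm) monoid_scheme"
  assumes "letters u \<subseteq> carrier H" "letters v \<subseteq> carrier H"
  shows "acyclic (nonbacktracking_step (word_tree u v))"
proof -
  interpret ugraph H "word_tree u v" by unfold_locales (rule word_tree_graph[OF assms])
  define level :: "nat \<Rightarrow> int" where
    "level h = (case from_nat h of (d, \<pi> :: bool list) \<Rightarrow> if d then - int (length \<pi>) else int (length \<pi>))" for h
  have level: "level (up_half \<pi>) = - int (length \<pi>)" "level (down_half \<pi>) = int (length \<pi>)" for \<pi>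
    by (simp_all add: level_def up_half_def down_half_def)
  have vertex: "z = up_half \<pi> \<or> z \<in> {down_half (True # \<pi>), down_half (False # \<pi>)} \<and> \<pi> \<in> node_positions (Br u v)"
    if "z \<in> vertex_of (word_tree u v) (up_half \<pi>)" for z \<pi>
    using that by (auto simp: vertex_of_def split: if_splits)
  have below: "level d < level d'"
    if d: "opp (word_tree u v) d = up_half \<pi>" and d': "d' \<in> vertex_of (word_tree u v) (up_half \<pi>)"
      "d' \<noteq> up_half \<pi>" and l: "level d \<le> int (length \<pi>)" for d d' \<pi>
    using vertex[OF d'(1)] d'(2) l by (auto simp: level)
  have "level d < level d'" if "(d, d') \<in> step" for d d'
  proof -
    have d: "d \<in> halves (word_tree u v)" and d': "d' \<in> vertex_of (word_tree u v) (opp (word_tree u v) d)"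
      "d' \<noteq> opp (word_tree u v) d"
      using that by (auto simp: nonbacktracking_step_def)
    consider (up) b \<pi> where "d = up_half (b # \<pi>)" "sub (Br u v) (b # \<pi>) \<noteq> None"
      | (down) b \<pi> where "d = down_half (b # \<pi>)" "\<pi> \<noteq> []"
      using d by (cases rule: halves_word_treeE) (auto simp: node_positions_def neq_Nil_conv)
    then show ?thesis
    proof cases
      case (up b \<pi>)
      show ?thesis
      proof (cases "\<pi> = []")
        case True
        then show ?thesis using below[of d "[\<not> b]" d'] d' up by (auto simp: level)
      next
        case False
        have "\<pi> \<in> node_positions (Br u v)" using up child_node_positions by blast
        then have "down_half (b # \<pi>) \<in> vertex_of (word_tree u v) (up_half \<pi>)"
          by (cases b) (auto simp: vertex_of_def)
        moreover have "up_half \<pi> \<in> halves (word_tree u v)"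
          using False \<open>\<pi> \<in> _\<close> by (auto simp: node_positions_def)
        ultimately have "vertex_of (word_tree u v) (down_half (b # \<pi>))
            = vertex_of (word_tree u v) (up_half \<pi>)"
          using vertex_of_eq by blast
        then have "d' \<in> vertex_of (word_tree u v) (up_half \<pi>)"
          using d' up False by simp
        then show ?thesis using vertex[of d' \<pi>] up by (auto simp: level)
      qed
    next
      case (down b \<pi>)
      then show ?thesis using below[of d "b # \<pi>" d'] d' by (auto simp: level)
    qed
  qed
  note level_step = this
  have "level d < level d'" if "(d, d') \<in> step\<^sup>+" for d d'
    using that by (induction rule: trancl_induct) (auto dest: level_step)
  then show ?thesis unfolding acyclic_def by force
qed

lemma word_tree_trivalent:
  "card (trivalent_vertices (word_tree u v)) + 2 = word_length u + word_length v"
proof -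
  let ?T = "word_tree u v" and ?N = "node_positions (Br u v) - {[]}"
  have eq: "vertex_of ?T (up_half \<pi>) = {up_half \<pi>, down_half (True # \<pi>), down_half (False # \<pi>)}"
    "vertex_of ?T (down_half (b # \<pi>)) = {up_half \<pi>, down_half (True # \<pi>), down_half (False # \<pi>)}"
    if "\<pi> \<in> ?N" for b \<pi>
    using that by (cases b; auto simp: vertex_of_def)+
  have "trivalent_vertices ?T = (\<lambda>\<pi>. vertex_of ?T (up_half \<pi>)) ` ?N"
  proof (intro equalityI subsetI)
    fix V assume "V \<in> trivalent_vertices ?T"
    then obtain d where d: "d \<in> halves ?T" "nxt ?T d \<noteq> d" "V = vertex_of ?T d"
      by (auto simp: trivalent_vertices_def)
    from d(1) show "V \<in> (\<lambda>\<pi>. vertex_of ?T (up_half \<pi>)) ` ?N"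
    proof (cases rule: halves_word_treeE)
      case (down b \<pi>)
      then show ?thesis using d eq(1)[of \<pi>] eq(2)[of \<pi> b] by auto
    qed (use d in auto)
  next
    fix V assume "V \<in> (\<lambda>\<pi>. vertex_of ?T (up_half \<pi>)) ` ?N"
    then obtain \<pi> where \<pi>: "\<pi> \<in> ?N" "V = vertex_of ?T (up_half \<pi>)" by blast
    then have "up_half \<pi> \<in> halves ?T" "nxt ?T (up_half \<pi>) \<noteq> up_half \<pi>"
      by (auto simp: node_positions_def)
    then show "V \<in> trivalent_vertices ?T" using \<pi>(2) unfolding trivalent_vertices_def by blast
  qed
  moreover have "inj_on (\<lambda>\<pi>. vertex_of ?T (up_half \<pi>)) ?N"
  proof (rule inj_onI)
    fix \<pi> \<rho> assume "\<pi> \<in> ?N" "\<rho> \<in> ?N" "vertex_of ?T (up_half \<pi>) = vertex_of ?T (up_half \<rho>)"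
    then have "up_half \<pi> \<in> {up_half \<rho>, down_half (True # \<rho>), down_half (False # \<rho>)}"
      by (metis eq(1) insertI1)
    then show "\<pi> = \<rho>" by simp
  qed
  ultimately have "card (trivalent_vertices ?T) = card ?N" by (simp add: card_image)
  moreover have "[] \<in> node_positions (Br u v)" by (simp add: node_positions_def)
  ultimately show ?thesis
    using card_node_positions[of u] card_node_positions[of v] card_node_positions[of "Br u v"]
    by simp
qed

lemma word_tree_in_trees:
  fixes H :: "('a, 'm) monoid_scheme"
  assumes "letters u \<subseteq> carrier H" "letters v \<subseteq> carrier H" "word_length u + word_length v = n + 2"
  shows "word_tree u v \<in> unitrivalent_trees H n"
  using word_tree_graph[OF assms(1,2)] word_tree_connected[OF assms(1,2)]
    word_tree_acyclic[OF assms(1,2)] word_tree_trivalent[of u v] assms(3)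
  by (simp add: unitrivalent_trees_def)

lemma branch_word_word_tree:
  "sub (Br u v) \<pi> = Some w \<Longrightarrow> \<pi> \<noteq> [] \<Longrightarrow> branch_word (word_tree u v) (up_half \<pi>) w"
proof (induction w arbitrary: \<pi>)
  case (Letter a)
  then show ?case
    using branch_word.leaf[of "word_tree u v" "up_half \<pi>"]
    by (auto simp: lab_word_tree node_positions_def)
next
  case (Br s t)
  have node: "\<pi> \<in> node_positions (Br u v)" using Br.prems by (auto simp: node_positions_def)
  have "branch_word (word_tree u v) (up_half (True # \<pi>)) s"
    "branch_word (word_tree u v) (up_half (False # \<pi>)) t"
    using Br.IH(1)[of "True # \<pi>"] Br.IH(2)[of "False # \<pi>"] Br.prems by auto
  then show ?case
    using node Br.prems by (intro branch_word.node) auto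
qed


section \<open>Trees are determined by their words\<close>

lemma (in ugraph) branch_word_letters:
  "branch_word T e w \<Longrightarrow> e \<in> halves T \<Longrightarrow> letters w \<subseteq> carrier H"
proof (induction rule: branch_word.induct)
  case (leaf e)
  then show ?case using lab_closed by simp
qed auto

text \<open>
  The half-edge at the root vertex of the subword at position \<open>\<pi>\<close>, pointing towards the root, when
  the two words of a pair are read along a graph from the edge of \<open>e\<close>.
\<close>

fun place :: "'a utree \<Rightarrow> nat \<Rightarrow> bool list \<Rightarrow> nat" where
  "place T e [] = e"
| "place T e [b] = (if b then e else opp T e)"
| "place T e (b # c # \<pi>) = opp T (if b then nxt T (place T e (c # \<pi>))
     else nxt T (nxt T (place T e (c # \<pi>))))"

lemma place_child:
  "\<pi> \<noteq> [] \<Longrightarrow> place T e (b # \<pi>) = opp T (if b then nxt T (place T e \<pi>)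
     else nxt T (nxt T (place T e \<pi>)))"
  by (cases \<pi>) auto

locale cut_graph = ugraph H T for H :: "('a, 'm) monoid_scheme" and T :: "'a utree" +
  fixes e :: nat and u v :: "'a word"
  assumes e: "e \<in> halves T"
    and word_e: "branch_word T e u" and word_opp_e: "branch_word T (opp T e) v"
begin

abbreviation "W \<equiv> Br u v"

lemma place_word:
  "sub W \<pi> = Some w \<Longrightarrow> \<pi> \<noteq> [] \<Longrightarrow> place T e \<pi> \<in> halves T \<and> branch_word T (place T e \<pi>) w"
proof (induction \<pi> arbitrary: w)
  case (Cons b \<pi>)
  show ?case
  proof (cases "\<pi> = []")
    case True
    then show ?thesis using Cons.prems e word_e word_opp_e by auto
  next
    case False
    obtain s t where st: "sub W \<pi> = Some (Br s t)" "w = (if b then s else t)"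
      using sub_tl[OF Cons.prems(1)] by blast
    then have "place T e \<pi> \<in> halves T" "branch_word T (place T e \<pi>) (Br s t)"
      using Cons.IH False by auto
    then show ?thesis
      using st(2) by (auto simp: place_child[OF False] elim: branch_word_BrE)
  qed
qed simp

lemma place_closed: "sub W \<pi> \<noteq> None \<Longrightarrow> \<pi> \<noteq> [] \<Longrightarrow> place T e \<pi> \<in> halves T"
  using place_word by auto

lemma place_node: "\<pi> \<in> node_positions W \<Longrightarrow> \<pi> \<noteq> [] \<Longrightarrow>
    place T e \<pi> \<in> halves T \<and> nxt T (place T e \<pi>) \<noteq> place T e \<pi>"
  using place_word by (fastforce simp: node_positions_def elim: branch_word_BrE)

lemma place_leaf: "sub W \<pi> = Some (Letter a) \<Longrightarrow> \<pi> \<noteq> [] \<Longrightarrow>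
    nxt T (place T e \<pi>) = place T e \<pi> \<and> lab T (place T e \<pi>) = a"
  using place_word by (fastforce elim: branch_word_LetterE)

definition realize :: "nat \<Rightarrow> nat" where
  "realize h = (case from_nat h of (d, \<pi>) \<Rightarrow> if d then place T e \<pi> else opp T (place T e \<pi>))"

lemma realize_simps [simp]:
  "realize (up_half \<pi>) = place T e \<pi>" "realize (down_half \<pi>) = opp T (place T e \<pi>)"
  by (simp_all add: realize_def up_half_def down_half_def)

lemma realize_hom:
  assumes "h \<in> halves (word_tree u v)"
  shows "realize h \<in> halves T" "realize (opp (word_tree u v) h) = opp T (realize h)"
    "realize (nxt (word_tree u v) h) = nxt T (realize h)"
    "nxt (word_tree u v) h = h \<Longrightarrow> lab T (realize h) = lab (word_tree u v) h"
proof -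
  have up: "realize (up_half \<pi>) \<in> halves T \<and>
      realize (opp (word_tree u v) (up_half \<pi>)) = opp T (realize (up_half \<pi>))"
    if valid: "\<pi> \<noteq> []" "sub W \<pi> \<noteq> None" for \<pi>
  proof -
    obtain b \<rho> where \<pi>: "\<pi> = b # \<rho>" using valid(1) by (cases \<pi>) auto
    show ?thesis
      using valid place_closed[of \<pi>] e unfolding \<pi> by (cases "\<rho> = []"; cases b) simp_all
  qed
  have "realize h \<in> halves T \<and> realize (opp (word_tree u v) h) = opp T (realize h) \<and>
    realize (nxt (word_tree u v) h) = nxt T (realize h) \<and>
    (nxt (word_tree u v) h = h \<longrightarrow> lab T (realize h) = lab (word_tree u v) h)"
    using assms
  proof (cases rule: halves_word_treeE)
    case (leaf \<pi> a)
    then show ?thesis using up[of \<pi>] place_leaf[of \<pi> a] by (simp add: lab_word_tree)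
  next
    case (node \<pi>)
    then show ?thesis
      using up[of \<pi>] place_node[of \<pi>] by (auto simp: place_child node_positions_def)
  next
    case (down b \<pi>)
    have "place T e \<pi> \<in> halves T" using place_node down by blast
    then show ?thesis
      using down by (cases b) (simp_all add: place_child)
  qed
  then show "realize h \<in> halves T" "realize (opp (word_tree u v) h) = opp T (realize h)"
    "realize (nxt (word_tree u v) h) = nxt T (realize h)"
    "nxt (word_tree u v) h = h \<Longrightarrow> lab T (realize h) = lab (word_tree u v) h"
    by auto
qed

lemma realize_surj:
  assumes "connected_graph T" shows "realize ` halves (word_tree u v) = halves T"
proof -
  interpret J: ugraph H "word_tree u v"
    using branch_word_letters[OF word_e] branch_word_letters[OF word_opp_e] e
    by unfold_locales (auto intro: word_tree_graph)
  have "d \<in> realize ` halves (word_tree u v)" if "(e, d) \<in> adjacent\<^sup>*" for d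
    using that
  proof (induction rule: rtrancl_induct)
    case base
    have "realize (up_half [True]) \<in> realize ` halves (word_tree u v)" by (intro imageI) simp
    then show ?case by simp
  next
    case (step y z)
    then obtain h where h: "h \<in> halves (word_tree u v)" "y = realize h" by blast
    from step(2) consider "z = opp T y" | "z = nxt T y" by blast
    then show ?case
    proof cases
      case 1
      then have "z = realize (opp (word_tree u v) h)" using realize_hom(2) h by simp
      then show ?thesis using J.opp_closed[OF h(1)] by blast
    next
      case 2
      then have "z = realize (nxt (word_tree u v) h)" using realize_hom(3) h by simp
      then show ?thesis using J.nxt_closed[OF h(1)] by blast
    qed
  qed
  then show ?thesis
    using assms e realize_hom(1) unfolding connected_graph_def by blast
qed

lemma word_tree_iso:
  assumes "connected_graph T" "inj_on realize (halves (word_tree u v))"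
  shows "utree_iso (word_tree u v) T"
  unfolding utree_iso_def
  using assms realize_surj realize_hom
  by (intro exI[of _ realize]) (auto simp: bij_betw_def univalent_def)

end

text \<open>
  The realization of a pair of words in a graph is a covering, and a covering of a tree is injective:
  two positions with the same image would give a closed path or a path that turns around.
\<close>

locale cut_tree = utree H T n + cut_graph H T e u v
  for H :: "('a, 'm) monoid_scheme" and T :: "'a utree" and n e u v
begin

lemma place_step:
  assumes "\<pi> \<in> node_positions W" "\<pi> \<noteq> []"
  shows "(place T e (b # \<pi>), place T e \<pi>) \<in> step"
proof -
  let ?h = "place T e \<pi>" and ?x = "if b then nxt T (place T e \<pi>) else nxt T (nxt T (place T e \<pi>))"
  have h: "?h \<in> halves T" "nxt T ?h \<noteq> ?h" using place_node assms by auto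
  then have "?x \<in> halves T" "?h \<in> vertex_of T ?x" "?h \<noteq> ?x"
    using nxt2_neq[of ?h] by (auto simp: vertex_of_def)
  then show ?thesis using stepI[of ?x ?h] by (simp add: place_child[OF assms(2)])
qed

lemma place_steps:
  "sub W \<pi> \<noteq> None \<Longrightarrow> \<pi> \<noteq> [] \<Longrightarrow> (place T e \<pi>, place T e [last \<pi>]) \<in> step\<^sup>*"
proof (induction \<pi>)
  case (Cons b \<pi>)
  show ?case
  proof (cases "\<pi> = []")
    case False
    have node: "\<pi> \<in> node_positions W" using child_node_positions Cons.prems by blast
    then have "sub W \<pi> \<noteq> None" by (auto simp: node_positions_def)
    then have "(place T e (b # \<pi>), place T e [last \<pi>]) \<in> step\<^sup>*"
      using False by (intro converse_rtrancl_into_rtrancl[OF place_step[OF node]] Cons.IH)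
    then show ?thesis using False by simp
  qed simp
qed simp

lemma place_root: "place T e [b] \<in> halves T" "opp T (place T e [b]) = place T e [\<not> b]"
  using e by auto

text \<open>
  Paths from two positions to the central edge could be combined to a cycle or to a path that turns
  around, if their half-edges were opposite without being those of the central edge.
\<close>

lemma place_eq_opp:
  assumes \<pi>: "sub W \<pi> \<noteq> None" "\<pi> \<noteq> []" and \<rho>: "sub W \<rho> \<noteq> None" "\<rho> \<noteq> []"
    and eq: "place T e \<pi> = opp T (place T e \<rho>)"
  shows "tl \<pi> = []"
proof (rule ccontr)
  assume tl: "tl \<pi> \<noteq> []"
  then obtain b \<sigma> where \<sigma>: "\<pi> = b # \<sigma>" "\<sigma> \<noteq> []" by (cases \<pi>) auto
  have node: "\<sigma> \<in> node_positions W" using \<pi> \<sigma> child_node_positions by blast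
  then have "sub W \<sigma> \<noteq> None" by (auto simp: node_positions_def)
  then have down: "(place T e \<sigma>, place T e [last \<sigma>]) \<in> step\<^sup>*" using \<sigma> by (intro place_steps)
  have st: "(place T e \<pi>, place T e \<sigma>) \<in> step" using place_step[OF node \<sigma>(2)] \<sigma> by simp
  have up: "(opp T (place T e [last \<rho>]), place T e \<pi>) \<in> step\<^sup>*"
    using steps_reverse[OF place_steps[OF \<rho>]] eq by simp
  show False
  proof (cases "last \<rho> = last \<sigma>")
    case True
    have "(opp T (place T e [last \<rho>]), place T e [last \<rho>]) \<in> step\<^sup>*"
      using up st down unfolding True by (meson rtrancl.rtrancl_into_rtrancl rtrancl_trans)
    then show False
      using no_turn[of "opp T (place T e [last \<rho>])"] place_root(1)[of "last \<rho>"] by simp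
  next
    case False
    then have "place T e [last \<sigma>] = opp T (place T e [last \<rho>])"
      unfolding place_root(2) by (cases "last \<sigma>") auto
    then show False using no_cycle[OF rtrancl_trans[OF down] st] up by simp
  qed
qed

lemma place_neq_root:
  assumes "sub W (c # \<rho>) \<noteq> None" "\<rho> \<noteq> []" shows "place T e (c # \<rho>) \<noteq> place T e [b]"
proof
  assume eq: "place T e (c # \<rho>) = place T e [b]"
  have node: "\<rho> \<in> node_positions W" using assms child_node_positions by blast
  then have "sub W \<rho> \<noteq> None" by (auto simp: node_positions_def)
  then have down: "(place T e \<rho>, place T e [last \<rho>]) \<in> step\<^sup>*" using assms by (intro place_steps)
  have st: "(place T e [b], place T e \<rho>) \<in> step" using place_step[OF node assms(2), of c] eq by simp
  show False
  proof (cases "last \<rho> = b")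
    case True
    then show False using no_cycle down st by simp
  next
    case False
    then have "(place T e [b], opp T (place T e [b])) \<in> step\<^sup>*"
      using st down unfolding place_root(2) by (auto intro: converse_rtrancl_into_rtrancl)
    then show False using no_turn place_root(1) by blast
  qed
qed

lemma place_inj:
  "sub W \<pi> \<noteq> None \<Longrightarrow> \<pi> \<noteq> [] \<Longrightarrow> sub W \<rho> \<noteq> None \<Longrightarrow> \<rho> \<noteq> [] \<Longrightarrow>
    place T e \<pi> = place T e \<rho> \<Longrightarrow> \<pi> = \<rho>"
proof (induction \<pi> arbitrary: \<rho>)
  case (Cons b \<pi>)
  obtain c \<sigma> where \<rho>: "\<rho> = c # \<sigma>" using Cons.prems(4) by (cases \<rho>) auto
  show ?case
  proof (cases "\<pi> = [] \<or> \<sigma> = []")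
    case True
    have "\<pi> = [] \<and> \<sigma> = []"
    proof (rule ccontr)
      assume "\<not> (\<pi> = [] \<and> \<sigma> = [])"
      then consider "\<pi> = []" "\<sigma> \<noteq> []" | "\<sigma> = []" "\<pi> \<noteq> []" using True by blast
      then show False
      proof cases
        case 1
        then show False using place_neq_root[of c \<sigma> b] Cons.prems(3,5) \<rho> by metis
      next
        case 2
        then show False using place_neq_root[of b \<pi> c] Cons.prems(1,5) \<rho> by metis
      qed
    qed
    then show ?thesis
      using Cons.prems(5) opp_neq[OF e] \<rho> by (cases b; cases c) auto
  next
    case False
    have node: "\<pi> \<in> node_positions W" "\<sigma> \<in> node_positions W"
      using Cons.prems child_node_positions unfolding \<rho> by blast+
    then have valid: "sub W \<pi> \<noteq> None" "sub W \<sigma> \<noteq> None" by (auto simp: node_positions_def)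
    have h: "place T e \<pi> \<in> halves T" "place T e \<sigma> \<in> halves T" using place_node node False by auto
    have eq: "(if b then nxt T (place T e \<pi>) else nxt T (nxt T (place T e \<pi>)))
        = (if c then nxt T (place T e \<sigma>) else nxt T (nxt T (place T e \<sigma>)))"
      using Cons.prems(5) False h unfolding \<rho>
      by (cases b; cases c) (simp_all add: place_child opp_inj)
    have turn: "place T e \<tau> \<noteq> nxt T (place T e \<tau>')"
      if "\<tau> \<in> node_positions W" "\<tau> \<noteq> []" "\<tau>' \<in> node_positions W" "\<tau>' \<noteq> []" for \<tau> \<tau>'
    proof
      assume "place T e \<tau> = nxt T (place T e \<tau>')"
      then have "place T e (True # \<tau>') = opp T (place T e \<tau>)"
        using that place_node by (simp add: place_child)
      then show False
        using place_eq_opp[of "True # \<tau>'" \<tau>] that node_positions_child[of \<tau>' W True]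
        by (auto simp: node_positions_def)
    qed
    have "b = c"
    proof (rule ccontr)
      assume "b \<noteq> c"
      then have "place T e \<pi> = nxt T (place T e \<sigma>) \<or> place T e \<sigma> = nxt T (place T e \<pi>)"
        using eq h by (cases b; cases c) (auto simp: nxt_inj)
      then show False using turn node False by blast
    qed
    then have "place T e \<pi> = place T e \<sigma>" using eq h by (auto simp: nxt_inj split: if_splits)
    then have "\<pi> = \<sigma>" using Cons.IH valid False by blast
    then show ?thesis using \<open>b = c\<close> \<rho> by simp
  qed
qed simp

lemma realize_inj: "inj_on realize (halves (word_tree u v))"
proof (rule inj_onI)
  have valid: "sub W \<pi> \<noteq> None" "sub W (b # \<pi>) \<noteq> None" if "\<pi> \<in> node_positions W" for b \<pi>
    using that node_positions_child by (auto simp: node_positions_def)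
  fix x y assume x: "x \<in> halves (word_tree u v)" and y: "y \<in> halves (word_tree u v)"
    and eq: "realize x = realize y"
  have repr: "(\<exists>\<pi>. h = up_half \<pi> \<and> \<pi> \<noteq> [] \<and> sub W \<pi> \<noteq> None) \<or>
      (\<exists>b \<pi>. h = down_half (b # \<pi>) \<and> \<pi> \<noteq> [] \<and> sub W (b # \<pi>) \<noteq> None)"
    if "h \<in> halves (word_tree u v)" for h
    using that by (cases rule: halves_word_treeE) (auto simp: node_positions_def)
  have mixed: "place T e \<pi> \<noteq> opp T (place T e (b # \<rho>))"
    if v: "\<pi> \<noteq> []" "sub W \<pi> \<noteq> None" "\<rho> \<noteq> []" "sub W (b # \<rho>) \<noteq> None" for \<pi> b \<rho>
  proof
    assume "place T e \<pi> = opp T (place T e (b # \<rho>))"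
    then have "place T e (b # \<rho>) = opp T (place T e \<pi>)" using place_closed v by simp
    then show False using place_eq_opp[of "b # \<rho>" \<pi>] v by simp
  qed
  from repr[OF x] repr[OF y] show "x = y"
  proof (elim disjE exE conjE)
    fix \<pi> \<rho> assume "x = up_half \<pi>" "\<pi> \<noteq> []" "sub W \<pi> \<noteq> None"
      "y = up_half \<rho>" "\<rho> \<noteq> []" "sub W \<rho> \<noteq> None"
    then show "x = y" using eq place_inj[of \<pi> \<rho>] by simp
  next
    fix b \<pi> c \<rho> assume *: "x = down_half (b # \<pi>)" "\<pi> \<noteq> []" "sub W (b # \<pi>) \<noteq> None"
      "y = down_half (c # \<rho>)" "\<rho> \<noteq> []" "sub W (c # \<rho>) \<noteq> None"
    then have "place T e (b # \<pi>) = place T e (c # \<rho>)"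
      using eq opp_inj[of "place T e (b # \<pi>)" "place T e (c # \<rho>)"]
        place_closed[of "b # \<pi>"] place_closed[of "c # \<rho>"] by simp
    then show "x = y" using * place_inj[of "b # \<pi>" "c # \<rho>"] by simp
  next
    fix \<pi> c \<rho> assume "x = up_half \<pi>" "\<pi> \<noteq> []" "sub W \<pi> \<noteq> None"
      "y = down_half (c # \<rho>)" "\<rho> \<noteq> []" "sub W (c # \<rho>) \<noteq> None"
    then show "x = y" using eq mixed[of \<pi> \<rho> c] by simp
  next
    fix b \<pi> \<rho> assume "x = down_half (b # \<pi>)" "\<pi> \<noteq> []" "sub W (b # \<pi>) \<noteq> None"
      "y = up_half \<rho>" "\<rho> \<noteq> []" "sub W \<rho> \<noteq> None"
    then show "x = y" using eq mixed[of \<rho> \<pi> b] by simp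
  qed
qed

lemma iso: "utree_iso (word_tree u v) T"
  by (rule word_tree_iso[OF connected realize_inj])

lemma univalent_eq: "univalent T = place T e ` (leaf_positions W)"
proof -
  have "univalent T = realize ` univalent (word_tree u v)"
  proof (intro equalityI subsetI)
    fix d assume "d \<in> univalent T"
    then have d: "d \<in> halves T" "nxt T d = d" by (auto simp: univalent_def)
    then obtain h where h: "h \<in> halves (word_tree u v)" "d = realize h"
      using realize_surj[OF connected] by blast
    interpret J: ugraph H "word_tree u v"
      using branch_word_letters[OF word_e] branch_word_letters[OF word_opp_e] e
      by unfold_locales (auto intro: word_tree_graph)
    have "realize (nxt (word_tree u v) h) = realize h" using realize_hom(3) h d by simp
    then have "nxt (word_tree u v) h = h" using realize_inj h(1) by (auto dest: inj_onD)
    then show "d \<in> realize ` univalent (word_tree u v)" using h by (auto simp: univalent_def)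
  next
    fix d assume "d \<in> realize ` univalent (word_tree u v)"
    then show "d \<in> univalent T" using realize_hom(1,3) by (force simp: univalent_def)
  qed
  moreover have "univalent (word_tree u v) = up_half ` leaf_positions W"
  proof (intro equalityI subsetI)
    fix h assume "h \<in> univalent (word_tree u v)"
    then have h: "h \<in> halves (word_tree u v)" "nxt (word_tree u v) h = h" by (auto simp: univalent_def)
    from h(1) show "h \<in> up_half ` leaf_positions W"
    proof (cases rule: halves_word_treeE)
      case (leaf \<pi> a)
      then show ?thesis by (auto simp: leaf_positions_def)
    next
      case (down b \<pi>)
      then show ?thesis using h by (cases b) auto
    qed (use h in auto)
  next
    fix h assume "h \<in> up_half ` leaf_positions W"
    then obtain \<pi> a where \<pi>: "h = up_half \<pi>" "sub W \<pi> = Some (Letter a)"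
      by (auto simp: leaf_positions_def)
    then have "\<pi> \<noteq> []" by auto
    then show "h \<in> univalent (word_tree u v)"
      using \<pi> by (simp add: univalent_def node_positions_def)
  qed
  ultimately show ?thesis by (simp add: image_image)
qed

text \<open>
  Descending towards a leaf moves the rest of the tree to the other side of the edge, as in the
  recursion of \<^const>\<open>branch_sum\<close>.
\<close>

lemma branch_sum_leaves:
  assumes "sub W \<pi> = Some w" "\<pi> \<noteq> []" "branch_word T (opp T (place T e \<pi>)) c"
    and \<omega>: "\<And>i. i \<in> univalent T \<Longrightarrow> branch_word T (opp T i) (\<omega> i)"
  shows "(\<Sum>\<rho>\<in>leaf_positions w. frag_of (lab T (place T e (\<rho> @ \<pi>)), \<omega> (place T e (\<rho> @ \<pi>))))
    = branch_sum w (frag_of c)"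
  using assms(1-3)
proof (induction w arbitrary: \<pi> c)
  case (Letter a)
  have "place T e \<pi> \<in> univalent T"
    using Letter.prems univalent_eq by (auto simp: leaf_positions_def)
  then have "\<omega> (place T e \<pi>) = c" using \<omega> Letter.prems(3) branch_word_unique by blast
  then show ?case using place_leaf[of \<pi> a] Letter.prems by (simp add: leaf_positions_simps)
next
  case (Br s t)
  let ?h = "place T e \<pi>"
  have node: "\<pi> \<in> node_positions W" using Br.prems by (auto simp: node_positions_def)
  have h: "?h \<in> halves T" "nxt T ?h \<noteq> ?h" using place_node node Br.prems by auto
  have st: "branch_word T (opp T (nxt T ?h)) s" "branch_word T (opp T (nxt T (nxt T ?h))) t"
    using place_word[OF Br.prems(1,2)] h by (auto elim: branch_word_BrE)
  have c: "branch_word T (opp T (place T e (True # \<pi>))) (Br t c)"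
    "branch_word T (opp T (place T e (False # \<pi>))) (Br c s)"
    using branch_word_other[OF h st Br.prems(3)] h Br.prems(2) by (simp_all add: place_child)
  have "(\<Sum>\<rho>\<in>leaf_positions s. frag_of (lab T (place T e (\<rho> @ True # \<pi>)), \<omega> (place T e (\<rho> @ True # \<pi>))))
      = branch_sum s (frag_of (Br t c))"
    using Br.prems c by (intro Br.IH(1)) auto
  moreover have "(\<Sum>\<rho>\<in>leaf_positions t. frag_of (lab T (place T e (\<rho> @ False # \<pi>)), \<omega> (place T e (\<rho> @ False # \<pi>))))
      = branch_sum t (frag_of (Br c s))"
    using Br.prems c by (intro Br.IH(2)) auto
  moreover have "(\<lambda>\<rho>. \<rho> @ [True]) ` leaf_positions s \<inter> (\<lambda>\<rho>. \<rho> @ [False]) ` leaf_positions t = {}"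
    by auto
  ultimately show ?case
    by (simp add: leaf_positions_simps sum.union_disjoint sum.reindex inj_on_def)
qed

lemma leaf_sum_univalent:
  assumes \<omega>: "\<And>i. i \<in> univalent T \<Longrightarrow> branch_word T (opp T i) (\<omega> i)"
  shows "(\<Sum>i\<in>univalent T. frag_of (lab T i, \<omega> i)) = leaf_sum (u, v)"
proof -
  let ?f = "\<lambda>\<pi>. frag_of (lab T (place T e \<pi>), \<omega> (place T e \<pi>))"
  have "inj_on (place T e) (leaf_positions W)"
    by (rule inj_onI) (auto intro!: place_inj simp: leaf_positions_def)
  then have "(\<Sum>i\<in>univalent T. frag_of (lab T i, \<omega> i)) = (\<Sum>\<pi>\<in>leaf_positions W. ?f \<pi>)"
    by (simp add: univalent_eq sum.reindex)
  also have "\<dots> = (\<Sum>\<pi>\<in>leaf_positions u. ?f (\<pi> @ [True])) + (\<Sum>\<pi>\<in>leaf_positions v. ?f (\<pi> @ [False]))"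
  proof -
    have "(\<lambda>\<rho>. \<rho> @ [True]) ` leaf_positions u \<inter> (\<lambda>\<rho>. \<rho> @ [False]) ` leaf_positions v = {}" by auto
    then show ?thesis
      by (simp add: leaf_positions_simps sum.union_disjoint sum.reindex inj_on_def)
  qed
  also have "\<dots> = branch_sum u (frag_of v) + branch_sum v (frag_of u)"
    using e word_e word_opp_e \<omega>
    by (intro arg_cong2[where f = "(+)"] branch_sum_leaves) auto
  finally show ?thesis by (simp add: leaf_sum_def)
qed

end


section \<open>Local modifications of trees\<close>

lemma unitrivalent_trees_iso:
  assumes T: "T \<in> unitrivalent_trees H n" and iso: "utree_iso T T'"
  shows "T' \<in> unitrivalent_trees H n"
proof -
  interpret utree H T n by unfold_locales (use T in \<open>auto simp: unitrivalent_trees_def\<close>)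
  obtain f where f: "bij_betw f (halves T) (halves T')"
    and hom: "\<And>d. d \<in> halves T \<Longrightarrow> f (opp T d) = opp T' (f d)"
      "\<And>d. d \<in> halves T \<Longrightarrow> f (nxt T d) = nxt T' (f d)"
    and lab: "\<And>d. d \<in> univalent T \<Longrightarrow> lab T' (f d) = lab T d"
    using iso by (auto simp: utree_iso_def)
  have inj: "f x = f y \<longleftrightarrow> x = y" if "x \<in> halves T" "y \<in> halves T" for x y
    using f that by (auto simp: bij_betw_def dest: inj_onD)
  have halves': "halves T' = f ` halves T" using f by (simp add: bij_betw_def)
  have opp': "opp T' (f d) = f (opp T d)" and nxt': "nxt T' (f d) = f (nxt T d)"
    if "d \<in> halves T" for d using that hom by simp_all
  have vertex': "vertex_of T' (f d) = f ` vertex_of T d" if "d \<in> halves T" for d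
    using that by (simp add: vertex_of_def nxt')
  have "unitrivalent_graph H T'"
    unfolding unitrivalent_graph_def univalent_def halves'
    using finite_halves lab lab_closed by (auto simp: opp' nxt' inj univalent_def)
  moreover have "connected_graph T'"
  proof -
    let ?adj = "{(c, opp T' c) | c. c \<in> halves T'} \<union> {(c, nxt T' c) | c. c \<in> halves T'}"
    have "(f x, f y) \<in> ?adj\<^sup>*" if "(x, y) \<in> adjacent\<^sup>*" "x \<in> halves T" for x y
      using that
    proof (induction rule: rtrancl_induct)
      case (step y z)
      then have "y \<in> halves T" using adjacent_closed by blast
      then have "(f y, f z) \<in> ?adj" using step(2) by (auto simp: halves' opp' nxt')
      then show ?case using step by (meson rtrancl.rtrancl_into_rtrancl)
    qed simp
    then show ?thesis
      using connected unfolding connected_graph_def halves' by blast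
  qed
  moreover have "acyclic (nonbacktracking_step T')"
  proof -
    have pull: "\<exists>x y. x' = f x \<and> y' = f y \<and> (x, y) \<in> step"
      if "(x', y') \<in> nonbacktracking_step T'" for x' y'
    proof -
      from that obtain x where x: "x \<in> halves T" "x' = f x"
        and y': "y' \<in> vertex_of T' (opp T' (f x))" "y' \<noteq> opp T' (f x)"
        by (auto simp: nonbacktracking_step_def halves')
      then obtain y where y: "y \<in> vertex_of T (opp T x)" "y' = f y"
        by (auto simp: opp' vertex')
      then have "y \<noteq> opp T x" using y' x by (auto simp: opp')
      then show ?thesis using x y by (auto simp: nonbacktracking_step_def)
    qed
    have pull_trancl: "\<exists>x y. x' = f x \<and> y' = f y \<and> (x, y) \<in> step\<^sup>+"
      if "(x', y') \<in> (nonbacktracking_step T')\<^sup>+" for x' y'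
      using that
    proof (induction rule: trancl_induct)
      case (base y')
      then show ?case using pull by blast
    next
      case (step y' z')
      then obtain x y where xy: "x' = f x" "y' = f y" "(x, y) \<in> step\<^sup>+" by blast
      from step(2) obtain w z where wz: "y' = f w" "z' = f z" "(w, z) \<in> step" using pull by blast
      have "y \<in> halves T" using xy(3) step_closed by (auto elim: tranclE)
      then have "y = w" using xy(2) wz step_closed inj by blast
      then have "(x, z) \<in> step\<^sup>+" using xy(3) wz(3) by (simp add: trancl.trancl_into_trancl)
      then show ?case using xy(1) wz(2) by blast
    qed
    have "False" if cycle: "(x', x') \<in> (nonbacktracking_step T')\<^sup>+" for x'
    proof -
      obtain x y where "x' = f x" "x' = f y" "(x, y) \<in> step\<^sup>+" using pull_trancl[OF cycle] by blast
      moreover have "x \<in> halves T" "y \<in> halves T"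
        using \<open>(x, y) \<in> step\<^sup>+\<close> step_closed by (auto elim: tranclE dest: tranclD)
      ultimately show False using inj acyclic by (auto simp: acyclic_def)
    qed
    then show ?thesis by (auto simp: acyclic_def)
  qed
  moreover have "card (trivalent_vertices T') = n"
  proof -
    have "trivalent_vertices T' = (`) f ` trivalent_vertices T"
    proof -
      have "{d \<in> halves T'. nxt T' d \<noteq> d} = f ` {d \<in> halves T. nxt T d \<noteq> d}"
        by (auto simp: halves' nxt' inj)
      moreover have "trivalent_vertices S = vertex_of S ` {d \<in> halves S. nxt S d \<noteq> d}"
        for S :: "'a utree"
        by (auto simp: trivalent_vertices_def)
      ultimately show ?thesis by (simp add: image_image vertex' cong: image_cong_simp)
    qed
    moreover have "inj_on ((`) f) (trivalent_vertices T)"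
    proof (rule inj_on_subset)
      show "inj_on ((`) f) (Pow (halves T))"
        using f by (auto simp: bij_betw_def intro: inj_on_image_Pow)
      show "trivalent_vertices T \<subseteq> Pow (halves T)"
        by (auto simp: trivalent_vertices_def dest: vertex_of_closed)
    qed
    ultimately show ?thesis using card_trivalent by (simp add: card_image)
  qed
  ultimately show ?thesis by (simp add: unitrivalent_trees_def)
qed

lemma card_halves_word_tree: "card (halves (word_tree u v)) + 6 = 4 * (word_length u + word_length v)"
proof -
  let ?N = "node_positions (Br u v)" and ?L = "leaf_positions (Br u v)"
  have L: "card (leaf_positions w) = word_length w" for w :: "'a word"
  proof (induction w)
    case (Br s t)
    then show ?case
      by (subst leaf_positions_simps, subst card_Un_disjoint) (auto simp: card_image inj_on_def)
  qed (simp add: leaf_positions_simps)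
  have root: "[] \<in> ?N" "[] \<notin> ?L" by (auto simp: node_positions_def leaf_positions_def)
  have disj: "?L \<inter> ?N = {}" by (auto simp: node_positions_def leaf_positions_def)
  have "card (?L \<union> ?N - {[]}) = card ?L + (card ?N - 1)"
  proof -
    have "?L \<union> ?N - {[]} = ?L \<union> (?N - {[]})" "?L \<inter> (?N - {[]}) = {}" using root disj by auto
    then show ?thesis using root by (simp add: card_Un_disjoint)
  qed
  then have "card (up_half ` (?L \<union> ?N - {[]})) = card ?L + (card ?N - 1)"
    by (simp add: card_image inj_on_def)
  moreover have "card ((\<lambda>(b, \<pi>). down_half (b # \<pi>)) ` ((UNIV :: bool set) \<times> (?N - {[]})))
      = 2 * (card ?N - 1)"
    using root by (subst card_image) (auto simp: inj_on_def card_cartesian_product)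
  moreover have "up_half ` (?L \<union> ?N - {[]})
      \<inter> (\<lambda>(b, \<pi>). down_half (b # \<pi>)) ` ((UNIV :: bool set) \<times> (?N - {[]})) = {}" by auto
  ultimately have "card (halves (word_tree u v)) = card ?L + (card ?N - 1) + 2 * (card ?N - 1)"
    unfolding halves_word_tree by (subst card_Un_disjoint) auto
  moreover have "card ?N + 1 = word_length u + word_length v" "card ?N \<ge> 1"
    using card_node_positions[of "Br u v"] root by (auto simp: Suc_le_eq card_gt_0_iff)
  ultimately show ?thesis using L[of "Br u v"] by simp
qed

context cut_graph
begin

lemma letters_words: "letters u \<subseteq> carrier H" "letters v \<subseteq> carrier H"
  using branch_word_letters word_e word_opp_e e by auto

text \<open>
  Without knowing that a connected graph has no cycles, it suffices to count its half-edges.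
\<close>

lemma tree_by_counting:
  assumes "connected_graph T" and card: "card (halves T) = card (halves (word_tree u v))"
    and "word_length u + word_length v = n + 2"
  shows "T \<in> unitrivalent_trees H n"
proof -
  have "finite (halves (word_tree u v))" by (simp add: halves_word_tree)
  then have "inj_on realize (halves (word_tree u v))"
    using realize_surj[OF assms(1)] card by (intro eq_card_imp_inj_on) auto
  then have "utree_iso (word_tree u v) T" by (rule word_tree_iso[OF assms(1)])
  moreover have "word_tree u v \<in> unitrivalent_trees H n"
    using letters_words assms(3) by (intro word_tree_in_trees)
  ultimately show ?thesis by (rule unitrivalent_trees_iso[rotated])
qed

end

context cut_tree
begin

lemma word_length_words: "word_length u + word_length v = n + 2"
proof -
  have "word_length u + word_length v = (word_length u + word_length v - 2) + 2"
    using word_length_pos[of u] word_length_pos[of v] by linarith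
  then have "word_tree u v \<in> unitrivalent_trees H (word_length u + word_length v - 2)"
    using letters_words by (intro word_tree_in_trees)
  then have "T \<in> unitrivalent_trees H (word_length u + word_length v - 2)"
    using iso by (rule unitrivalent_trees_iso)
  then have "word_length u + word_length v - 2 = n"
    using card_trivalent by (simp add: unitrivalent_trees_def)
  then show ?thesis using word_length_pos[of u] word_length_pos[of v] by linarith
qed

lemma card_halves: "card (halves T) = card (halves (word_tree u v))"
  using iso by (auto simp: utree_iso_def dest: bij_betw_same_card)

end

context utree
begin

lemma cut_treeI:
  "e \<in> halves T \<Longrightarrow> branch_word T e u \<Longrightarrow> branch_word T (opp T e) v \<Longrightarrow> cut_tree H T n e u v"
  by unfold_locales

text \<open>
  Reversing the orientation does not change the vertex as a set of half-edges, so the non-backtracking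
  steps are the same, and with them acyclicity and the branches at the vertex.
\<close>

lemma flip_orientation_tree:
  assumes d: "d \<in> halves T" "nxt T d \<noteq> d"
  shows "flip_orientation T d \<in> unitrivalent_trees H n"
    and "branch_word T d (Br s t) \<Longrightarrow> branch_word (flip_orientation T d) d (Br t s)"
    and "branch_word T (opp T d) w \<Longrightarrow> branch_word (flip_orientation T d) (opp T d) w"
proof -
  let ?T = "flip_orientation T d" and ?V = "vertex_of T d"
  have simps [simp]: "halves ?T = halves T" "opp ?T = opp T" "lab ?T = lab T"
    "nxt ?T c = (if c \<in> ?V then nxt T (nxt T c) else nxt T c)" for c
    by (simp_all add: flip_orientation_def)
  have V: "c \<in> ?V \<Longrightarrow> c \<in> halves T \<and> nxt T c \<in> ?V \<and> nxt T c \<noteq> c" for c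
    using d nxt2_neq[OF d] by (auto simp: vertex_of_def)
  have notV: "nxt T c \<notin> ?V" if "c \<in> halves T" "c \<notin> ?V" for c
    using that V V[of "nxt T c"] V[of "nxt T (nxt T c)"] by auto
  have fixed: "nxt ?T c = c \<longleftrightarrow> nxt T c = c" if "c \<in> halves T" for c
    using V[of c] nxt2_neq[OF that] by auto
  have vertex: "vertex_of ?T c = vertex_of T c" if "c \<in> halves T" for c
  proof (cases "c \<in> ?V")
    case True
    then show ?thesis using V[of c] V[of "nxt T c"] V[of "nxt T (nxt T c)"] that
      by (auto simp: vertex_of_def)
  next
    case False
    then show ?thesis using notV that by (auto simp: vertex_of_def)
  qed
  have graph': "unitrivalent_graph H ?T"
    unfolding unitrivalent_graph_def
  proof (intro conjI ballI)
    fix c assume c: "c \<in> halves ?T"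
    show "nxt ?T (nxt ?T (nxt ?T c)) = c"
    proof (cases "c \<in> ?V")
      case True
      then show ?thesis using V[of c] V[of "nxt T c"] V[of "nxt T (nxt T c)"] by simp
    next
      case False
      then show ?thesis using notV c by simp
    qed
  next
    fix c assume "c \<in> univalent ?T"
    then have "c \<in> halves T" "nxt T c = c" using fixed by (auto simp: univalent_def simp del: simps(4))
    then show "lab ?T c \<in> carrier H" using lab_closed by simp
  qed (use finite_halves in auto)
  have "connected_graph ?T"
  proof -
    interpret F: ugraph H ?T by unfold_locales (rule graph')
    have nxt: "(c, nxt T c) \<in> F.adjacent\<^sup>*" if "c \<in> halves T" for c
    proof (cases "c \<in> ?V")
      case True
      have "nxt ?T c \<in> halves ?T" using that by simp
      then have "(c, nxt ?T c) \<in> F.adjacent" "(nxt ?T c, nxt ?T (nxt ?T c)) \<in> F.adjacent"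
        using that by (auto simp del: simps(2-4))
      moreover have "nxt ?T (nxt ?T c) = nxt T c"
        using True V[of c] V[of "nxt T c"] V[of "nxt T (nxt T c)"] by simp
      ultimately show ?thesis by (metis (no_types, lifting) r_into_rtrancl rtrancl_trans)
    next
      case False
      then have "(c, nxt T c) \<in> F.adjacent" using that by auto
      then show ?thesis by blast
    qed
    have "(x, y) \<in> F.adjacent\<^sup>*" if "(x, y) \<in> adjacent\<^sup>*" for x y
      using that
    proof (induction rule: rtrancl_induct)
      case (step y z)
      from step(2) consider "y \<in> halves T" "z = opp T y" | "y \<in> halves T" "z = nxt T y" by blast
      then have "(y, z) \<in> F.adjacent\<^sup>*"
      proof cases
        case 1
        then have "(y, z) \<in> F.adjacent" by auto
        then show ?thesis by blast
      next
        case 2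
        then show ?thesis using nxt by blast
      qed
      then show ?case by (rule rtrancl_trans[OF step.IH])
    qed simp
    then show ?thesis using connected by (auto simp: connected_graph_def simp del: simps(2-4))
  qed
  moreover have "nonbacktracking_step ?T = step"
    by (auto simp: nonbacktracking_step_def vertex)
  moreover have "trivalent_vertices ?T = trivalent_vertices T"
    unfolding trivalent_vertices_def using fixed vertex by (auto simp del: simps(4))
  ultimately show "?T \<in> unitrivalent_trees H n"
    using graph' tree by (simp add: unitrivalent_trees_def del: simps(4))
  have cong: "branch_word ?T (opp T x) y" if "branch_word T (opp T x) y" "x \<in> ?V" for x y
  proof (rule branch_word_cong[OF that(1), where K = ?V])
    show "(opp T (opp T x), opp T z) \<notin> step\<^sup>*" if "z \<in> ?V" for z
      using no_return[of x z] V[of x] \<open>x \<in> ?V\<close> that vertex_of_eq[OF d(1)] by auto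
  qed (use that V in auto)
  show "branch_word ?T (opp T d) w" if "branch_word T (opp T d) w"
    using cong that vertex_of_self by blast
  show "branch_word ?T d (Br t s)" if st: "branch_word T d (Br s t)"
  proof (rule branch_word.node)
    show "nxt ?T d \<noteq> d" using d fixed by blast
    have n: "nxt T d \<in> ?V" "nxt T (nxt T d) \<in> ?V" "d \<in> ?V" by (auto simp: vertex_of_def)
    show "branch_word ?T (opp ?T (nxt ?T d)) t" "branch_word ?T (opp ?T (nxt ?T (nxt ?T d))) s"
      using st cong n d by (auto elim: branch_word_BrE)
  qed
qed

lemma relabel_tree:
  assumes d: "d \<in> univalent T" and a: "a \<in> carrier H"
  shows "T\<lparr>lab := (lab T)(d := a)\<rparr> \<in> unitrivalent_trees H n"
    and "branch_word (T\<lparr>lab := (lab T)(d := a)\<rparr>) d (Letter a)"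
    and "branch_word T (opp T d) w \<Longrightarrow> branch_word (T\<lparr>lab := (lab T)(d := a)\<rparr>) (opp T d) w"
proof -
  let ?T = "T\<lparr>lab := (lab T)(d := a)\<rparr>"
  have d': "d \<in> halves T" "nxt T d = d" using d by (auto simp: univalent_def)
  have vertex: "vertex_of ?T = vertex_of T" by (auto simp: vertex_of_def fun_eq_iff)
  show "?T \<in> unitrivalent_trees H n"
    using tree a
    by (auto simp: unitrivalent_trees_def unitrivalent_graph_def connected_graph_def univalent_def
        nonbacktracking_step_def trivalent_vertices_def vertex)
  show "branch_word ?T d (Letter a)"
    using branch_word.leaf[of ?T d] d' by simp
  show "branch_word ?T (opp T d) w" if "branch_word T (opp T d) w"
  proof (rule branch_word_cong[OF that, where K = "{d}"])
    show "(opp T (opp T d), opp T z) \<notin> step\<^sup>*" if "z \<in> {d}" for z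
      using no_turn d' that by auto
  qed (use d' in auto)
qed

end


context utree
begin

text \<open>
  A path leaving the vertex of \<open>e\<close> by another half-edge cannot enter the neighbouring vertex: from
  there it could be continued across \<open>e\<close> to its start.
\<close>

lemma no_path_across:
  assumes e: "e \<in> halves T" and x: "x \<in> vertex_of T e" "x \<noteq> e" and z: "z \<in> vertex_of T (opp T e)"
  shows "(x, opp T z) \<notin> step\<^sup>*"
proof
  assume path: "(x, opp T z) \<in> step\<^sup>*"
  have first: "(opp T e, x) \<in> step" using e x by (intro stepI)
  show False
  proof (cases "z = opp T e")
    case True
    then have "(opp T e, opp T (opp T e)) \<in> step\<^sup>*"
      using path first by (simp add: converse_rtrancl_into_rtrancl)
    then show False using no_turn[of "opp T e"] e by simp
  next
    case False
    have "opp T e \<in> vertex_of T z" using vertex_of_eq[OF _ z] vertex_of_self e by auto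
    moreover have "z \<in> halves T" using vertex_of_closed[OF opp_closed[OF e] z] .
    ultimately have "(opp T z, opp T e) \<in> step" using False by (intro stepI) auto
    then have "(x, opp T e) \<in> step\<^sup>*" using path by (rule rtrancl_into_rtrancl[rotated])
    then show False using first no_cycle by blast
  qed
qed

text \<open>
  The three terms of an IHX relation differ by a permutation of the four branches at an edge. The
  branches do not see the change, and the new graph is connected with the same number of half-edges,
  so it is again a tree.
\<close>

lemma arrange_tree:
  assumes halves: "{a, b, c, d, e} \<subseteq> halves T" and neq: "a \<noteq> b" "c \<noteq> d"
    and nxt: "nxt T a = b" "nxt T b = e" "nxt T e = a"
      "nxt T (opp T e) = c" "nxt T c = d" "nxt T d = opp T e"
    and perm: "distinct [x\<^sub>1, x\<^sub>2, x\<^sub>3, x\<^sub>4]" "{x\<^sub>1, x\<^sub>2, x\<^sub>3, x\<^sub>4} = {a, b, c, d}"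
    and W: "\<And>x. x \<in> {a, b, c, d} \<Longrightarrow> branch_word T (opp T x) (W x)"
  shows "arrange T x\<^sub>1 x\<^sub>2 x\<^sub>3 x\<^sub>4 e \<in> unitrivalent_trees H n"
    and "branch_word (arrange T x\<^sub>1 x\<^sub>2 x\<^sub>3 x\<^sub>4 e) e (Br (W x\<^sub>1) (W x\<^sub>2))"
    and "branch_word (arrange T x\<^sub>1 x\<^sub>2 x\<^sub>3 x\<^sub>4 e) (opp T e) (Br (W x\<^sub>3) (W x\<^sub>4))"
proof -
  let ?T = "arrange T x\<^sub>1 x\<^sub>2 x\<^sub>3 x\<^sub>4 e" and ?K = "{a, b, e, c, d, opp T e}"
  have e: "e \<in> halves T" "opp T e \<in> halves T" using halves by auto
  have V: "vertex_of T e = {a, b, e}" "vertex_of T (opp T e) = {c, d, opp T e}"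
    using nxt by (auto simp: vertex_of_def)
  have inV: "a \<noteq> e" "b \<noteq> e" "c \<noteq> opp T e" "d \<noteq> opp T e"
    using nxt neq halves nxt_inj by auto
  have apart: "vertex_of T e \<inter> vertex_of T (opp T e) = {}"
  proof (rule ccontr)
    assume "vertex_of T e \<inter> vertex_of T (opp T e) \<noteq> {}"
    then have "e \<in> vertex_of T (opp T e)"
      using vertex_of_eq[OF e(1)] vertex_of_eq[OF e(2)] vertex_of_self by blast
    then show False using no_return[OF e(2)] by blast
  qed
  have x: "x \<in> {x\<^sub>1, x\<^sub>2, x\<^sub>3, x\<^sub>4} \<Longrightarrow> x \<in> {a, b, c, d}" for x using perm by simp
  have x_neq: "x\<^sub>1 \<noteq> e" "x\<^sub>2 \<noteq> e" "x\<^sub>3 \<noteq> e" "x\<^sub>4 \<noteq> e" "x\<^sub>1 \<noteq> opp T e" "x\<^sub>2 \<noteq> opp T e"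
    "x\<^sub>3 \<noteq> opp T e" "x\<^sub>4 \<noteq> opp T e" "e \<noteq> opp T e"
    using x[of x\<^sub>1] x[of x\<^sub>2] x[of x\<^sub>3] x[of x\<^sub>4] inV apart V opp_neq[OF e(1)] by auto
  have K: "?K = {x\<^sub>1, x\<^sub>2, e, x\<^sub>3, x\<^sub>4, opp T e}" using perm(2) by blast
  have K_halves: "z \<in> ?K \<Longrightarrow> z \<in> halves T" for z using halves e by auto
  have K_nxt: "z \<in> ?K \<Longrightarrow> nxt T z \<in> ?K" for z using nxt by auto
  have K_outside: "z \<in> halves T \<Longrightarrow> z \<notin> ?K \<Longrightarrow> nxt T z \<notin> ?K" for z
    using K_nxt[of "nxt T z"] K_nxt[of "nxt T (nxt T z)"] nxt3[of z] by metis
  have simps: "halves ?T = halves T" "opp ?T = opp T" "lab ?T = lab T"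
    by (simp_all add: arrange_def)
  have nxt': "nxt ?T x\<^sub>1 = x\<^sub>2" "nxt ?T x\<^sub>2 = e" "nxt ?T e = x\<^sub>1" "nxt ?T (opp T e) = x\<^sub>3"
    "nxt ?T x\<^sub>3 = x\<^sub>4" "nxt ?T x\<^sub>4 = opp T e"
    using perm(1) x_neq by (auto simp: arrange_def)
  have nxt'': "nxt ?T z = nxt T z" if "z \<notin> ?K" for z
    using that unfolding K by (auto simp: arrange_def)
  have graph': "unitrivalent_graph H ?T"
    unfolding unitrivalent_graph_def simps
  proof (intro conjI ballI)
    fix z assume z: "z \<in> halves T"
    show "nxt ?T z \<in> halves T"
    proof (cases "z \<in> ?K")
      case True
      then have "nxt ?T z \<in> ?K" unfolding K using nxt' by auto
      then show ?thesis by (rule K_halves)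
    qed (simp add: nxt'' z)
    show "nxt ?T (nxt ?T (nxt ?T z)) = z"
    proof (cases "z \<in> ?K")
      case True
      then show ?thesis unfolding K using nxt' by auto
    next
      case False
      then show ?thesis using K_outside z nxt'' by simp
    qed
  next
    fix z assume "z \<in> univalent ?T"
    then have z: "z \<in> halves T" "nxt ?T z = z" by (auto simp: univalent_def simps)
    then have "z \<notin> ?K" unfolding K using nxt' perm(1) x_neq by auto
    then show "lab T z \<in> carrier H" using nxt'' z lab_closed by simp
  qed (use finite_halves in auto)
  interpret F: ugraph H ?T by unfold_locales (rule graph')
  have conn: "connected_graph ?T"
  proof (rule F.connectedI)
    show "e \<in> halves ?T" using e by (simp add: simps)
    have sF: "(z, nxt ?T z) \<in> F.adjacent\<^sup>*" "(z, opp T z) \<in> F.adjacent\<^sup>*" if "z \<in> halves T" for z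
      using that by (auto simp: simps intro!: r_into_rtrancl)
    have xs: "x\<^sub>1 \<in> halves T" "x\<^sub>3 \<in> halves T"
      using x[of x\<^sub>1] x[of x\<^sub>3] K_halves by auto
    have "(e, x\<^sub>1) \<in> F.adjacent\<^sup>*" "(x\<^sub>1, x\<^sub>2) \<in> F.adjacent\<^sup>*" "(e, opp T e) \<in> F.adjacent\<^sup>*"
      "(opp T e, x\<^sub>3) \<in> F.adjacent\<^sup>*" "(x\<^sub>3, x\<^sub>4) \<in> F.adjacent\<^sup>*"
      using sF(1)[OF e(1)] sF(1)[OF xs(1)] sF(2)[OF e(1)] sF(1)[OF e(2)] sF(1)[OF xs(2)]
      by (simp_all only: nxt')
    then have reach: "(e, z) \<in> F.adjacent\<^sup>*" if "z \<in> ?K" for z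
      using that unfolding K by (blast intro: rtrancl_trans)
    have "(y, nxt T y) \<in> F.adjacent\<^sup>*" if "y \<in> halves T" for y
    proof (cases "y \<in> ?K")
      case True
      show ?thesis
        using F.adjacent_sym[OF reach[OF True]] reach[OF K_nxt[OF True]] by (rule rtrancl_trans)
    next
      case False
      show ?thesis using sF(1)[OF that] unfolding nxt''[OF False] .
    qed
    then have step: "(y, z) \<in> F.adjacent\<^sup>*" if "(y, z) \<in> adjacent" for y z
      using that sF(2) by auto
    fix z assume "z \<in> halves ?T"
    then have "(e, z) \<in> adjacent\<^sup>*" using connected e by (auto simp: connected_graph_def simps)
    then show "(e, z) \<in> F.adjacent\<^sup>*"
      by (induction rule: rtrancl_induct) (blast intro: step rtrancl_trans)+
  qed
  have away: "(x, opp T z) \<notin> step\<^sup>*" if "x \<in> {a, b, c, d}" "z \<in> ?K" for x z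
  proof -
    have "x \<in> vertex_of T e \<and> x \<noteq> e \<or> x \<in> vertex_of T (opp T e) \<and> x \<noteq> opp T e"
      "z \<in> vertex_of T e \<or> z \<in> vertex_of T (opp T e)"
      using that inV unfolding V by auto
    then show ?thesis
      using no_path_across[OF e(1), of x z] no_path_across[OF e(2), of x z]
        no_return[of x z] vertex_of_eq[OF e(1), of x] vertex_of_eq[OF e(2), of x] e
        vertex_of_closed[OF e(1), of x] vertex_of_closed[OF e(2), of x] by auto
  qed
  have branch: "branch_word ?T (opp T x) (W x)" if "x \<in> {a, b, c, d}" for x
  proof (rule branch_word_cong[OF W[OF that], where K = ?K])
    show "opp T x \<in> halves T" using that halves by auto
    show "(opp T (opp T x), opp T z) \<notin> step\<^sup>*" if "z \<in> ?K" for z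
      using away[of x z] that \<open>x \<in> {a, b, c, d}\<close> K_halves[of x] by auto
    show "nxt ?T z = nxt T z \<and> (nxt T z = z \<longrightarrow> lab ?T z = lab T z)" if "z \<notin> ?K" for z
      using nxt''[OF that] by (simp add: simps)
    show "z \<in> halves T \<and> nxt T z \<in> ?K" if "z \<in> ?K" for z
      using K_halves[OF that] K_nxt[OF that] by (rule conjI)
  qed (rule simps(2))
  have W': "branch_word ?T (opp T x\<^sub>1) (W x\<^sub>1)" "branch_word ?T (opp T x\<^sub>2) (W x\<^sub>2)"
    "branch_word ?T (opp T x\<^sub>3) (W x\<^sub>3)" "branch_word ?T (opp T x\<^sub>4) (W x\<^sub>4)"
    using branch x by blast+
  show words: "branch_word ?T e (Br (W x\<^sub>1) (W x\<^sub>2))" "branch_word ?T (opp T e) (Br (W x\<^sub>3) (W x\<^sub>4))"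
    using W' x_neq by (auto intro!: branch_word.node simp: nxt' simps)
  have "branch_word T e (Br (W a) (W b))" "branch_word T (opp T e) (Br (W c) (W d))"
    using branch_word.node[of T e "W a" "W b"] branch_word.node[of T "opp T e" "W c" "W d"]
      W[of a] W[of b] W[of c] W[of d] inV nxt by simp_all
  then interpret C: cut_tree H T n e "Br (W a) (W b)" "Br (W c) (W d)"
    using e by (intro cut_treeI)
  interpret C': cut_graph H ?T e "Br (W x\<^sub>1) (W x\<^sub>2)" "Br (W x\<^sub>3) (W x\<^sub>4)"
    using e words by unfold_locales (simp_all add: simps)
  have "distinct [a, b, c, d]" using neq apart unfolding V by auto
  then have "(\<Sum>x\<in>{a, b, c, d}. word_length (W x))
      = word_length (W a) + word_length (W b) + word_length (W c) + word_length (W d)"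
    by simp
  moreover have "(\<Sum>x\<in>{x\<^sub>1, x\<^sub>2, x\<^sub>3, x\<^sub>4}. word_length (W x))
      = word_length (W x\<^sub>1) + word_length (W x\<^sub>2) + word_length (W x\<^sub>3) + word_length (W x\<^sub>4)"
    using perm(1) by simp
  ultimately have len: "word_length (Br (W x\<^sub>1) (W x\<^sub>2)) + word_length (Br (W x\<^sub>3) (W x\<^sub>4))
      = word_length (Br (W a) (W b)) + word_length (Br (W c) (W d))"
    unfolding perm(2) by simp
  show "?T \<in> unitrivalent_trees H n"
  proof (rule C'.tree_by_counting[OF conn])
    show "card (halves ?T) = card (halves (word_tree (Br (W x\<^sub>1) (W x\<^sub>2)) (Br (W x\<^sub>3) (W x\<^sub>4))))"
      using C.card_halves len card_halves_word_tree[of "Br (W x\<^sub>1) (W x\<^sub>2)" "Br (W x\<^sub>3) (W x\<^sub>4)"]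
        card_halves_word_tree[of "Br (W a) (W b)" "Br (W c) (W d)"]
      by (simp only: simps)
  qed (use len C.word_length_words in simp)
qed

end


section \<open>The maps on generators\<close>

lemma branch_word_iso:
  assumes hom: "\<And>d. d \<in> halves T \<Longrightarrow> f (opp T d) = opp T' (f d) \<and> f (nxt T d) = nxt T' (f d)"
    and inj: "inj_on f (halves T)" and lab: "\<And>d. d \<in> univalent T \<Longrightarrow> lab T' (f d) = lab T d"
    and closed: "\<And>d. d \<in> halves T \<Longrightarrow> opp T d \<in> halves T \<and> nxt T d \<in> halves T"
  shows "branch_word T e w \<Longrightarrow> e \<in> halves T \<Longrightarrow> branch_word T' (f e) w"
proof (induction rule: branch_word.induct)
  case (leaf e)
  then have "nxt T' (f e) = f e" "lab T' (f e) = lab T e"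
    using hom[of e] lab[of e] by (auto simp: univalent_def)
  then show ?case using branch_word.leaf[of T' "f e"] by simp
next
  case (node e s t)
  have "nxt T' (f e) \<noteq> f e"
    using node.hyps(1) node.prems hom[of e] closed[of e] inj by (metis inj_onD)
  moreover have "opp T' (nxt T' (f e)) = f (opp T (nxt T e))"
    "opp T' (nxt T' (nxt T' (f e))) = f (opp T (nxt T (nxt T e)))"
    using node.prems hom closed by simp_all
  ultimately show ?case using node.IH node.prems closed by (intro branch_word.node) simp_all
qed

locale tree_maps = coordinates H coord
  for H :: "('a, 'm) monoid_scheme" and coord :: "'a \<Rightarrow> ('a \<Rightarrow>\<^sub>0 int)" +
  fixes n :: nat
begin

abbreviation deg :: "nat \<Rightarrow> 'a word set" where "deg m \<equiv> {t \<in> words H. word_length t = m}"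
abbreviation L where "L \<equiv> quasi_lie_deg H (n + 1)"
abbreviation tensor_rels where "tensor_rels \<equiv> tensor_relations H L"
abbreviation trees where "trees \<equiv> unitrivalent_trees H n"
abbreviation tree_rels where
  "tree_rels \<equiv> iso_relations H n \<union> as_relations H n \<union> ihx_relations H n \<union> linearity_relations H n"

sublocale L: frag_quotient "quasi_lie_ideal H" "{x. Poly_Mapping.keys x \<subseteq> deg (n + 1)}" L
  by (rule quasi_lie_deg_frag_quotient) (rule comm_group_H)

sublocale L2: frag_quotient "quasi_lie_ideal H" "{x. Poly_Mapping.keys x \<subseteq> deg (n + 2)}"
  "quasi_lie_deg H (n + 2)"
  by (rule quasi_lie_deg_frag_quotient) (rule comm_group_H)

sublocale LG: comm_group L by (rule L.comm_group)

lemma utreeI: "T \<in> trees \<Longrightarrow> utree H T n"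
  by unfold_locales (auto simp: unitrivalent_trees_def)

lemma tensor_rels_keys: "r \<in> tensor_rels \<Longrightarrow> Poly_Mapping.keys r \<subseteq> carrier H \<times> carrier L"
  unfolding tensor_relations_def
  using LG.m_closed
  by (auto intro!: order_trans[OF keys_diff] Un_least dest!: keys_diff[THEN subsetD])

lemma tree_rels_keys:
  assumes "r \<in> tree_rels" shows "Poly_Mapping.keys r \<subseteq> trees"
proof -
  have diff: "Poly_Mapping.keys (x - y) \<subseteq> trees"
    and add: "Poly_Mapping.keys (x + y) \<subseteq> trees"
    if "Poly_Mapping.keys x \<subseteq> trees" "Poly_Mapping.keys y \<subseteq> trees" for x y
    using that keys_diff[of x y] keys_add[of x y] by blast+
  from assms consider "r \<in> iso_relations H n" | "r \<in> as_relations H n" | "r \<in> ihx_relations H n"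
    | "r \<in> linearity_relations H n" by blast
  then show ?thesis
  proof cases
    case 4
    then obtain T d a\<^sub>1 a\<^sub>2 where r: "r = frag_of T - frag_of (T\<lparr>lab := (lab T)(d := a\<^sub>1)\<rparr>)
        - frag_of (T\<lparr>lab := (lab T)(d := a\<^sub>2)\<rparr>)" "T \<in> trees" "d \<in> univalent T"
        "a\<^sub>1 \<in> carrier H" "a\<^sub>2 \<in> carrier H"
      by (auto simp: linearity_relations_def)
    then have "T\<lparr>lab := (lab T)(d := a\<^sub>1)\<rparr> \<in> trees" "T\<lparr>lab := (lab T)(d := a\<^sub>2)\<rparr> \<in> trees"
      using utree.relabel_tree(1)[OF utreeI] by blast+
    then show ?thesis unfolding r using r(2) by (intro diff) auto
  next
    case 1
    then show ?thesis
      unfolding iso_relations_def by (elim CollectE exE conjE, simp only:) (intro diff, simp_all)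
  next
    case 2
    then show ?thesis
      unfolding as_relations_def by (elim CollectE exE conjE, simp only:) (intro add, simp_all)
  next
    case 3
    then show ?thesis
      unfolding ihx_relations_def by (elim CollectE exE conjE, simp only:) (intro add, simp_all)
  qed
qed

sublocale TL: frag_quotient tensor_rels "{x. Poly_Mapping.keys x \<subseteq> carrier H \<times> carrier L}"
  "tensor H L"
  unfolding tensor_def by (rule presented_frag_quotient) (rule tensor_rels_keys)

sublocale TG: frag_quotient tree_rels "{x. Poly_Mapping.keys x \<subseteq> trees}" "tree_group H n"
  unfolding tree_group_def by (rule presented_frag_quotient) (rule tree_rels_keys)

lemma pure_tensor_eq: "pure_tensor H L a X = frag_class tensor_rels (frag_of (a, X))"
  unfolding pure_tensor_def by (rule presented_gen_eq) (rule tensor_rels_keys)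

abbreviation cls :: "('a word \<Rightarrow>\<^sub>0 int) \<Rightarrow> ('a word \<Rightarrow>\<^sub>0 int) set" where
  "cls \<equiv> quasi_lie_class H"

lemma cls_eq_iff: "cls x = cls y \<longleftrightarrow> x - y \<in> quasi_lie_ideal H"
  by (simp add: quasi_lie_class_eq frag_class_eq_iff)

lemma cls_closed: "Poly_Mapping.keys x \<subseteq> deg (n + 1) \<Longrightarrow> cls x \<in> carrier L"
  using L.closed by (simp add: quasi_lie_class_eq)

lemma cls_mult:
  "Poly_Mapping.keys x \<subseteq> deg (n + 1) \<Longrightarrow> Poly_Mapping.keys y \<subseteq> deg (n + 1) \<Longrightarrow>
    cls x \<otimes>\<^bsub>L\<^esub> cls y = cls (x + y)"
  using L.mult by (simp add: quasi_lie_class_eq)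

text \<open>
  The relations between words are homogeneous, so words of another degree or with letters outside
  \<open>H\<close> may be sent to zero.
\<close>

definition to_tensor :: "'a \<times> 'a word \<Rightarrow> ('a \<times> ('a word \<Rightarrow>\<^sub>0 int) set \<Rightarrow>\<^sub>0 int)" where
  "to_tensor = (\<lambda>(a, w). if a \<in> carrier H \<and> w \<in> deg (n + 1) then frag_of (a, cls (frag_of w)) else 0)"

lemma tensor_additive_right:
  assumes "a \<in> carrier H" "X \<in> carrier L" "Y \<in> carrier L"
  shows "frag_of (a, X \<otimes>\<^bsub>L\<^esub> Y) - frag_of (a, X) - frag_of (a, Y) \<in> zspan tensor_rels"
  using assms by (intro zspan.gen) (auto simp: tensor_relations_def)

lemma tensor_additive_left:
  assumes "a \<in> carrier H" "b \<in> carrier H" "X \<in> carrier L"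
  shows "frag_of (a \<otimes>\<^bsub>H\<^esub> b, X) - frag_of (a, X) - frag_of (b, X) \<in> zspan tensor_rels"
  using assms by (intro zspan.gen) (auto simp: tensor_relations_def)

lemma to_tensor_cls:
  assumes a: "a \<in> carrier H" and x: "Poly_Mapping.keys x \<subseteq> deg (n + 1)"
  shows "frag_extend to_tensor (otimes (frag_of a) x) - frag_of (a, cls x) \<in> zspan tensor_rels"
  using x
proof (induction x rule: free_Abelian_group_induct[consumes 1])
  case 1
  have "cls 0 \<in> carrier L" by (rule cls_closed) simp
  moreover have "cls 0 \<otimes>\<^bsub>L\<^esub> cls 0 = cls 0" using cls_mult[of 0 0] by simp
  ultimately show ?case
    using zspan_minus[OF tensor_additive_right[OF a, of "cls 0" "cls 0"]]
    by (simp add: otimes_bilinear) (use zspan_minus in fastforce)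
next
  case (2 x y)
  have xy: "Poly_Mapping.keys (x - y) \<subseteq> deg (n + 1)" using 2(1,2) keys_diff[of x y] by blast
  have "frag_of (a, cls x) - frag_of (a, cls (x - y)) - frag_of (a, cls y) \<in> zspan tensor_rels"
    using tensor_additive_right[OF a cls_closed[OF xy] cls_closed[OF 2(2)]] cls_mult[OF xy 2(2)]
    by simp
  then have "(frag_of (a, cls x) - frag_of (a, cls y)) - frag_of (a, cls (x - y)) \<in> zspan tensor_rels"
    by (simp add: algebra_simps)
  then show ?case
    using zspan_trans[OF zspan_diff_cong[OF 2(3,4)]] by (simp add: otimes_bilinear frag_extend_linear)
next
  case (3 w)
  then show ?case using a by (simp add: to_tensor_def zspan.zero)
qed

lemma to_tensor_ideal:
  assumes q: "q \<in> quasi_lie_ideal H" and keys: "\<And>w. w \<in> Poly_Mapping.keys q \<Longrightarrow> word_length w = m"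
  shows "frag_extend to_tensor (otimes (frag_of a) q) \<in> zspan tensor_rels"
proof (cases "a \<in> carrier H \<and> m = n + 1")
  case True
  then have keys: "Poly_Mapping.keys q \<subseteq> deg (n + 1)"
    using keys quasi_lie_ideal_keys[OF comm_group_H q] by auto
  have "cls q = cls 0" using q by (simp add: cls_eq_iff)
  then have "frag_of (a, cls q) \<in> zspan tensor_rels"
    using zspan_minus[OF to_tensor_cls[of a 0]] True by (simp add: otimes_bilinear)
  then show ?thesis using to_tensor_cls[OF _ keys, of a] True by (blast intro: zspan_subst)
next
  case False
  have "frag_extend to_tensor (otimes (frag_of a) q) = 0"
  proof (rule frag_extend_eq_0)
    fix x assume "x \<in> Poly_Mapping.keys (otimes (frag_of a) q)"
    then obtain w where "x = (a, w)" "w \<in> Poly_Mapping.keys q"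
      using keys_otimes[of "frag_of a" q] by auto
    then show "to_tensor x = 0" using False keys[of w] by (auto simp: to_tensor_def)
  qed
  then show ?thesis by (simp add: zspan.zero)
qed

lemma to_tensor_tensor_relators:
  assumes "x \<in> zspan tensor_relators" shows "frag_extend to_tensor x \<in> zspan tensor_rels"
  using assms
proof (rule frag_extend_zspan)
  fix r :: "'a \<times> 'a word \<Rightarrow>\<^sub>0 int" assume "r \<in> tensor_relators"
  then obtain a and g :: "'a word \<Rightarrow>\<^sub>0 int" where g: "g \<in> lie_relators" "r = otimes (frag_of a) g"
    by (auto simp: tensor_relators_def)
  then obtain m where m: "\<And>w. w \<in> Poly_Mapping.keys g \<Longrightarrow> letter_mset w = m"
    using lie_relators_homogeneous by blast
  show "frag_extend to_tensor r \<in> zspan tensor_rels"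
  proof (cases "set_mset m \<subseteq> carrier H")
    case True
    then have "Poly_Mapping.keys g \<subseteq> words H"
      using m by (auto simp: words_def simp flip: letter_mset_letters)
    then have "g \<in> quasi_lie_ideal H" using zspan_lie_quasi_lie_ideal zspan.gen g(1) by blast
    then show ?thesis
      unfolding g(2) by (rule to_tensor_ideal[where m = "size m"]) (simp flip: letter_mset_length add: m)
  next
    case False
    have "frag_extend to_tensor r = 0"
    proof (rule frag_extend_eq_0)
      fix x assume "x \<in> Poly_Mapping.keys r"
      then obtain w where "x = (a, w)" "w \<in> Poly_Mapping.keys g"
        using keys_otimes[of "frag_of a" g] g(2) by auto
      then show "to_tensor x = 0"
        using False m[of w] letter_mset_letters[of w] by (auto simp: to_tensor_def words_def)
    qed
    then show ?thesis by (simp add: zspan.zero)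
  qed
qed

lemma to_tensor_branch_sum_ideal:
  assumes "q \<in> quasi_lie_ideal H" "\<And>w. w \<in> Poly_Mapping.keys q \<Longrightarrow> word_length w = m"
    and "s \<in> words H"
  shows "frag_extend to_tensor (branch_sum s q) \<in> zspan tensor_rels"
  using assms
proof (induction s arbitrary: q m)
  case (Letter a)
  then show ?case using to_tensor_ideal by simp
next
  case (Br s t)
  have "frag_extend to_tensor (branch_sum s (word_mult (frag_of t) q)) \<in> zspan tensor_rels"
  proof (rule Br.IH(1))
    show "word_mult (frag_of t) q \<in> quasi_lie_ideal H"
      using Br.prems by (intro quasi_lie_ideal.mult_left) auto
    show "word_length w = word_length t + m"
      if "w \<in> Poly_Mapping.keys (word_mult (frag_of t) q)" for w
      using that keys_word_mult[of "frag_of t" q] Br.prems(2) by auto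
  qed (use Br.prems in auto)
  moreover have "frag_extend to_tensor (branch_sum t (word_mult q (frag_of s))) \<in> zspan tensor_rels"
  proof (rule Br.IH(2))
    show "word_mult q (frag_of s) \<in> quasi_lie_ideal H"
      using Br.prems by (intro quasi_lie_ideal.mult_right) auto
    show "word_length w = m + word_length s"
      if "w \<in> Poly_Mapping.keys (word_mult q (frag_of s))" for w
      using that keys_word_mult[of q "frag_of s"] Br.prems(2) by auto
  qed (use Br.prems in auto)
  ultimately show ?case by (simp add: frag_extend_linear zspan_add)
qed


section \<open>The map eta\<close>

definition eta_frag :: "'a utree \<Rightarrow> ('a \<times> ('a word \<Rightarrow>\<^sub>0 int) set \<Rightarrow>\<^sub>0 int)" where
  "eta_frag T = (\<Sum>i\<in>univalent T. frag_of (lab T i, rooted_value H T i))"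

text \<open>
  Cut at the half-edge of a univalent vertex \<open>i\<close>, the tree consists of the label of \<open>i\<close> and of the word
  whose class is the rooted value. So the sum defining eta is the image of \<^const>\<open>leaf_sum\<close>, which
  can be computed from the words at any edge.
\<close>

lemma eta_frag_cut:
  assumes "cut_tree H T n e u v"
  shows "eta_frag T = frag_extend to_tensor (leaf_sum (u, v))"
    and "Poly_Mapping.keys (eta_frag T) \<subseteq> carrier H \<times> carrier L"
    and "eta_tree H n T = frag_class tensor_rels (eta_frag T)"
proof -
  interpret cut_tree H T n e u v by (rule assms)
  have "\<exists>w. branch_word T (opp T i) w" if "i \<in> univalent T" for i
    using that branch_word_exists[of "opp T i"] by (auto simp: univalent_def)
  then obtain \<omega> where \<omega>: "\<And>i. i \<in> univalent T \<Longrightarrow> branch_word T (opp T i) (\<omega> i)" by metis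
  have i: "lab T i \<in> carrier H \<and> \<omega> i \<in> deg (n + 1) \<and> rooted_value H T i = cls (frag_of (\<omega> i))"
    if i: "i \<in> univalent T" for i
  proof -
    have h: "i \<in> halves T" "nxt T i = i" using i by (auto simp: univalent_def)
    interpret I: cut_tree H T n i "Letter (lab T i)" "\<omega> i"
      using \<omega>[OF i] branch_word.leaf h by unfold_locales auto
    have "branch_value H T i (cls (frag_of (\<omega> i))) \<and> \<omega> i \<in> words H"
      using branch_value_branch_word[OF comm_group_H \<omega>[OF i]] h by simp
    moreover from this have "rooted_value H T i = cls (frag_of (\<omega> i))"
      unfolding rooted_value_def using branch_value_ex1[OF tree h(1)] by (intro the1_equality) auto
    ultimately show ?thesis using I.word_length_words lab_closed h by simp
  qed
  have "frag_extend to_tensor (leaf_sum (u, v))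
      = frag_extend to_tensor (\<Sum>i\<in>univalent T. frag_of (lab T i, \<omega> i))"
    using leaf_sum_univalent[OF \<omega>] by simp
  also have "\<dots> = (\<Sum>i\<in>univalent T. to_tensor (lab T i, \<omega> i))"
    using finite_halves by (simp add: frag_extend_sum univalent_def)
  also have "\<dots> = eta_frag T"
    unfolding eta_frag_def
  proof (intro sum.cong refl)
    fix x assume "x \<in> univalent T"
    then show "to_tensor (lab T x, \<omega> x) = frag_of (lab T x, rooted_value H T x)"
      using i[of x] by (simp add: to_tensor_def)
  qed
  finally show "eta_frag T = frag_extend to_tensor (leaf_sum (u, v))" by simp
  have closed: "(lab T i, rooted_value H T i) \<in> carrier H \<times> carrier L" if "i \<in> univalent T" for i
    using i[OF that] cls_closed[of "frag_of (\<omega> i)"] by auto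
  then show "Poly_Mapping.keys (eta_frag T) \<subseteq> carrier H \<times> carrier L"
    unfolding eta_frag_def by (intro order_trans[OF keys_sum]) auto
  have "finite (univalent T)" using finite_halves by (simp add: univalent_def)
  then show "eta_tree H n T = frag_class tensor_rels (eta_frag T)"
    unfolding eta_tree_def eta_frag_def pure_tensor_eq
    by (rule TL.finprod) (use closed in auto)
qed

lemma cut_tree_exists:
  assumes "T \<in> trees"
  obtains e u v where "cut_tree H T n e u v"
proof -
  interpret utree H T n by (rule utreeI) fact
  obtain e where e: "e \<in> halves T" using connected by (auto simp: connected_graph_def)
  then obtain u v where "branch_word T e u" "branch_word T (opp T e) v"
    using branch_word_exists opp_closed by meson
  then show ?thesis using that cut_treeI e by blast
qed

lemma cut_treeI':
  "T \<in> trees \<Longrightarrow> e \<in> halves T \<Longrightarrow> branch_word T e u \<Longrightarrow> branch_word T (opp T e) v \<Longrightarrow>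
    cut_tree H T n e u v"
  by (rule utree.cut_treeI[OF utreeI])

lemma leaf_sum_to_tensor_relator:
  assumes "x \<in> zspan pair_relators"
  shows "frag_extend to_tensor (frag_extend leaf_sum x) \<in> zspan tensor_rels"
  using frag_extend_zspan[OF assms leaf_sum_pair_relators] by (rule to_tensor_tensor_relators)

lemma zspan_pair_ihx:
  "frag_of (Br r s, Br t w) + frag_of (Br s t, Br r w) + frag_of (Br t r, Br s w)
    \<in> zspan pair_relators"
proof -
  have move: "frag_of (Br x y, Br z w) - frag_of (Br (Br x y) z, w) \<in> zspan pair_relators" for x y z
    by (rule zspan_sym) (intro zspan.gen pair_relators.move)
  show ?thesis
    using zspan_add_cong[OF zspan_add_cong[OF move move] move] zspan.gen[OF pair_relators.ihx]
    by (rule zspan_subst)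
qed

text \<open>
  For each relation the trees are cut at the edge where they differ; then the relation becomes one
  between pairs of words.
\<close>

lemma eta_frag_rels:
  assumes "r \<in> tree_rels" shows "frag_extend eta_frag r \<in> zspan tensor_rels"
proof -
  from assms consider "r \<in> iso_relations H n" | "r \<in> as_relations H n" | "r \<in> ihx_relations H n"
    | "r \<in> linearity_relations H n" by blast
  then show ?thesis
  proof cases
    case 1
    then obtain T T' where r: "r = frag_of T - frag_of T'" "T \<in> trees" "T' \<in> trees" "utree_iso T T'"
      by (auto simp: iso_relations_def)
    obtain e u v where "cut_tree H T n e u v" using cut_tree_exists r(2) by blast
    then interpret cut_tree H T n e u v .
    obtain f where f: "bij_betw f (halves T) (halves T')"
      "\<And>d. d \<in> halves T \<Longrightarrow> f (opp T d) = opp T' (f d) \<and> f (nxt T d) = nxt T' (f d)"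
      "\<And>d. d \<in> univalent T \<Longrightarrow> lab T' (f d) = lab T d"
      using r(4) by (auto simp: utree_iso_def)
    have image: "branch_word T' (f d) w" if "branch_word T d w" "d \<in> halves T" for d w
      using branch_word_iso[OF f(2) _ f(3) _ that] f(1) by (auto simp: bij_betw_def)
    have "branch_word T' (f e) u" "branch_word T' (opp T' (f e)) v" "f e \<in> halves T'"
      using image[OF word_e e] image[OF word_opp_e opp_closed[OF e]] e f(1) f(2)[OF e]
      by (auto simp: bij_betw_def)
    then have "cut_tree H T' n (f e) u v" using r(3) by (intro cut_treeI')
    then have "eta_frag T' = eta_frag T"
      using eta_frag_cut(1) \<open>cut_tree H T n e u v\<close> by metis
    then show ?thesis unfolding r(1) by (simp add: frag_extend_linear zspan.zero)
  next
    case 2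
    then obtain T d where r: "r = frag_of T + frag_of (flip_orientation T d)" "T \<in> trees"
      "d \<in> halves T" "nxt T d \<noteq> d" by (auto simp: as_relations_def)
    interpret utree H T n by (rule utreeI) fact
    obtain u v where uv: "branch_word T d u" "branch_word T (opp T d) v"
      using branch_word_exists r(3) opp_closed by meson
    obtain s t where u: "u = Br s t" using uv(1) r(4) by cases auto
    have T: "cut_tree H T n d (Br s t) v" using r uv u by (intro cut_treeI) auto
    have "cut_tree H (flip_orientation T d) n d (Br t s) v"
      using flip_orientation_tree[OF r(3,4)] uv r(3) unfolding u
      by (intro cut_treeI') (auto simp: flip_orientation_def)
    from eta_frag_cut(1)[OF this] eta_frag_cut(1)[OF T] show ?thesis
      using leaf_sum_to_tensor_relator[OF zspan.gen[OF pair_relators.antisym[of s t v]]]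
      unfolding r(1) by (simp add: frag_extend_linear)
  next
    case 3
    then obtain T a b c d e where r: "r = frag_of T + frag_of (arrange T b c a d e)
          + frag_of (arrange T c a b d e)" and T: "T \<in> trees"
      and h: "{a, b, c, d, e} \<subseteq> halves T" "a \<noteq> b" "c \<noteq> d" "nxt T a = b" "nxt T b = e" "nxt T e = a"
        "nxt T (opp T e) = c" "nxt T c = d" "nxt T d = opp T e"
      unfolding ihx_relations_def by (elim CollectE exE conjE) (rule that; assumption)
    interpret utree H T n by (rule utreeI) fact
    have "\<exists>w. branch_word T (opp T x) w" if "x \<in> {a, b, c, d}" for x
      using that h(1) branch_word_exists[of "opp T x"] by auto
    then obtain W where W: "\<And>x. x \<in> {a, b, c, d} \<Longrightarrow> branch_word T (opp T x) (W x)" by metis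
    have e: "e \<in> halves T" using h(1) by simp
    have ne: "a \<noteq> e" "c \<noteq> opp T e" using h nxt_inj by auto
    have cut: "cut_tree H T n e (Br (W a) (W b)) (Br (W c) (W d))"
      using branch_word.node[of T e "W a" "W b"] branch_word.node[of T "opp T e" "W c" "W d"]
        W[of a] W[of b] W[of c] W[of d] h(4-9) ne e by (intro cut_treeI) simp_all
    have "vertex_of T e = {a, b, e}" "vertex_of T (opp T e) = {c, d, opp T e}"
      using h(4-9) by (auto simp: vertex_of_def)
    moreover have "vertex_of T x = vertex_of T e" if "x \<in> vertex_of T e" for x
      using vertex_of_eq e that by blast
    moreover have "vertex_of T x = vertex_of T (opp T e)" if "x \<in> vertex_of T (opp T e)" for x
      using vertex_of_eq opp_closed[OF e] that by blast
    moreover have "e \<notin> vertex_of T (opp T e)" using no_return[of "opp T e" e] e by auto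
    ultimately have "distinct [a, b, c, d]" using h(2,3) by auto
    then have dist: "distinct [b, c, a, d]" "distinct [c, a, b, d]" by auto
    have cut1: "cut_tree H (arrange T b c a d e) n e (Br (W b) (W c)) (Br (W a) (W d))"
      using arrange_tree[OF h dist(1) _ W] e by (intro cut_treeI') (auto simp: arrange_def)
    have cut2: "cut_tree H (arrange T c a b d e) n e (Br (W c) (W a)) (Br (W b) (W d))"
      using arrange_tree[OF h dist(2) _ W] e by (intro cut_treeI') (auto simp: arrange_def)
    show ?thesis
      using leaf_sum_to_tensor_relator[OF zspan_pair_ihx[of "W a" "W b" "W c" "W d"]]
        eta_frag_cut(1)[OF cut] eta_frag_cut(1)[OF cut1] eta_frag_cut(1)[OF cut2]
      unfolding r by (simp add: frag_extend_linear)
  next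
    case 4
    then obtain T d a\<^sub>1 a\<^sub>2 where r: "r = frag_of T - frag_of (T\<lparr>lab := (lab T)(d := a\<^sub>1)\<rparr>)
        - frag_of (T\<lparr>lab := (lab T)(d := a\<^sub>2)\<rparr>)" "T \<in> trees" "d \<in> univalent T"
        "a\<^sub>1 \<in> carrier H" "a\<^sub>2 \<in> carrier H" "lab T d = a\<^sub>1 \<otimes>\<^bsub>H\<^esub> a\<^sub>2"
      by (auto simp: linearity_relations_def)
    interpret utree H T n by (rule utreeI) fact
    have d: "d \<in> halves T" "nxt T d = d" using r(3) by (auto simp: univalent_def)
    obtain w where w: "branch_word T (opp T d) w" using branch_word_exists d opp_closed by meson
    have cut: "cut_tree H T n d (Letter (a\<^sub>1 \<otimes>\<^bsub>H\<^esub> a\<^sub>2)) w"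
      using branch_word.leaf[OF d(2)] w d r(6) by (intro cut_treeI) auto
    then interpret cut_tree H T n d "Letter (a\<^sub>1 \<otimes>\<^bsub>H\<^esub> a\<^sub>2)" w .
    have cut': "cut_tree H (T\<lparr>lab := (lab T)(d := a)\<rparr>) n d (Letter a) w" if "a \<in> carrier H" for a
      using relabel_tree[OF r(3) that] w d by (intro cut_treeI') auto
    have w': "w \<in> deg (n + 1)" using letters_words word_length_words by (auto simp: words_def)
    let ?q = "frag_of (Letter (a\<^sub>1 \<otimes>\<^bsub>H\<^esub> a\<^sub>2)) - frag_of (Letter a\<^sub>1) - frag_of (Letter a\<^sub>2)"
    have "frag_extend eta_frag r
        = (frag_of (a\<^sub>1 \<otimes>\<^bsub>H\<^esub> a\<^sub>2, cls (frag_of w)) - frag_of (a\<^sub>1, cls (frag_of w)) - frag_of (a\<^sub>2, cls (frag_of w)))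
          + frag_extend to_tensor (branch_sum w ?q)"
      using r(4,5) w' unfolding r(1)
      by (simp add: frag_extend_linear eta_frag_cut(1)[OF cut] eta_frag_cut(1)[OF cut'] leaf_sum_def
          branch_sum_linear to_tensor_def)
    moreover have "frag_extend to_tensor (branch_sum w ?q) \<in> zspan tensor_rels"
    proof (rule to_tensor_branch_sum_ideal)
      show "?q \<in> quasi_lie_ideal H" using r(4,5) by (rule quasi_lie_ideal.additive)
      show "word_length x = 1" if "x \<in> Poly_Mapping.keys ?q" for x
        using that by (auto dest!: keys_diff[THEN subsetD])
    qed (use w' in auto)
    ultimately show ?thesis
      using tensor_additive_left[OF r(4,5) cls_closed[of "frag_of w"]] w'
      by (simp add: zspan_add)
  qed
qed

lemma eta_class:
  assumes "Poly_Mapping.keys z \<subseteq> trees"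
  shows "eta H n (frag_class tree_rels z) = frag_class tensor_rels (frag_extend eta_frag z)"
  unfolding eta_def
proof (rule TL.induced)
  fix T assume "T \<in> trees"
  then show "eta_tree H n T = frag_class tensor_rels (eta_frag T) \<and>
      eta_frag T \<in> {x. Poly_Mapping.keys x \<subseteq> carrier H \<times> carrier L}"
    using cut_tree_exists eta_frag_cut(2,3) by (metis mem_Collect_eq)
qed (use assms eta_frag_rels tree_rels_keys in auto)

end


context tree_maps
begin

section \<open>The bracket map\<close>

definition representative :: "('a word \<Rightarrow>\<^sub>0 int) set \<Rightarrow> ('a word \<Rightarrow>\<^sub>0 int)" where
  "representative X = (SOME x. Poly_Mapping.keys x \<subseteq> deg (n + 1) \<and> cls x = X)"

lemma representative:
  assumes "X \<in> carrier L"
  shows "Poly_Mapping.keys (representative X) \<subseteq> deg (n + 1)" "cls (representative X) = X"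
proof -
  have "\<exists>x. Poly_Mapping.keys x \<subseteq> deg (n + 1) \<and> cls x = X"
    using assms unfolding L.carrier_eq quasi_lie_class_eq by blast
  from someI_ex[OF this] show "Poly_Mapping.keys (representative X) \<subseteq> deg (n + 1)"
    "cls (representative X) = X" unfolding representative_def by blast+
qed

lemma representative_mult:
  assumes "X \<in> carrier L" "Y \<in> carrier L"
  shows "representative (X \<otimes>\<^bsub>L\<^esub> Y) - representative X - representative Y \<in> quasi_lie_ideal H"
proof -
  have "cls (representative (X \<otimes>\<^bsub>L\<^esub> Y)) = cls (representative X + representative Y)"
    using assms representative cls_mult[of "representative X" "representative Y"]
      LG.m_closed[OF assms] by simp
  then show ?thesis by (simp add: cls_eq_iff diff_diff_eq)
qed

lemma representative_cls:
  assumes "Poly_Mapping.keys x \<subseteq> deg (n + 1)"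
  shows "representative (cls x) - x \<in> quasi_lie_ideal H"
  using representative(2)[OF cls_closed[OF assms]] by (simp add: cls_eq_iff)

definition bracket_frag :: "'a \<times> ('a word \<Rightarrow>\<^sub>0 int) set \<Rightarrow> ('a word \<Rightarrow>\<^sub>0 int)" where
  "bracket_frag = (\<lambda>(h, X). word_mult (frag_of (Letter h)) (representative X))"

lemma keys_words: "Poly_Mapping.keys x \<subseteq> deg m \<Longrightarrow> Poly_Mapping.keys x \<subseteq> words H"
  by blast

lemma bracket_frag_rels:
  assumes "r \<in> tensor_rels" shows "frag_extend bracket_frag r \<in> quasi_lie_ideal H"
proof -
  from assms consider g g' k where "r = frag_of (g \<otimes>\<^bsub>H\<^esub> g', k) - frag_of (g, k) - frag_of (g', k)"
      "g \<in> carrier H" "g' \<in> carrier H" "k \<in> carrier L"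
    | g k k' where "r = frag_of (g, k \<otimes>\<^bsub>L\<^esub> k') - frag_of (g, k) - frag_of (g, k')"
      "g \<in> carrier H" "k \<in> carrier L" "k' \<in> carrier L"
    unfolding tensor_relations_def by blast
  then show ?thesis
  proof cases
    case 1
    have "word_mult (frag_of (Letter (g \<otimes>\<^bsub>H\<^esub> g')) - frag_of (Letter g) - frag_of (Letter g'))
        (representative k) \<in> quasi_lie_ideal H"
      using 1 keys_words[OF representative(1)[OF 1(4)]]
      by (intro quasi_lie_ideal.mult_right quasi_lie_ideal.additive) auto
    then show ?thesis
      unfolding 1(1) by (simp add: bracket_frag_def frag_extend_linear word_mult_bilinear)
  next
    case 2
    have "word_mult (frag_of (Letter g))
        (representative (k \<otimes>\<^bsub>L\<^esub> k') - representative k - representative k') \<in> quasi_lie_ideal H"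
      using 2 representative_mult[OF 2(3,4)] by (intro quasi_lie_ideal.mult_left) auto
    then show ?thesis
      unfolding 2(1) by (simp add: bracket_frag_def frag_extend_linear word_mult_bilinear)
  qed
qed

lemma beta_class:
  assumes y: "Poly_Mapping.keys y \<subseteq> carrier H \<times> carrier L"
  shows "beta H n (frag_class tensor_rels y)
    = frag_class (quasi_lie_ideal H) (frag_extend bracket_frag y)"
  unfolding beta_def
proof (rule L2.induced[OF _ _ y])
  fix s assume "s \<in> carrier H \<times> carrier L"
  then obtain h X where s: "s = (h, X)" "h \<in> carrier H" "X \<in> carrier L" by blast
  note rep = representative[OF s(3)]
  have "quasi_lie_bracket H (quasi_lie_incl H h) X = cls (bracket_frag s)"
    using quasi_lie_bracket_class[OF comm_group_H, of "frag_of (Letter h)" "representative X"]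
      s rep keys_words[OF rep(1)]
    by (simp add: quasi_lie_incl_def bracket_frag_def)
  moreover have "Poly_Mapping.keys (bracket_frag s) \<subseteq> deg (n + 2)"
    using keys_word_mult[of "frag_of (Letter h)" "representative X"] rep(1) s(2)
    unfolding s(1) bracket_frag_def by fastforce
  ultimately show "(case s of (h, x) \<Rightarrow> quasi_lie_bracket H (quasi_lie_incl H h) x)
      = frag_class (quasi_lie_ideal H) (bracket_frag s)
      \<and> bracket_frag s \<in> {x. Poly_Mapping.keys x \<subseteq> deg (n + 2)}"
    by (simp add: s(1) quasi_lie_class_eq)
next
  fix r assume "r \<in> tensor_rels"
  then show "Poly_Mapping.keys r \<subseteq> carrier H \<times> carrier L \<and>
      frag_extend bracket_frag r \<in> zspan (quasi_lie_ideal H)"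
    using tensor_rels_keys bracket_frag_rels by simp
qed

lemma leaf_sum_keys:
  assumes "letters u \<subseteq> A" "letters v \<subseteq> A" "word_length u + word_length v = n + 2"
    and "(a, w) \<in> Poly_Mapping.keys (leaf_sum (u, v))"
  shows "a \<in> A" "letters w \<subseteq> A" "word_length w = n + 1"
proof -
  have m: "add_mset a (letter_mset w) = letter_mset u + letter_mset v"
    using assms(4) by (rule leaf_sum_homogeneous)
  from arg_cong[OF m, of set_mset] show "a \<in> A" "letters w \<subseteq> A" using assms(1,2) by auto
  from arg_cong[OF m, of size] show "word_length w = n + 1" using assms(3) by simp
qed

lemma beta_eta:
  assumes "T \<in> trees" shows "frag_extend bracket_frag (eta_frag T) \<in> quasi_lie_ideal H"
proof -
  obtain e u v where cut: "cut_tree H T n e u v" using cut_tree_exists assms by blast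
  then interpret cut_tree H T n e u v .
  let ?br = "\<lambda>(a, w). frag_of (Br (Letter a) w)"
  have key: "a \<in> carrier H \<and> w \<in> deg (n + 1)" if "(a, w) \<in> Poly_Mapping.keys (leaf_sum (u, v))" for a w
    using leaf_sum_keys[OF letters_words word_length_words that] by (simp add: words_def)
  have "frag_extend bracket_frag (to_tensor s) - ?br s \<in> zspan (quasi_lie_ideal H)"
    if s: "s \<in> Poly_Mapping.keys (leaf_sum (u, v))" for s
  proof -
    obtain a w where aw: "s = (a, w)" "a \<in> carrier H" "w \<in> deg (n + 1)"
      using key s by (cases s) auto
    have "word_mult (frag_of (Letter a)) (representative (cls (frag_of w)) - frag_of w)
        \<in> quasi_lie_ideal H"
      using aw by (intro quasi_lie_ideal.mult_left representative_cls) auto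
    then show ?thesis
      using aw by (simp add: to_tensor_def bracket_frag_def word_mult_bilinear)
  qed
  then have "frag_extend bracket_frag (eta_frag T) - frag_extend ?br (leaf_sum (u, v))
      \<in> zspan (quasi_lie_ideal H)"
    unfolding eta_frag_cut(1)[OF cut] frag_extend_frag_extend by (rule frag_extend_cong_zspan)
  moreover have "frag_extend ?br (leaf_sum (u, v)) \<in> quasi_lie_ideal H"
  proof (rule zspan_lie_quasi_lie_ideal[OF bracket_leaf_sum])
    show "Poly_Mapping.keys (frag_extend ?br (leaf_sum (u, v))) \<subseteq> words H"
      using key by (intro keys_frag_extendI) auto
  qed
  ultimately show ?thesis using zspan_subst by (metis zspan_quasi_lie_ideal)
qed


section \<open>Trees as pairs of words\<close>

text \<open>
  The relators between pairs are homogeneous, so either all pairs in a relator come from trees with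
  \<open>n\<close> trivalent vertices and labels in \<open>H\<close>, or none.
\<close>

definition to_tree :: "'a word \<times> 'a word \<Rightarrow> ('a utree \<Rightarrow>\<^sub>0 int)" where
  "to_tree = (\<lambda>(u, v). if u \<in> words H \<and> v \<in> words H \<and> word_length u + word_length v = n + 2
     then frag_of (word_tree u v) else 0)"

lemma word_tree_cut:
  assumes "u \<in> words H" "v \<in> words H" "word_length u + word_length v = n + 2"
  shows "cut_tree H (word_tree u v) n (up_half [True]) u v" "word_tree u v \<in> trees"
proof -
  show tree: "word_tree u v \<in> trees" using assms by (intro word_tree_in_trees) (auto simp: words_def)
  show "cut_tree H (word_tree u v) n (up_half [True]) u v"
    using branch_word_word_tree[of u v "[True]" u] branch_word_word_tree[of u v "[False]" v]
    by (intro cut_treeI' tree) auto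
qed

lemma to_tree_cut:
  assumes "cut_tree H T n e u v" shows "frag_of T - to_tree (u, v) \<in> zspan tree_rels"
proof -
  interpret cut_tree H T n e u v by fact
  have "to_tree (u, v) = frag_of (word_tree u v)"
    using letters_words word_length_words by (simp add: to_tree_def words_def)
  moreover have "word_tree u v \<in> trees"
    using letters_words word_length_words by (intro word_tree_in_trees)
  then have "frag_of (word_tree u v) - frag_of T \<in> zspan tree_rels"
    using iso tree by (intro zspan.gen) (auto simp: iso_relations_def)
  ultimately show ?thesis using zspan_sym by simp
qed

lemma to_tree_recut:
  assumes "u \<in> words H" "v \<in> words H" "word_length u + word_length v = n + 2"
    and "cut_tree H (word_tree u v) n e u' v'"
  shows "to_tree (u, v) - to_tree (u', v') \<in> zspan tree_rels"
  using to_tree_cut[OF assms(4)] assms(1-3) by (simp add: to_tree_def)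

lemma to_tree_swap: "to_tree (u, v) - to_tree (v, u) \<in> zspan tree_rels"
proof (cases "u \<in> words H \<and> v \<in> words H \<and> word_length u + word_length v = n + 2")
  case True
  then have "cut_tree H (word_tree u v) n (up_half [False]) v u"
    using branch_word_word_tree[of u v "[True]" u] branch_word_word_tree[of u v "[False]" v]
    by (intro cut_treeI' word_tree_cut) auto
  then show ?thesis using to_tree_recut True by blast
qed (auto simp: to_tree_def zspan.zero add.commute)

lemma to_tree_move: "to_tree (Br u v, w) - to_tree (u, Br v w) \<in> zspan tree_rels"
proof (cases "Br u v \<in> words H \<and> w \<in> words H \<and> word_length (Br u v) + word_length w = n + 2")
  case True
  let ?T = "word_tree (Br u v) w" and ?e = "up_half [True]"
  interpret cut_tree H ?T n ?e "Br u v" w using True by (intro word_tree_cut) auto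
  have node: "[True] \<in> node_positions (Br (Br u v) w)" by (simp add: node_positions_def)
  have "branch_word ?T (nxt ?T ?e) (Br v w)"
    using word_e word_opp_e e node by (intro branch_word_other) (auto elim: branch_word_BrE)
  moreover have "branch_word ?T (opp ?T (nxt ?T ?e)) u"
    using word_e by (rule branch_word_BrE)
  ultimately have "cut_tree H ?T n (opp ?T (nxt ?T ?e)) u (Br v w)"
    using e by (intro cut_treeI) auto
  then show ?thesis using to_tree_recut True by blast
qed (auto simp: to_tree_def zspan.zero add.assoc)

lemma to_tree_antisym: "to_tree (Br u v, w) + to_tree (Br v u, w) \<in> zspan tree_rels"
proof (cases "Br u v \<in> words H \<and> w \<in> words H \<and> word_length (Br u v) + word_length w = n + 2")
  case True
  let ?T = "word_tree (Br u v) w" and ?e = "up_half [True]"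
  interpret cut_tree H ?T n ?e "Br u v" w using True by (intro word_tree_cut) auto
  have "[True] \<in> node_positions (Br (Br u v) w)" by (simp add: node_positions_def)
  then have ne: "nxt ?T ?e \<noteq> ?e" by simp
  let ?F = "flip_orientation ?T ?e"
  have F: "?F \<in> trees" by (rule flip_orientation_tree[OF e ne])
  have "cut_tree H ?F n ?e (Br v u) w"
    using flip_orientation_tree(2,3)[OF e ne] word_e word_opp_e e F
    by (intro cut_treeI') (auto simp: flip_orientation_def)
  then have "frag_of ?F - to_tree (Br v u, w) \<in> zspan tree_rels" by (rule to_tree_cut)
  moreover have "frag_of ?T + frag_of ?F \<in> as_relations H n"
    unfolding as_relations_def using tree F e ne by blast
  then have "frag_of ?T + frag_of ?F \<in> zspan tree_rels" by (intro zspan.gen) blast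
  ultimately have "(frag_of ?T + frag_of ?F) - (frag_of ?F - to_tree (Br v u, w)) \<in> zspan tree_rels"
    by (rule zspan.diff[rotated])
  then show ?thesis using True by (simp add: to_tree_def algebra_simps)
qed (auto simp: to_tree_def zspan.zero add.commute)

lemma to_tree_ihx_edge:
  "to_tree (Br r s, Br t w) + to_tree (Br s t, Br r w) + to_tree (Br t r, Br s w) \<in> zspan tree_rels"
proof (cases "Br r s \<in> words H \<and> Br t w \<in> words H
    \<and> word_length (Br r s) + word_length (Br t w) = n + 2")
  case True
  let ?T = "word_tree (Br r s) (Br t w)" and ?e = "up_half [True]"
  interpret cut_tree H ?T n ?e "Br r s" "Br t w" using True by (intro word_tree_cut) auto
  let ?a = "down_half [True, True]" and ?b = "down_half [False, True]"
  let ?c = "down_half [True, False]" and ?d = "down_half [False, False]"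
  have node: "[True] \<in> node_positions W" "[False] \<in> node_positions W"
    by (simp_all add: node_positions_def)
  have nxt: "nxt ?T ?a = ?b" "nxt ?T ?b = ?e" "nxt ?T ?e = ?a" "nxt ?T (opp ?T ?e) = ?c"
    "nxt ?T ?c = ?d" "nxt ?T ?d = opp ?T ?e"
    using node by simp_all
  have halves: "{?a, ?b, ?c, ?d, ?e} \<subseteq> halves ?T" using node by simp
  have neq: "?a \<noteq> ?b" "?c \<noteq> ?d" by simp_all
  define V where "V x = (if x = ?a then r else if x = ?b then s else if x = ?c then t else w)" for x
  have V: "branch_word ?T (opp ?T x) (V x)" if "x \<in> {?a, ?b, ?c, ?d}" for x
    using that branch_word_word_tree[of "Br r s" "Br t w" "[True, True]" r]
      branch_word_word_tree[of "Br r s" "Br t w" "[False, True]" s]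
      branch_word_word_tree[of "Br r s" "Br t w" "[True, False]" t]
      branch_word_word_tree[of "Br r s" "Br t w" "[False, False]" w]
    by (auto simp: V_def)
  have V': "V ?a = r" "V ?b = s" "V ?c = t" "V ?d = w" by (simp_all add: V_def)
  let ?T1 = "arrange ?T ?b ?c ?a ?d ?e" and ?T2 = "arrange ?T ?c ?a ?b ?d ?e"
  have T1: "?T1 \<in> trees" "branch_word ?T1 ?e (Br s t)" "branch_word ?T1 (opp ?T ?e) (Br r w)"
    using arrange_tree[OF halves neq nxt _ _ V, of ?b ?c ?a ?d] unfolding V' by auto
  have T2: "?T2 \<in> trees" "branch_word ?T2 ?e (Br t r)" "branch_word ?T2 (opp ?T ?e) (Br s w)"
    using arrange_tree[OF halves neq nxt _ _ V, of ?c ?a ?b ?d] unfolding V' by auto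
  have "cut_tree H ?T1 n ?e (Br s t) (Br r w)" "cut_tree H ?T2 n ?e (Br t r) (Br s w)"
    using T1 T2 e by (auto intro!: cut_treeI' simp: arrange_def)
  then have "frag_of ?T1 - to_tree (Br s t, Br r w) \<in> zspan tree_rels"
    "frag_of ?T2 - to_tree (Br t r, Br s w) \<in> zspan tree_rels"
    by (auto intro: to_tree_cut)
  moreover have "frag_of ?T - to_tree (Br r s, Br t w) \<in> zspan tree_rels"
    by (rule to_tree_cut[OF cut_tree_axioms])
  ultimately have diff: "(frag_of ?T + frag_of ?T1 + frag_of ?T2) - (to_tree (Br r s, Br t w)
      + to_tree (Br s t, Br r w) + to_tree (Br t r, Br s w)) \<in> zspan tree_rels"
    by (intro zspan_add_cong)
  have "frag_of ?T + frag_of ?T1 + frag_of ?T2 \<in> ihx_relations H n"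
    unfolding ihx_relations_def using tree T1(1) T2(1) halves neq nxt by blast
  then have "frag_of ?T + frag_of ?T1 + frag_of ?T2 \<in> zspan tree_rels"
    by (intro zspan.gen) blast
  then show ?thesis using zspan_sym[OF diff] by (rule zspan_subst[rotated])
qed (auto simp: to_tree_def zspan.zero ac_simps)

lemma to_tree_pair_relators:
  assumes "x \<in> zspan pair_relators" shows "frag_extend to_tree x \<in> zspan tree_rels"
  using assms
proof (rule frag_extend_zspan)
  fix g :: "'a word \<times> 'a word \<Rightarrow>\<^sub>0 int" assume "g \<in> pair_relators"
  then show "frag_extend to_tree g \<in> zspan tree_rels"
  proof cases
    case (ihx r s t w)
    have "frag_extend to_tree g - (to_tree (Br r s, Br t w) + to_tree (Br s t, Br r w)
        + to_tree (Br t r, Br s w)) \<in> zspan tree_rels"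
      unfolding ihx frag_extend_add frag_extend_of by (intro zspan_add_cong to_tree_move)
    then show ?thesis using to_tree_ihx_edge by (rule zspan_subst)
  qed (auto simp only: frag_extend_linear frag_extend_of
      intro: to_tree_swap to_tree_move to_tree_antisym)
qed

lemma to_tree_pair_cong:
  "x - y \<in> zspan pair_relators \<Longrightarrow> frag_extend to_tree x - frag_extend to_tree y \<in> zspan tree_rels"
  using to_tree_pair_relators[of "x - y"] by (simp add: frag_extend_linear)

lemma to_tree_letter_additive:
  assumes a: "a \<in> carrier H" and b: "b \<in> carrier H"
  shows "to_tree (Letter (a \<otimes>\<^bsub>H\<^esub> b), v) - to_tree (Letter a, v) - to_tree (Letter b, v)
    \<in> zspan tree_rels"
proof (cases "v \<in> deg (n + 1)")
  case True
  let ?T = "word_tree (Letter (a \<otimes>\<^bsub>H\<^esub> b)) v" and ?e = "up_half [True]"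
  interpret cut_tree H ?T n ?e "Letter (a \<otimes>\<^bsub>H\<^esub> b)" v using True a b by (intro word_tree_cut) auto
  have fixed: "nxt ?T ?e = ?e" "lab ?T ?e = a \<otimes>\<^bsub>H\<^esub> b" using word_e by (auto elim: branch_word_LetterE)
  then have uni: "?e \<in> univalent ?T" using e by (simp add: univalent_def)
  have cut: "cut_tree H (?T\<lparr>lab := (lab ?T)(?e := x)\<rparr>) n ?e (Letter x) v" if "x \<in> carrier H" for x
    using relabel_tree[OF uni that] word_opp_e e by (intro cut_treeI') auto
  have "frag_of ?T - frag_of (?T\<lparr>lab := (lab ?T)(?e := a)\<rparr>) - frag_of (?T\<lparr>lab := (lab ?T)(?e := b)\<rparr>)
      \<in> zspan tree_rels"
    using tree uni a b fixed(2) by (intro zspan.gen) (auto simp: linearity_relations_def)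
  moreover have "(frag_of ?T - frag_of (?T\<lparr>lab := (lab ?T)(?e := a)\<rparr>)
        - frag_of (?T\<lparr>lab := (lab ?T)(?e := b)\<rparr>))
      - (to_tree (Letter (a \<otimes>\<^bsub>H\<^esub> b), v) - to_tree (Letter a, v) - to_tree (Letter b, v))
      \<in> zspan tree_rels"
    by (intro zspan_diff_cong to_tree_cut[OF cut_tree_axioms] to_tree_cut[OF cut] a b)
  ultimately show ?thesis using zspan_subst[OF zspan_sym] by blast
next
  case False
  then show ?thesis using a b by (auto simp: to_tree_def zspan.zero)
qed

text \<open>
  To expand the letters of one word, each of its letters is made the root in turn, where the
  linearity relation applies.
\<close>

lemma to_tree_expand_left:
  "u \<in> words H \<Longrightarrow>
    frag_extend to_tree (otimes (frag_of u) y) - frag_extend to_tree (otimes (expand u) y)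
      \<in> zspan tree_rels"
proof (induction u arbitrary: y)
  case (Letter a)
  show ?case
  proof (rule frag_zspan_ext[where x = y], goal_cases)
    case (2 v)
    let ?f = "\<lambda>a. to_tree (Letter a, v)"
    have "?f a - frag_extend ?f (coord a) \<in> zspan tree_rels"
      using Letter by (intro additive_eq_coord to_tree_letter_additive) auto
    moreover have "frag_extend to_tree (otimes (expand (Letter a)) (frag_of v))
        = frag_extend ?f (coord a)"
      by (simp add: otimes_def frag_extend_frag_extend)
    ultimately show ?case by simp
  qed (simp add: otimes_bilinear frag_extend_linear)
next
  case (Br s t)
  let ?s = "frag_of s" and ?t = "frag_of t" and ?F = "frag_extend to_tree"
  have "?F (otimes (frag_of (Br s t)) y) - ?F (otimes ?s (word_mult ?t y)) \<in> zspan tree_rels"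
    using to_tree_pair_cong[OF zspan_pair_move[of ?s ?t y]] by simp
  moreover have "?F (otimes ?s (word_mult ?t y)) - ?F (otimes (expand s) (word_mult ?t y)) \<in> zspan tree_rels"
    using Br by simp
  moreover have "?F (otimes (expand s) (word_mult ?t y)) - ?F (otimes ?t (word_mult y (expand s)))
      \<in> zspan tree_rels"
    by (rule to_tree_pair_cong) (rule zspan_trans[OF zspan_pair_move' zspan_pair_swap])
  moreover have "?F (otimes ?t (word_mult y (expand s))) - ?F (otimes (expand t) (word_mult y (expand s)))
      \<in> zspan tree_rels"
    using Br by simp
  moreover have "?F (otimes (expand t) (word_mult y (expand s))) - ?F (otimes (expand (Br s t)) y)
      \<in> zspan tree_rels"
    unfolding expand.simps by (rule to_tree_pair_cong) (rule zspan_pair_move')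
  ultimately show ?case by (blast intro: zspan_trans)
qed

lemma to_tree_expand:
  assumes "u \<in> words H" "v \<in> words H"
  shows "to_tree (u, v) - frag_extend to_tree (otimes (expand u) (expand v)) \<in> zspan tree_rels"
proof -
  let ?F = "frag_extend to_tree"
  have "to_tree (u, v) - ?F (otimes (expand u) (frag_of v)) \<in> zspan tree_rels"
    using to_tree_expand_left[OF assms(1), of "frag_of v"] by simp
  moreover have "?F (otimes (expand u) (frag_of v)) - ?F (otimes (frag_of v) (expand u)) \<in> zspan tree_rels"
    by (intro to_tree_pair_cong zspan_pair_swap)
  moreover have "?F (otimes (frag_of v) (expand u)) - ?F (otimes (expand v) (expand u)) \<in> zspan tree_rels"
    using assms(2) by (rule to_tree_expand_left)
  moreover have "?F (otimes (expand v) (expand u)) - ?F (otimes (expand u) (expand v)) \<in> zspan tree_rels"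
    by (intro to_tree_pair_cong zspan_pair_swap)
  ultimately show ?thesis by (blast intro: zspan_trans)
qed

end


section \<open>The contraction\<close>

context tree_maps
begin

definition tensor_coords :: "'a \<times> ('a word \<Rightarrow>\<^sub>0 int) set \<Rightarrow> ('a \<times> 'a word \<Rightarrow>\<^sub>0 int)" where
  "tensor_coords = (\<lambda>(h, X). otimes (coord h) (frag_extend expand (representative X)))"

text \<open>
  \<^const>\<open>regraft_by\<close> in terms of the actual groups. It is defined on coordinates, since weights make
  sense only for letters from the basis.
\<close>

definition retract ::
  "('a multiset \<Rightarrow> 'a \<Rightarrow> int) \<Rightarrow> 'a \<times> ('a word \<Rightarrow>\<^sub>0 int) set \<Rightarrow> ('a utree \<Rightarrow>\<^sub>0 int)" where
  "retract c s = frag_extend to_tree (frag_extend (regraft_by c) (tensor_coords s))"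

lemma regraft_by_lie:
  assumes "q \<in> zspan lie_relators"
  shows "frag_extend to_tree (frag_extend (regraft_by c) (otimes y q)) \<in> zspan tree_rels"
  by (rule frag_zspan_ext[where x = y])
     (simp_all add: otimes_bilinear frag_extend_linear to_tree_pair_relators
       regraft_by_tensor_relators assms)

lemma retract_rels:
  assumes "r \<in> tensor_rels" shows "frag_extend (retract c) r \<in> zspan tree_rels"
proof -
  from assms consider g g' k where "r = frag_of (g \<otimes>\<^bsub>H\<^esub> g', k) - frag_of (g, k) - frag_of (g', k)"
      "g \<in> carrier H" "g' \<in> carrier H" "k \<in> carrier L"
    | g k k' where "r = frag_of (g, k \<otimes>\<^bsub>L\<^esub> k') - frag_of (g, k) - frag_of (g, k')"
      "g \<in> carrier H" "k \<in> carrier L" "k' \<in> carrier L"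
    unfolding tensor_relations_def by blast
  then show ?thesis
  proof cases
    case 1
    have "frag_extend (retract c) r = 0"
      unfolding 1(1) using 1(2,3)
      by (simp add: retract_def tensor_coords_def frag_extend_linear coord_mult otimes_bilinear)
    then show ?thesis by (simp add: zspan.zero)
  next
    case 2
    have "frag_extend (retract c) r = frag_extend to_tree (frag_extend (regraft_by c)
        (otimes (coord g) (frag_extend expand
          (representative (k \<otimes>\<^bsub>L\<^esub> k') - representative k - representative k'))))"
      unfolding 2(1)
      by (simp add: retract_def tensor_coords_def frag_extend_linear otimes_bilinear)
    then show ?thesis
      using regraft_by_lie expand_quasi_lie_ideal representative_mult[OF 2(3,4)] by simp
  qed
qed

lemma retract_to_tensor:
  assumes a: "a \<in> basis" and w: "letters w \<subseteq> basis" "word_length w = n + 1"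
  shows "frag_extend (retract c) (to_tensor (a, w)) - frag_extend to_tree (regraft_by c (a, w))
    \<in> zspan tree_rels"
proof -
  have H: "a \<in> carrier H" "coord a = frag_of a" "w \<in> deg (n + 1)"
    using a w basis_words by (auto simp: basis_def)
  let ?q = "frag_extend expand (representative (cls (frag_of w)) - frag_of w)"
  have "?q \<in> zspan lie_relators"
    using H(3) by (intro expand_quasi_lie_ideal representative_cls) auto
  then have "frag_extend to_tree (frag_extend (regraft_by c) (otimes (frag_of a) ?q)) \<in> zspan tree_rels"
    by (rule regraft_by_lie)
  then show ?thesis
    using H by (simp add: to_tensor_def retract_def tensor_coords_def frag_extend_linear
        otimes_bilinear expand_basis[OF w(1)])
qed

lemma expand_keys_representative:
  assumes "X \<in> carrier L"
  shows "Poly_Mapping.keys (frag_extend expand (representative X))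
    \<subseteq> {w. letters w \<subseteq> basis \<and> word_length w = n + 1}"
proof (rule keys_frag_extendI)
  fix s assume "s \<in> Poly_Mapping.keys (representative X)"
  then have "s \<in> deg (n + 1)" using representative(1)[OF assms] by blast
  then show "Poly_Mapping.keys (expand s) \<subseteq> {w. letters w \<subseteq> basis \<and> word_length w = n + 1}"
    using keys_expand[of s] by auto
qed

lemma tensor_coords_keys:
  assumes "s \<in> carrier H \<times> carrier L"
  shows "Poly_Mapping.keys (tensor_coords s)
    \<subseteq> basis \<times> {w. letters w \<subseteq> basis \<and> word_length w = n + 1}"
proof -
  obtain h X where s: "s = (h, X)" "h \<in> carrier H" "X \<in> carrier L" using assms by blast
  have "Poly_Mapping.keys (tensor_coords s)
      \<subseteq> Poly_Mapping.keys (coord h) \<times> Poly_Mapping.keys (frag_extend expand (representative X))"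
    unfolding s tensor_coords_def prod.case by (rule keys_otimes)
  then show ?thesis
    using coord_keys[OF s(2)] expand_keys_representative[OF s(3)] unfolding basis_def by blast
qed

lemma to_tensor_coords:
  assumes "s \<in> carrier H \<times> carrier L"
  shows "frag_of s - frag_extend to_tensor (tensor_coords s) \<in> zspan tensor_rels"
proof -
  obtain h X where s: "s = (h, X)" "h \<in> carrier H" "X \<in> carrier L" using assms by blast
  let ?x = "representative X" and ?y = "frag_extend expand (representative X)"
  note x = representative[OF s(3)]
  have y: "Poly_Mapping.keys ?y \<subseteq> deg (n + 1)"
    using expand_keys_representative[OF s(3)] basis_words by blast
  have "?x - ?y = frag_extend (\<lambda>w. frag_of w - expand w) ?x"
    using frag_expansion[of ?x] by (simp add: frag_extend_fun_diff)
  also have "\<dots> \<in> zspan (quasi_lie_ideal H)"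
    using x(1) by (intro zspan_frag_extend) (auto intro: expand_cong)
  finally have "cls ?y = X" using x(2) zspan_sym[of ?x ?y] cls_eq_iff by fastforce
  then have 1: "frag_of (h, X) - frag_extend to_tensor (otimes (frag_of h) ?y) \<in> zspan tensor_rels"
    using zspan_sym[OF to_tensor_cls[OF s(2) y]] by simp
  have 2: "frag_extend to_tensor (otimes (frag_of h) ?y)
      - frag_extend (\<lambda>h. frag_extend to_tensor (otimes (frag_of h) ?y)) (coord h) \<in> zspan tensor_rels"
  proof (rule additive_eq_coord[OF _ s(2)])
    fix a b assume ab: "a \<in> carrier H" "b \<in> carrier H"
    show "frag_extend to_tensor (otimes (frag_of (a \<otimes>\<^bsub>H\<^esub> b)) ?y)
        - frag_extend to_tensor (otimes (frag_of a) ?y) - frag_extend to_tensor (otimes (frag_of b) ?y)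
      \<in> zspan tensor_rels"
    proof (rule frag_zspan_ext[where x = ?y], goal_cases)
      case (2 w)
      then have w: "w \<in> deg (n + 1)" using y by blast
      show ?case
        using tensor_additive_left[OF ab cls_closed[of "frag_of w"]] ab w by (simp add: to_tensor_def)
    qed (simp add: otimes_bilinear frag_extend_linear)
  qed
  have 3: "frag_extend (\<lambda>h. frag_extend to_tensor (otimes (frag_of h) ?y)) (coord h)
      = frag_extend to_tensor (tensor_coords s)"
    unfolding s tensor_coords_def prod.case
    by (rule frag_linear_ext[where x = "coord h"])
       (simp_all add: otimes_bilinear frag_extend_linear)
  show ?thesis using zspan_trans[OF 1 2] unfolding 3 s(1) .
qed

lemma eta_frag_regraft:
  assumes "a \<in> carrier H" "w \<in> deg (n + 1)"
  shows "frag_extend eta_frag (frag_extend to_tree (regraft_by c (a, w)))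
    = frag_extend to_tensor (frag_extend leaf_sum (regraft_by c (a, w)))"
  using assms eta_frag_cut(1)[OF word_tree_cut(1)[of "Letter a" w]]
  by (simp add: regraft_by_def regraft_def to_tree_def frag_extend_linear)

text \<open>
  By linearity it suffices to consider trees labelled by basis elements; for these the claim is
  \<open>regraft_by_leaf_sum\<close>. The assumption on \<open>c\<close> is a congruence, because with a single letter the
  total weight is not \<open>N\<close> itself.
\<close>

lemma retract_eta:
  assumes total: "\<And>u v. word_length u + word_length v = n + 2 \<Longrightarrow>
      frag_cmul (total c (letter_mset u + letter_mset v)) (frag_of (u, v)) - frag_cmul N (frag_of (u, v))
        \<in> zspan (pair_relators :: ('a word \<times> 'a word \<Rightarrow>\<^sub>0 int) set)"
    and z: "Poly_Mapping.keys z \<subseteq> trees"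
  shows "frag_extend (retract c) (frag_extend eta_frag z) - frag_cmul N z \<in> zspan tree_rels"
proof -
  define \<Phi> where "\<Phi> z = frag_extend (retract c) (frag_extend eta_frag z) - frag_cmul N z" for z
  have \<Phi>_diff: "\<Phi> (x - y) = \<Phi> x - \<Phi> y" for x y
    by (simp add: \<Phi>_def frag_extend_linear frag_cmul_diff_distrib2)
  have \<Phi>_rels: "\<Phi> x \<in> zspan tree_rels" if x: "x \<in> zspan tree_rels" for x
  proof -
    have "frag_extend eta_frag x \<in> zspan tensor_rels"
      using x by (rule frag_extend_zspan) (rule eta_frag_rels)
    then have "frag_extend (retract c) (frag_extend eta_frag x) \<in> zspan tree_rels"
      by (rule frag_extend_zspan) (rule retract_rels)
    then show ?thesis unfolding \<Phi>_def using x by (intro zspan.diff zspan_cmul)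
  qed
  have basis: "\<Phi> (to_tree (u, v)) \<in> zspan tree_rels"
    if uv: "letters u \<subseteq> basis" "letters v \<subseteq> basis" "word_length u + word_length v = n + 2" for u v
  proof -
    have words: "u \<in> words H" "v \<in> words H" using uv basis_words by auto
    have "frag_extend eta_frag (to_tree (u, v)) = frag_extend to_tensor (leaf_sum (u, v))"
      using eta_frag_cut(1)[OF word_tree_cut(1)[OF words uv(3)]] words uv(3) by (simp add: to_tree_def)
    moreover have "frag_extend (retract c) (frag_extend to_tensor (leaf_sum (u, v)))
        - frag_extend to_tree (frag_extend (regraft_by c) (leaf_sum (u, v))) \<in> zspan tree_rels"
      unfolding frag_extend_frag_extend
    proof (rule frag_extend_cong_zspan)
      fix s assume s: "s \<in> Poly_Mapping.keys (leaf_sum (u, v))"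
      obtain a w where aw: "s = (a, w)" by (cases s)
      show "frag_extend (retract c) (to_tensor s) - frag_extend to_tree (regraft_by c s)
        \<in> zspan tree_rels"
        unfolding aw by (intro retract_to_tensor leaf_sum_keys[OF uv s[unfolded aw]])
    qed
    moreover have "frag_extend to_tree (frag_extend (regraft_by c) (leaf_sum (u, v)))
        - frag_extend to_tree (frag_cmul N (frag_of (u, v))) \<in> zspan tree_rels"
      by (rule to_tree_pair_cong) (rule zspan_trans[OF regraft_by_leaf_sum total[OF uv(3)]])
    ultimately show ?thesis
      unfolding \<Phi>_def by (simp add: frag_extend_linear) (blast intro: zspan_trans)
  qed
  have "\<Phi> z \<in> zspan tree_rels"
  proof (rule frag_zspan_ext[where x = z and F = \<Phi>, OF \<Phi>_diff])
    fix T assume "T \<in> Poly_Mapping.keys z"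
    then have "T \<in> trees" using z by blast
    then obtain e u v where cut: "cut_tree H T n e u v" using cut_tree_exists by blast
    then interpret cut_tree H T n e u v .
    have words: "u \<in> words H" "v \<in> words H" using letters_words by (auto simp: words_def)
    let ?x = "otimes (expand u) (expand v)"
    have "frag_of T - frag_extend to_tree ?x \<in> zspan tree_rels"
      using to_tree_cut[OF cut] to_tree_expand[OF words] by (rule zspan_trans)
    then have "\<Phi> (frag_of T) - \<Phi> (frag_extend to_tree ?x) \<in> zspan tree_rels"
      unfolding \<Phi>_diff[symmetric] by (rule \<Phi>_rels)
    moreover have "\<Phi> (frag_extend to_tree ?x) \<in> zspan tree_rels"
    proof (rule frag_zspan_ext[where x = ?x and F = "\<lambda>x. \<Phi> (frag_extend to_tree x)"])
      fix s assume s: "s \<in> Poly_Mapping.keys ?x"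
      obtain u' v' where uv: "s = (u', v')" by (cases s)
      then have "u' \<in> Poly_Mapping.keys (expand u)" "v' \<in> Poly_Mapping.keys (expand v)"
        using s keys_otimes[of "expand u" "expand v"] by auto
      then have "letters u' \<subseteq> basis \<and> word_length u' = word_length u"
          "letters v' \<subseteq> basis \<and> word_length v' = word_length v"
        using keys_expand[OF words(1)] keys_expand[OF words(2)] by blast+
      then show "\<Phi> (frag_extend to_tree (frag_of s)) \<in> zspan tree_rels"
        unfolding uv frag_extend_of using word_length_words by (intro basis) simp_all
    qed (simp add: frag_extend_linear \<Phi>_diff)
    ultimately show "\<Phi> (frag_of T) \<in> zspan tree_rels" by (rule zspan_subst)
  qed
  then show ?thesis by (simp add: \<Phi>_def)
qed

text \<open>
  By \<open>homotopy_by_bracket\<close> the two sides differ by the image of the bracket of \<open>y\<close> under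
  \<^const>\<open>homotopy_by\<close>, which respects the Lie relations.
\<close>

lemma eta_retract:
  assumes total: "\<And>a w. word_length w = n + 1 \<Longrightarrow>
      frag_cmul (total c (add_mset a (letter_mset w))) (frag_of (a, w)) - frag_of (a, w)
        \<in> zspan (tensor_relators :: ('a \<times> 'a word \<Rightarrow>\<^sub>0 int) set)"
    and y: "Poly_Mapping.keys y \<subseteq> carrier H \<times> carrier L"
    and bracket: "frag_extend bracket_frag y \<in> quasi_lie_ideal H"
  shows "y - frag_extend eta_frag (frag_extend (retract c) y) \<in> zspan tensor_rels"
proof -
  let ?T = "frag_extend to_tensor"
  define t where "t = frag_extend tensor_coords y"
  have keys_t: "Poly_Mapping.keys t \<subseteq> basis \<times> {w. letters w \<subseteq> basis \<and> word_length w = n + 1}"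
    unfolding t_def using tensor_coords_keys y by (intro keys_frag_extendI) blast
  have "frag_extend frag_of y - frag_extend (\<lambda>s. ?T (tensor_coords s)) y \<in> zspan tensor_rels"
    using y to_tensor_coords by (intro frag_extend_cong_zspan) blast
  then have y_t: "y - ?T t \<in> zspan tensor_rels"
    using frag_expansion[of y] by (simp add: t_def frag_extend_frag_extend)
  have eta: "frag_extend eta_frag (frag_extend (retract c) y)
      = frag_extend (\<lambda>s. ?T (frag_extend leaf_sum (regraft_by c s))) t"
  proof -
    have "frag_extend eta_frag (frag_extend (retract c) y)
        = frag_extend (\<lambda>s. frag_extend eta_frag (frag_extend to_tree (regraft_by c s))) t"
      unfolding t_def retract_def[abs_def] frag_extend_frag_extend ..
    also have "\<dots> = frag_extend (\<lambda>s. ?T (frag_extend leaf_sum (regraft_by c s))) t"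
    proof (rule frag_extend_eq)
      fix s assume "s \<in> Poly_Mapping.keys t"
      then obtain a w where s: "s = (a, w)" "a \<in> basis" "letters w \<subseteq> basis" "word_length w = n + 1"
        using keys_t by blast
      then have "a \<in> carrier H" "w \<in> deg (n + 1)" using basis_words by (auto simp: basis_def)
      then show "frag_extend eta_frag (frag_extend to_tree (regraft_by c s))
          = ?T (frag_extend leaf_sum (regraft_by c s))"
        unfolding s(1) by (rule eta_frag_regraft)
    qed
    finally show ?thesis .
  qed
  let ?br = "\<lambda>(a, w). frag_of (Br (Letter a) w)"
  have br: "frag_extend ?br t = frag_extend expand (frag_extend bracket_frag y)"
  proof -
    have "frag_extend ?br (otimes x z) = word_mult (frag_extend (\<lambda>a. frag_of (Letter a)) x) z" for x z
    proof (rule frag_linear_ext[where x = x], goal_cases)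
      case (3 a)
      show ?case
        by (rule frag_linear_ext[where x = z])
           (simp_all add: otimes_bilinear word_mult_bilinear frag_extend_linear)
    qed (simp_all add: otimes_bilinear word_mult_bilinear frag_extend_linear)
    then have "frag_extend ?br (tensor_coords s) = frag_extend expand (bracket_frag s)" for s
      by (cases s) (simp add: tensor_coords_def bracket_frag_def expand_word_mult)
    then show ?thesis by (simp add: t_def frag_extend_frag_extend)
  qed
  have "frag_extend (homotopy_by c) (frag_extend ?br t) \<in> zspan tensor_relators"
    unfolding br using bracket by (intro homotopy_by_lie expand_quasi_lie_ideal)
  then have hom: "?T (frag_extend (homotopy_by c) (frag_extend ?br t)) \<in> zspan tensor_rels"
    by (rule to_tensor_tensor_relators)
  have "frag_extend (\<lambda>s. frag_extend (homotopy_by c) (?br s) + frag_extend leaf_sum (regraft_by c s)) t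
      - frag_extend frag_of t \<in> zspan tensor_relators"
  proof (rule frag_extend_cong_zspan)
    fix s assume "s \<in> Poly_Mapping.keys t"
    then obtain a w where "s = (a, w)" "word_length w = n + 1" using keys_t by blast
    then show "frag_extend (homotopy_by c) (?br s) + frag_extend leaf_sum (regraft_by c s) - frag_of s
        \<in> zspan tensor_relators"
      using total[of w a] homotopy_by_bracket[of c a w] by simp
  qed
  then have "frag_extend (homotopy_by c) (frag_extend ?br t)
      + frag_extend (\<lambda>s. frag_extend leaf_sum (regraft_by c s)) t - t \<in> zspan tensor_relators"
    using frag_expansion[of t] by (simp add: frag_extend_fun_add frag_extend_frag_extend)
  from to_tensor_tensor_relators[OF this]
  have "?T (frag_extend (homotopy_by c) (frag_extend ?br t))
      + frag_extend eta_frag (frag_extend (retract c) y) - ?T t \<in> zspan tensor_rels"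
    unfolding eta by (simp add: frag_extend_linear frag_extend_frag_extend)
  from zspan.diff[OF hom this]
  have "?T t - frag_extend eta_frag (frag_extend (retract c) y) \<in> zspan tensor_rels"
    by (simp add: algebra_simps)
  with y_t show ?thesis by (rule zspan_trans)
qed

end


section \<open>Prime powers\<close>

text \<open>
  If all letters are equal, their number is the whole degree \<open>p ^ k\<close>, so that weight one gives the
  multiple \<open>p ^ k\<close> instead of \<open>p ^ (k - 1)\<close>. This does no harm, because in this case everything is
  killed by two and the difference of the two multiples is even.
\<close>

definition prime_weights :: "nat \<Rightarrow> nat \<Rightarrow> 'a multiset \<Rightarrow> 'a \<Rightarrow> int" where
  "prime_weights p k m = (if \<exists>a. set_mset m \<subseteq> {a} then (\<lambda>_. 1)
     else (SOME c. (\<Sum>a\<in>#m. c a) = int (p ^ (k - 1))))"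

lemma total_prime_weights:
  assumes "prime p" "k \<ge> 1" "size m = p ^ k"
  shows "(\<exists>a. set_mset m \<subseteq> {a}) \<and> total (prime_weights p k) m = int (p ^ k)
    \<or> total (prime_weights p k) m = int (p ^ (k - 1))"
proof (cases "\<exists>a. set_mset m \<subseteq> {a}")
  case True
  then show ?thesis using assms(3) by (simp add: total_def prime_weights_def)
next
  case False
  from someI_ex[OF prime_power_weights[OF assms False]] show ?thesis
    using False by (simp add: total_def prime_weights_def)
qed

lemma even_prime_power_diff:
  assumes "prime (p :: nat)" "k \<ge> 1" "p ^ k \<ge> 3"
  shows "even (int (p ^ k) - int (p ^ (k - 1)))"
proof (cases "p = 2")
  case True
  then have "k \<noteq> 1" using assms(3) by auto
  then have "even (p ^ k)" "even (p ^ (k - 1))" using True assms(2) by auto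
  then show ?thesis by simp
next
  case False
  then have "odd p" using assms(1) prime_odd_nat prime_ge_2_nat[of p] by simp
  then show ?thesis by simp
qed

lemma double_pair:
  assumes "letters u \<subseteq> {a}" "letters v \<subseteq> {a}" "word_length u + word_length v \<ge> 3"
  shows "frag_cmul 2 (frag_of (u, v)) \<in> zspan pair_relators"
proof (cases "word_length v \<ge> 2")
  case True
  then show ?thesis
    using otimes_zspan_lie_right[OF double_single_letter[OF assms(2)], of "frag_of u"]
    by (simp add: otimes_bilinear)
next
  case False
  then have "word_length u \<ge> 2" using assms(3) by linarith
  then have "frag_cmul 2 (frag_of (v, u)) \<in> zspan pair_relators"
    using otimes_zspan_lie_right[OF double_single_letter[OF assms(1)], of "frag_of v"]
    by (simp add: otimes_bilinear)
  moreover have "frag_cmul 2 (frag_of (u, v) - frag_of (v, u)) \<in> zspan pair_relators"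
    by (intro zspan_cmul zspan.gen pair_relators.swap)
  ultimately show ?thesis
    unfolding frag_cmul_diff_distrib2 by (blast intro: zspan_subst)
qed

lemma prime_weights_pair:
  assumes p: "prime p" "k \<ge> 1" and n: "n \<ge> 1" "n + 2 = p ^ k"
    and uv: "word_length u + word_length v = n + 2"
  shows "frag_cmul (total (prime_weights p k) (letter_mset u + letter_mset v)) (frag_of (u, v))
    - frag_cmul (int (p ^ (k - 1))) (frag_of (u, v)) \<in> zspan pair_relators"
proof -
  let ?m = "letter_mset u + letter_mset v"
  have "size ?m = p ^ k" using uv n by simp
  from total_prime_weights[OF p this] show ?thesis
  proof (elim disjE conjE exE)
    fix a assume a: "set_mset ?m \<subseteq> {a}" and t: "total (prime_weights p k) ?m = int (p ^ k)"
    obtain j where j: "int (p ^ k) - int (p ^ (k - 1)) = 2 * j"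
      using even_prime_power_diff[OF p] n unfolding dvd_def by auto
    have "frag_cmul j (frag_cmul 2 (frag_of (u, v))) \<in> zspan pair_relators"
      using a uv n by (intro zspan_cmul double_pair[of u a v]) auto
    then show ?thesis
      unfolding t frag_cmul_diff_distrib[symmetric] j by (simp add: mult.commute)
  qed (simp add: zspan.zero)
qed

lemma prime_weights_tensor:
  assumes p: "prime p" and n: "n \<ge> 1" "n + 2 = p" and w: "word_length w = n + 1"
  shows "frag_cmul (total (prime_weights p 1) (add_mset a (letter_mset w))) (frag_of (a, w))
    - frag_of (a, w) \<in> zspan tensor_relators"
proof -
  let ?m = "add_mset a (letter_mset w)"
  have "size ?m = p ^ 1" using w n by simp
  from total_prime_weights[OF p order.refl this] show ?thesis
  proof (elim disjE conjE exE)
    fix b assume b: "set_mset ?m \<subseteq> {b}" and t: "total (prime_weights p 1) ?m = int (p ^ 1)"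
    obtain j where j: "int p - 1 = 2 * j"
      using even_prime_power_diff[OF p, of 1] n unfolding dvd_def by auto
    have "frag_cmul 2 (frag_of w) \<in> zspan lie_relators"
      using b w n by (intro double_single_letter[of w b]) auto
    then have "branch_sum (Letter a) (frag_cmul 2 (frag_of w)) \<in> zspan tensor_relators"
      by (rule branch_sum_lie_right)
    then have "frag_cmul 2 (frag_of (a, w)) \<in> zspan tensor_relators"
      by (simp add: otimes_bilinear)
    then have "frag_cmul j (frag_cmul 2 (frag_of (a, w))) \<in> zspan tensor_relators"
      by (rule zspan_cmul)
    then have "frag_cmul (int p - 1) (frag_of (a, w)) \<in> zspan tensor_relators"
      unfolding j by (simp add: mult.commute)
    then show ?thesis unfolding t by (simp add: frag_cmul_diff_distrib)
  qed (simp_all add: zspan.zero)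
qed

context tree_maps
begin

lemma tree_class_cases:
  assumes "X \<in> carrier (tree_group H n)"
  obtains z where "X = frag_class tree_rels z" "Poly_Mapping.keys z \<subseteq> trees"
  using assms unfolding TG.carrier_eq by blast

lemma eta_frag_extend_keys:
  assumes "Poly_Mapping.keys z \<subseteq> trees"
  shows "Poly_Mapping.keys (frag_extend eta_frag z) \<subseteq> carrier H \<times> carrier L"
proof (rule keys_frag_extendI)
  fix T assume "T \<in> Poly_Mapping.keys z"
  then have "T \<in> trees" using assms by blast
  then show "Poly_Mapping.keys (eta_frag T) \<subseteq> carrier H \<times> carrier L"
    using cut_tree_exists eta_frag_cut(2) by metis
qed

lemma kernel_annihilated:
  assumes p: "prime p" "k \<ge> 1" and n: "n \<ge> 1" "n + 2 = p ^ k"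
    and z: "Poly_Mapping.keys z \<subseteq> trees" "frag_extend eta_frag z \<in> zspan tensor_rels"
  shows "frag_cmul (int (p ^ (k - 1))) z \<in> zspan tree_rels"
proof -
  let ?R = "frag_extend (retract (prime_weights p k)) (frag_extend eta_frag z)"
  have "?R - frag_cmul (int (p ^ (k - 1))) z \<in> zspan tree_rels"
    using prime_weights_pair[OF p n] z(1) by (rule retract_eta)
  moreover have "?R \<in> zspan tree_rels"
    using z(2) by (rule frag_extend_zspan) (rule retract_rels)
  ultimately show ?thesis by (metis zspan_subst zspan_sym)
qed

lemma eta_iso:
  assumes p: "prime (n + 2)" and n: "n \<ge> 1"
  shows "eta H n \<in> iso (tree_group H n) (D_group H n)"
proof -
  have D: "carrier (D_group H n) = {Y \<in> carrier (tensor H L). beta H n Y = \<one>\<^bsub>quasi_lie_deg H (n + 2)\<^esub>}"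
    "monoid.mult (D_group H n) = monoid.mult (tensor H L)"
    by (simp_all add: D_group_def kernel_def)
  interpret G: comm_group "tree_group H n" by (rule TG.comm_group)
  have "eta H n \<in> hom (tree_group H n) (D_group H n)"
  proof (rule homI)
    fix X assume "X \<in> carrier (tree_group H n)"
    then obtain z where z: "X = frag_class tree_rels z" "Poly_Mapping.keys z \<subseteq> trees"
      by (rule tree_class_cases)
    have "frag_extend (\<lambda>T. frag_extend bracket_frag (eta_frag T)) z \<in> zspan (quasi_lie_ideal H)"
    proof (rule zspan_frag_extend)
      fix T assume "T \<in> Poly_Mapping.keys z"
      then show "frag_extend bracket_frag (eta_frag T) \<in> zspan (quasi_lie_ideal H)"
        using z(2) beta_eta by auto
    qed
    then have "beta H n (eta H n X) = \<one>\<^bsub>quasi_lie_deg H (n + 2)\<^esub>"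
      unfolding z(1) eta_class[OF z(2)] beta_class[OF eta_frag_extend_keys[OF z(2)]]
      by (simp only: L2.one_iff frag_extend_frag_extend)
    then show "eta H n X \<in> carrier (D_group H n)"
      unfolding D(1) z(1) eta_class[OF z(2)]
      using TL.closed[of "frag_extend eta_frag z"] eta_frag_extend_keys[OF z(2)] by blast
  next
    fix X Y assume "X \<in> carrier (tree_group H n)" "Y \<in> carrier (tree_group H n)"
    then obtain x y where x: "X = frag_class tree_rels x" "Poly_Mapping.keys x \<subseteq> trees"
      and y: "Y = frag_class tree_rels y" "Poly_Mapping.keys y \<subseteq> trees"
      by (meson tree_class_cases)
    have xy: "Poly_Mapping.keys (x + y) \<subseteq> trees" using x(2) y(2) keys_add[of x y] by blast
    show "eta H n (X \<otimes>\<^bsub>tree_group H n\<^esub> Y) = eta H n X \<otimes>\<^bsub>D_group H n\<^esub> eta H n Y"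
      using TG.mult[of x y] x y TL.mult[of "frag_extend eta_frag x" "frag_extend eta_frag y"]
        eta_frag_extend_keys[OF x(2)] eta_frag_extend_keys[OF y(2)]
        eta_class[OF x(2)] eta_class[OF y(2)] eta_class[OF xy]
      by (simp add: D(2) frag_extend_linear)
  qed
  moreover have "inj_on (eta H n) (carrier (tree_group H n))"
  proof (rule inj_onI)
    fix X Y assume "X \<in> carrier (tree_group H n)" "Y \<in> carrier (tree_group H n)"
      and eq: "eta H n X = eta H n Y"
    then obtain x y where x: "X = frag_class tree_rels x" "Poly_Mapping.keys x \<subseteq> trees"
      and y: "Y = frag_class tree_rels y" "Poly_Mapping.keys y \<subseteq> trees"
      by (meson tree_class_cases)
    have xy: "Poly_Mapping.keys (x - y) \<subseteq> trees" using x(2) y(2) keys_diff[of x y] by blast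
    have "frag_extend eta_frag (x - y) \<in> zspan tensor_rels"
      using eq unfolding x(1) y(1) eta_class[OF x(2)] eta_class[OF y(2)] frag_class_eq_iff
      by (simp add: frag_extend_linear)
    from kernel_annihilated[OF p _ n _ xy this, of 1] show "X = Y"
      unfolding x(1) y(1) frag_class_eq_iff by simp
  qed
  moreover have "carrier (D_group H n) \<subseteq> eta H n ` carrier (tree_group H n)"
  proof
    fix Y assume Y: "Y \<in> carrier (D_group H n)"
    then have tensor: "Y \<in> carrier (tensor H L)" and kernel: "beta H n Y = \<one>\<^bsub>quasi_lie_deg H (n + 2)\<^esub>"
      unfolding D(1) by simp_all
    from tensor obtain y where y: "Y = frag_class tensor_rels y"
        "Poly_Mapping.keys y \<subseteq> carrier H \<times> carrier L"
      unfolding TL.carrier_eq by blast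
    have "frag_class (quasi_lie_ideal H) (frag_extend bracket_frag y) = \<one>\<^bsub>quasi_lie_deg H (n + 2)\<^esub>"
      using kernel unfolding y(1) beta_class[OF y(2)] .
    then have bracket: "frag_extend bracket_frag y \<in> quasi_lie_ideal H"
      unfolding L2.one_iff by simp
    let ?z = "frag_extend (retract (prime_weights (n + 2) 1)) y"
    have z: "Poly_Mapping.keys ?z \<subseteq> trees"
      unfolding retract_def[abs_def]
    proof (intro keys_frag_extendI)
      fix s :: "'a word \<times> 'a word"
      show "Poly_Mapping.keys (to_tree s) \<subseteq> trees"
        by (cases s) (auto simp: to_tree_def intro: word_tree_cut(2))
    qed
    have "y - frag_extend eta_frag ?z \<in> zspan tensor_rels"
      using prime_weights_tensor[OF p n refl] y(2) bracket by (rule eta_retract)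
    then have "Y = eta H n (frag_class tree_rels ?z)"
      unfolding y(1) eta_class[OF z] frag_class_eq_iff .
    then show "Y \<in> eta H n ` carrier (tree_group H n)"
      using TG.closed[of ?z] z by blast
  qed
  ultimately show ?thesis
    unfolding iso_def bij_betw_def by (auto simp: hom_def)
qed

end

theorem corollary2p6:
  fixes H :: "('a, 'm) monoid_scheme" and n :: nat
  assumes "fg_free_abelian H" and "n \<ge> 1"
  shows "(\<forall>p k :: nat. prime p \<and> k \<ge> 1 \<and> n + 2 = p ^ k \<longrightarrow>
            (\<forall>x \<in> kernel (tree_group H n) (tensor H (quasi_lie_deg H (n + 1))) (eta H n).
               x [^]\<^bsub>tree_group H n\<^esub> (p ^ (k - 1)) = \<one>\<^bsub>tree_group H n\<^esub>))
       \<and> (prime (n + 2) \<longrightarrow> eta H n \<in> iso (tree_group H n) (D_group H n))"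
proof -
  obtain coord where "coordinates H coord" using fg_free_abelian_coordinates[OF assms(1)] by blast
  then interpret tree_maps H coord n unfolding tree_maps_def .
  have "x [^]\<^bsub>tree_group H n\<^esub> (p ^ (k - 1)) = \<one>\<^bsub>tree_group H n\<^esub>"
    if p: "prime p" "k \<ge> 1" "n + 2 = p ^ k"
      and x: "x \<in> kernel (tree_group H n) (tensor H L) (eta H n)" for p k x
  proof -
    have "x \<in> carrier (tree_group H n)" using x by (simp add: kernel_def)
    then obtain z where z: "x = frag_class tree_rels z" "Poly_Mapping.keys z \<subseteq> trees"
      by (rule tree_class_cases)
    have "eta H n x = \<one>\<^bsub>tensor H L\<^esub>" using x by (simp only: kernel_def mem_Collect_eq)
    then have "frag_class tensor_rels (frag_extend eta_frag z) = \<one>\<^bsub>tensor H L\<^esub>"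
      unfolding z(1) eta_class[OF z(2)] .
    then have "frag_cmul (int (p ^ (k - 1))) z \<in> zspan tree_rels"
      unfolding TL.one_iff by (intro kernel_annihilated p assms(2) z(2))
    then show ?thesis
      unfolding z(1) using TG.nat_pow[of z "p ^ (k - 1)"] z(2) TG.one_iff by simp
  qed
  then show ?thesis using eta_iso assms(2) by blast
qed

end
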